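(* Let $G$ be a countably infinite amenable group with the comparison property, let $\Lambda$ be a finite alphabet, and let $X\subset\Lambda^G$ be an aperiodic, strongly irreducible symbolic dynamical system with the shift action of $G$. Then for every $N\in\mathbb{N}$ (with $N\geq 1$) such that $\log N<h(X)$ there exists a factor map from $X$ onto the full $G$-shift over $N$ symbols, i.e. a continuous surjective map $\pi:X\to\{0,1,\ldots,N-1\}^G$ such that $\pi(gx)=g\pi(x)$ for all $g\in G$ and $x\in X$.
   Context: Shifts: for a finite set $\Lambda$, the full $G$-shift $\Lambda^G$ carries the product topology (with $\Lambda$ discrete) and the action $(gx)(h)=x(hg)$. A symbolic dynamical system (subshift) is a closed, shift-invariant subset $X\subset\Lambda^G$ with this action. Products of sets and elements of $G$ are element-wise: $Tg=\{tg:t\in T\}$, $DT=\{dt:d\in D,t\in T\}$. Blocks: for a finite $T\subset G$, a block with domain $T$ is a function $B:T\to\Lambda$. It occurs in $x\in\Lambda^G$ at position $g$ if $x(tg)=B(t)$ for all $t\in T$, written $x(Tg)=B$. It occurs in $X$ if it occurs in some $x\in X$ (at some position). Strong irreducibility: $X$ is strongly irreducible (with irreducibility distance $D$, a finite subset of $G$ with $e\in D$) if for any blocks $B_1,B_2$ with finite domains $T_1,T_2$ which occur in $X$, and any $g_1,g_2\in G$ with $DT_1g_1\cap T_2g_2=\emptyset$, there exists $x\in X$ such that $x(T_1g_1)=B_1$ and $x(T_2g_2)=B_2$. "Strongly irreducible" means that such a $D$ exists. Aperiodicity: for a finite $P\subset G\setminus\{e\}$, a block $B$ with domain $T$ is $P$-aperiodic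 if for every $p\in P$ there is $t\in T$ such that $tp\in T$ and $B(tp)\neq B(t)$. $X$ is aperiodic if for every finite $P\subset G\setminus\{e\}$ some $P$-aperiodic block occurs in $X$. Entropy: fix a Følner sequence $(F_n)$ of $G$, i.e. a sequence of nonempty finite subsets of $G$ with $|gF_n\bigtriangleup F_n|/|F_n|\to0$ for every $g\in G$. Let $\mathcal{N}_{F_n}(X)$ be the number of different blocks with domain $F_n$ which occur in $X$. Then $h(X)=\lim_{n\to\infty}\frac{1}{|F_n|}\log\mathcal{N}_{F_n}(X)$, which does not depend on the choice of $(F_n)$. Logarithms are to base 2. Comparison property: let $G$ act by homeomorphisms on a zero-dimensional compact metric space $W$. For clopen $A,B\subset W$ write $A\preccurlyeq B$ if there are a finite partition $A=A_1\sqcup\cdots\sqcup A_k$ into clopen sets and $g_1,\ldots,g_k\in G$ such that $g_1A_1,\ldots,g_kA_k$ are pairwise disjoint subsets of $B$. The action admits comparison if, for all clopen $A,B\subset W$, $\mu(A)<\mu(B)$ for every $G$-invariant Borel probability measure $\mu$ on $W$ implies $A\preccurlyeq B$. The countable amenable group $G$ has the comparison property if every action of $G$ by homeomorphisms on a zero-dimensional compact metric space admits comparison. *)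

theory Defs
  imports "HOL-Analysis.Analysis" "HOL-Probability.Probability"
begin

text \<open>
  The group \<open>G\<close> is a type of class \<^class>\<open>group_add\<close>, which is not assumed to be commutative. It is
  written additively: \<open>0\<close> is the neutral element \<open>e\<close>, \<open>d + t\<close> is the product \<open>dt\<close>, and for sets
  the elementwise products \<open>Tg\<close>, \<open>gT\<close>, \<open>DT\<close> are \<open>T + {g}\<close>, \<open>{g} + T\<close>, \<open>D + T\<close>
  (\<^theory>\<open>HOL-Library.Set_Algebras\<close>).
\<close>

subsection \<open>Shifts and factor maps\<close>

definition shift_topology :: "'a set \<Rightarrow> ('g \<Rightarrow> 'a) topology" where
  "shift_topology \<Lambda> = product_topology (\<lambda>_. discrete_topology \<Lambda>) UNIV"

definition full_shift :: "'a set \<Rightarrow> ('g \<Rightarrow> 'a) set" where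
  "full_shift \<Lambda> = {x. \<forall>g. x g \<in> \<Lambda>}"

lemma topspace_shift_topology: "topspace (shift_topology \<Lambda>) = full_shift \<Lambda>"
  by (auto simp: shift_topology_def full_shift_def PiE_def Pi_def)

definition shift :: "'g::group_add \<Rightarrow> ('g \<Rightarrow> 'a) \<Rightarrow> ('g \<Rightarrow> 'a)" where
  "shift g x = (\<lambda>h. x (h + g))"

definition subshift :: "'a set \<Rightarrow> ('g::group_add \<Rightarrow> 'a) set \<Rightarrow> bool" where
  "subshift \<Lambda> X \<longleftrightarrow> closedin (shift_topology \<Lambda>) X \<and> (\<forall>g. \<forall>x\<in>X. shift g x \<in> X)"

definition factor_map ::
  "'a set \<Rightarrow> ('g::group_add \<Rightarrow> 'a) set \<Rightarrow> 'b set \<Rightarrow> ('g \<Rightarrow> 'b) set \<Rightarrow>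
    (('g \<Rightarrow> 'a) \<Rightarrow> ('g \<Rightarrow> 'b)) \<Rightarrow> bool" where
  "factor_map \<Lambda> X \<Gamma> Y \<pi> \<longleftrightarrow>
     continuous_map (subtopology (shift_topology \<Lambda>) X) (subtopology (shift_topology \<Gamma>) Y) \<pi> \<and>
     \<pi> ` X = Y \<and> (\<forall>g. \<forall>x\<in>X. \<pi> (shift g x) = shift g (\<pi> x))"

subsection \<open>Blocks\<close>

definition occurs_at :: "'g::group_add set \<Rightarrow> ('g \<Rightarrow> 'a) \<Rightarrow> ('g \<Rightarrow> 'a) \<Rightarrow> 'g \<Rightarrow> bool" where
  "occurs_at T B x g \<longleftrightarrow> (\<forall>t\<in>T. x (t + g) = B t)"

text \<open>
  A block with domain \<open>T\<close> is represented by the function extending it by \<^const>\<open>undefined\<close>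
  outside \<open>T\<close>, so that different blocks are different functions. A block occurring in
  \<open>X \<subseteq> full_shift \<Lambda>\<close> automatically has its values in \<open>\<Lambda>\<close>.
\<close>

definition blocks :: "('g::group_add \<Rightarrow> 'a) set \<Rightarrow> 'g set \<Rightarrow> ('g \<Rightarrow> 'a) set" where
  "blocks X T = {B \<in> extensional T. \<exists>x\<in>X. \<exists>g. occurs_at T B x g}"

definition irreducibility_distance :: "('g::group_add \<Rightarrow> 'a) set \<Rightarrow> 'g set \<Rightarrow> bool" where
  "irreducibility_distance X D \<longleftrightarrow> finite D \<and> 0 \<in> D \<and>
     (\<forall>T\<^sub>1 T\<^sub>2 B\<^sub>1 B\<^sub>2 g\<^sub>1 g\<^sub>2.
        finite T\<^sub>1 \<longrightarrow> finite T\<^sub>2 \<longrightarrow> B\<^sub>1 \<in> blocks X T\<^sub>1 \<longrightarrow> B\<^sub>2 \<in> blocks X T\<^sub>2 \<longrightarrow>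
        (D + T\<^sub>1 + {g\<^sub>1}) \<inter> (T\<^sub>2 + {g\<^sub>2}) = {} \<longrightarrow>
        (\<exists>x\<in>X. occurs_at T\<^sub>1 B\<^sub>1 x g\<^sub>1 \<and> occurs_at T\<^sub>2 B\<^sub>2 x g\<^sub>2))"

definition strongly_irreducible :: "('g::group_add \<Rightarrow> 'a) set \<Rightarrow> bool" where
  "strongly_irreducible X \<longleftrightarrow> (\<exists>D. irreducibility_distance X D)"

definition aperiodic_block :: "'g::group_add set \<Rightarrow> 'g set \<Rightarrow> ('g \<Rightarrow> 'a) \<Rightarrow> bool" where
  "aperiodic_block P T B \<longleftrightarrow> (\<forall>p\<in>P. \<exists>t\<in>T. t + p \<in> T \<and> B (t + p) \<noteq> B t)"

definition aperiodic :: "('g::group_add \<Rightarrow> 'a) set \<Rightarrow> bool" where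
  "aperiodic X \<longleftrightarrow>
     (\<forall>P. finite P \<and> P \<subseteq> UNIV - {0} \<longrightarrow>
        (\<exists>T B. finite T \<and> B \<in> blocks X T \<and> aperiodic_block P T B))"

subsection \<open>Amenability and entropy\<close>

definition folner_sequence :: "(nat \<Rightarrow> 'g::group_add set) \<Rightarrow> bool" where
  "folner_sequence F \<longleftrightarrow> (\<forall>n. finite (F n) \<and> F n \<noteq> {}) \<and>
     (\<forall>g. (\<lambda>n. real (card (sym_diff ({g} + F n) (F n))) / real (card (F n))) \<longlonglongrightarrow> 0)"

text \<open>
  A countable group is amenable if and only if it has a Folner sequence.
\<close>

definition entropy :: "(nat \<Rightarrow> 'g::group_add set) \<Rightarrow> ('g \<Rightarrow> 'a) set \<Rightarrow> real" where
  "entropy F X = lim (\<lambda>n. log 2 (real (card (blocks X (F n)))) / real (card (F n)))"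

subsection \<open>Comparison\<close>

definition clopenin :: "'w topology \<Rightarrow> 'w set \<Rightarrow> bool" where
  "clopenin W A \<longleftrightarrow> openin W A \<and> closedin W A"

definition zero_dimensional_space :: "'w topology \<Rightarrow> bool" where
  "zero_dimensional_space W \<longleftrightarrow> neighbourhood_base_of (clopenin W) W"

definition acts_by_homeomorphisms :: "'w topology \<Rightarrow> ('g::group_add \<Rightarrow> 'w \<Rightarrow> 'w) \<Rightarrow> bool" where
  "acts_by_homeomorphisms W act \<longleftrightarrow>
     (\<forall>g. homeomorphic_map W W (act g)) \<and>
     (\<forall>w\<in>topspace W. act 0 w = w) \<and>
     (\<forall>g h. \<forall>w\<in>topspace W. act (g + h) w = act g (act h w))"

definition invariant_probability_measure ::
  "'w topology \<Rightarrow> ('g::group_add \<Rightarrow> 'w \<Rightarrow> 'w) \<Rightarrow> 'w measure \<Rightarrow> bool" where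
  "invariant_probability_measure W act \<mu> \<longleftrightarrow>
     prob_space \<mu> \<and> sets \<mu> = sigma_sets (topspace W) {U. openin W U} \<and>
     (\<forall>g. distr \<mu> \<mu> (act g) = \<mu>)"

definition subequivalent ::
  "'w topology \<Rightarrow> ('g::group_add \<Rightarrow> 'w \<Rightarrow> 'w) \<Rightarrow> 'w set \<Rightarrow> 'w set \<Rightarrow> bool" where
  "subequivalent W act A B \<longleftrightarrow>
     (\<exists>(k::nat) P h.
        A = (\<Union>i<k. P i) \<and> disjoint_family_on P {..<k} \<and> (\<forall>i<k. clopenin W (P i)) \<and>
        disjoint_family_on (\<lambda>i. act (h i) ` P i) {..<k} \<and> (\<forall>i<k. act (h i) ` P i \<subseteq> B))"

definition admits_comparison :: "'w topology \<Rightarrow> ('g::group_add \<Rightarrow> 'w \<Rightarrow> 'w) \<Rightarrow> bool" where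
  "admits_comparison W act \<longleftrightarrow>
     (\<forall>A B. clopenin W A \<and> clopenin W B \<and>
        (\<forall>\<mu>. invariant_probability_measure W act \<mu> \<longrightarrow> measure \<mu> A < measure \<mu> B) \<longrightarrow>
        subequivalent W act A B)"

text \<open>
  Types cannot be quantified inside a formula, so the spaces \<open>W\<close> range over all topologies
  carried by subsets of the type \<^typ>\<open>nat \<Rightarrow> bool\<close>, which is used only as a universe of
  cardinality continuum; its own topology plays no role. Nothing is lost: a compact metrizable
  space is second countable, and mapping a point to the set of indices of basic open sets
  containing it injects the space into \<^typ>\<open>nat \<Rightarrow> bool\<close>, so every compact metrizable space is
  homeomorphic to one of these, and actions transfer along the homeomorphism.
\<close>

definition comparison_property :: "'g::group_add itself \<Rightarrow> bool" where
  "comparison_property G \<longleftrightarrow>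
     (\<forall>(W :: (nat \<Rightarrow> bool) topology) (act :: 'g \<Rightarrow> (nat \<Rightarrow> bool) \<Rightarrow> (nat \<Rightarrow> bool)).
        metrizable_space W \<and> compact_space W \<and> zero_dimensional_space W \<and>
        acts_by_homeomorphisms W act \<longrightarrow> admits_comparison W act)"

end

theory Submission
  imports Defs "HOL-Real_Asymp.Real_Asymp"
begin

text \<open>
  A factor map onto the full shift is a local rule, and only surjectivity is at stake. It is enough
  to associate with every \<open>y\<close> in the full shift some code \<open>x \<in> X\<close> such that the symbol of \<open>y\<close> at \<open>g\<close>
  can be read off the symbols of \<open>x\<close> on \<open>K + {g}\<close> for a finite set \<open>K\<close> that depends on neither
  \<open>y\<close> nor \<open>g\<close>: the reading rule extends to all of \<open>X\<close> by giving a default symbol where nothing can be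
  read (\<open>factor_map_from_code\<close>).

  Storage. Fix one quasi-tiling of the group by translates of finitely many very invariant finite
  sets (\<open>quasi_tiling_exists\<close>, the Ornstein-Weiss construction). A tile of size \<open>n\<close> carries at least
  \<open>2 powr (h1 * n)\<close> blocks of \<open>X\<close> with \<open>h1 > log 2 N\<close>, so after small losses it can hold the symbols
  of \<open>y\<close> on its own cells and on \<open>\<beta> * n\<close> further cells (\<open>capacity\<close>), and by strong irreducibility
  blocks of different tiles can be prescribed independently (\<open>irreducible_glue\<close>). Cells without an
  owner are so rare that every translate of a suitable window contains more of these free slots than
  cells without owner (\<open>unbalanced\<close>).

  Assignment of slots. The decoder has to know which slot holds the symbol of a given cell without
  owner. Consider all configurations of cells and slots in which each translate of a fixed window has
  more slots than cells. They form a zero-dimensional compact space on which every invariant measure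
  gives the cells less mass than the slots; comparison then cuts the set of cells into finitely many
  clopen pieces which suitable group elements move to disjoint sets of slots. Clopen sets depend on
  finitely many coordinates, so this is an injective assignment given by a local rule
  (\<open>comparison_matching\<close>).

  Markers. The decoder also has to recover the quasi-tiling from \<open>x\<close>. A filler is a block \<open>u\<close> put
  along a sparse but syndetic set; since the number of blocks grows exponentially with their domain,
  some \<open>u\<close> is absent from two blocks \<open>v0\<close> and \<open>v1\<close> on a domain \<open>V\<close> so large that fillers reach
  every translate of it (\<open>filler_system_exists\<close>). Blocks \<open>v0\<close> and \<open>v1\<close> can then only be found where
  fillers are omitted on purpose. A marker consists of copies of \<open>v0\<close> or \<open>v1\<close> at a finite set \<open>A\<close> of
  positions and of an aperiodic block \<open>A0\<close>. The shape of \<open>A\<close> forces two overlapping markers to differ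
  by an element of a finite set fixed in advance (\<open>rigid_set\<close>), and the aperiodicity of \<open>A0\<close> with
  respect to this set excludes that (\<open>marker_placement\<close>). The choice between \<open>v0\<close> and \<open>v1\<close> gives
  \<open>2 ^ card A\<close> different markers, whereas the space that a marker needs is only quadratic in
  \<open>card A\<close>; so there are enough of them to tell the levels of the quasi-tiling apart
  (\<open>many_labels\<close>).

  The entropy enters through a limit whose existence is itself a consequence of the quasi-tilings
  (\<open>entropy_tendsto\<close>).
\<close>

section \<open>Density along a Folner sequence\<close>

text \<open>
  Right translates are written \<open>T + {g}\<close>; membership in them is always reduced to membership in \<open>T\<close>.
\<close>

lemma mem_translate: "x \<in> T + {g} \<longleftrightarrow> x - g \<in> T" for g :: "'g::group_add"
proof
  assume "x - g \<in> T"
  then have "(x - g) + g \<in> T + {g}" by (rule set_plus_intro) simp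
  then show "x \<in> T + {g}" by simp
qed (auto simp: set_plus_def)

lemma mem_left_translate: "x \<in> {g} + T \<longleftrightarrow> - g + x \<in> T" for g :: "'g::group_add"
proof
  assume "- g + x \<in> T"
  then have "g + (- g + x) \<in> {g} + T" by (intro set_plus_intro) simp_all
  then show "x \<in> {g} + T" by simp
qed (auto simp: set_plus_def)

lemma translate_eq_image: "T + {g} = (\<lambda>t. t + g) ` T" for g :: "'g::group_add"
  by (auto simp: set_plus_def)

lemma finite_translate [simp]: "finite (T + {g}) \<longleftrightarrow> finite T" for g :: "'g::group_add"
  unfolding translate_eq_image by (rule finite_image_iff) (simp add: inj_on_def)

lemma card_translate [simp]: "card (T + {g}) = card T" for g :: "'g::group_add"
  unfolding translate_eq_image by (rule card_image) (simp add: inj_on_def)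

lemma card_left_translate: "card ({g} + T) = card T" for g :: "'g::group_add"
proof -
  have "{g} + T = (\<lambda>t. g + t) ` T" by (auto simp: set_plus_def)
  then show ?thesis by (simp add: card_image inj_on_def)
qed

lemma card_set_plus_le:
  fixes A B :: "'g::group_add set"
  assumes "finite A" "finite B"
  shows "card (A + B) \<le> card A * card B"
proof -
  have "A + B = (\<lambda>(a, b). a + b) ` (A \<times> B)" by (auto simp: set_plus_def)
  then show ?thesis
    using card_image_le[of "A \<times> B" "\<lambda>(a, b). a + b"] assms by (simp add: card_cartesian_product)
qed

lemma card_uminus_image: "card (uminus ` A) = card A" for A :: "'g::group_add set"
  by (rule card_image) (simp add: inj_on_def)

lemma folner_expand:
  fixes F :: "nat \<Rightarrow> 'g::group_add set" and \<delta> :: real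
  assumes F: "folner_sequence F" and K: "finite K" and \<delta>: "\<delta> > 0"
  shows "\<forall>\<^sub>F n in sequentially. real (card ((K + F n) - F n)) \<le> \<delta> * card (F n)"
proof -
  define c where "c = \<delta> / (card K + 1)"
  have c: "c > 0" using \<delta> by (simp add: c_def)
  have "\<forall>\<^sub>F n in sequentially. \<forall>k\<in>K. real (card (sym_diff ({k} + F n) (F n))) / card (F n) < c"
  proof (rule eventually_ball_finite[OF K], rule ballI)
    fix k
    have "(\<lambda>n. real (card (sym_diff ({k} + F n) (F n))) / real (card (F n))) \<longlonglongrightarrow> 0"
      using F unfolding folner_sequence_def by blast
    then show "\<forall>\<^sub>F n in sequentially. real (card (sym_diff ({k} + F n) (F n))) / card (F n) < c"
      using c by (rule order_tendstoD(2))
  qed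
  then show ?thesis
  proof eventually_elim
    case (elim n)
    have fin: "finite (F n)" and ne: "F n \<noteq> {}" using F by (auto simp: folner_sequence_def)
    then have pos: "0 < real (card (F n))" by (simp add: card_gt_0_iff)
    have "(K + F n) - F n \<subseteq> (\<Union>k\<in>K. sym_diff ({k} + F n) (F n))"
      by (auto simp: set_plus_def)
    then have "card ((K + F n) - F n) \<le> card (\<Union>k\<in>K. sym_diff ({k} + F n) (F n))"
      using K fin by (intro card_mono) (auto intro!: finite_set_plus)
    also have "\<dots> \<le> (\<Sum>k\<in>K. card (sym_diff ({k} + F n) (F n)))"
      by (rule card_UN_le[OF K])
    finally have "real (card ((K + F n) - F n)) \<le> (\<Sum>k\<in>K. real (card (sym_diff ({k} + F n) (F n))))"
      by (simp flip: of_nat_sum)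
    also have "\<dots> \<le> (\<Sum>k\<in>K. c * card (F n))"
      by (rule sum_mono) (use elim pos in \<open>auto simp: divide_simps dest!: bspec\<close>)
    also have "\<dots> = (card K * c) * card (F n)" by simp
    also have "\<dots> \<le> \<delta> * card (F n)"
      by (rule mult_right_mono) (use \<delta> in \<open>auto simp: c_def divide_simps\<close>)
    finally show ?case .
  qed
qed

lemma folner_interior:
  fixes F :: "nat \<Rightarrow> 'g::group_add set" and \<delta> :: real
  assumes F: "folner_sequence F" and K: "finite K" and \<delta>: "\<delta> > 0"
  shows "\<forall>\<^sub>F n in sequentially. real (card {g \<in> F n. \<exists>k\<in>K. k + g \<notin> F n}) \<le> \<delta> * card (F n)"
proof -
  define c where "c = \<delta> / (card K + 1)"
  have c: "c > 0" using \<delta> by (simp add: c_def)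
  have "\<forall>\<^sub>F n in sequentially. \<forall>k\<in>K. real (card (({k} + F n) - F n)) \<le> c * card (F n)"
    by (rule eventually_ball_finite[OF K], rule ballI, rule folner_expand[OF F _ c]) simp
  then show ?thesis
  proof eventually_elim
    case (elim n)
    have fin: "finite (F n)" using F by (auto simp: folner_sequence_def)
    have eq: "card {g \<in> F n. k + g \<notin> F n} = card (({k} + F n) - F n)" for k
      by (rule bij_betw_same_card[of "\<lambda>g. k + g"])
         (auto simp: bij_betw_def inj_on_def set_plus_def image_iff)
    have "{g \<in> F n. \<exists>k\<in>K. k + g \<notin> F n} = (\<Union>k\<in>K. {g \<in> F n. k + g \<notin> F n})" by auto
    then have "card {g \<in> F n. \<exists>k\<in>K. k + g \<notin> F n} \<le> (\<Sum>k\<in>K. card {g \<in> F n. k + g \<notin> F n})"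
      using card_UN_le[OF K] by auto
    then have "real (card {g \<in> F n. \<exists>k\<in>K. k + g \<notin> F n}) \<le> (\<Sum>k\<in>K. real (card (({k} + F n) - F n)))"
      unfolding eq by (simp flip: of_nat_sum)
    also have "\<dots> \<le> (\<Sum>k\<in>K. c * card (F n))"
      by (rule sum_mono) (use elim in auto)
    also have "\<dots> = (card K * c) * card (F n)" by simp
    also have "\<dots> \<le> \<delta> * card (F n)"
      by (rule mult_right_mono) (use \<delta> in \<open>auto simp: c_def divide_simps\<close>)
    finally show ?case .
  qed
qed

text \<open>
  For \<open>K\<close> of size \<open>2 * m\<close>, the set \<open>K + F n\<close> has at least \<open>2 * m\<close> elements, while almost invariance
  bounds it by \<open>2 * card (F n)\<close>.
\<close>

lemma folner_card_unbounded:
  fixes F :: "nat \<Rightarrow> 'g::group_add set"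
  assumes F: "folner_sequence F" and inf: "infinite (UNIV :: 'g set)"
  shows "\<forall>\<^sub>F n in sequentially. m \<le> card (F n)"
proof -
  obtain K :: "'g set" where K: "finite K" "card K = 2 * m"
    using infinite_arbitrarily_large[OF inf] by metis
  have "\<forall>\<^sub>F n in sequentially. real (card ((K + F n) - F n)) \<le> 1 * real (card (F n))"
    by (rule folner_expand[OF F K(1)]) simp
  then show ?thesis
  proof eventually_elim
    case (elim n)
    have fin: "finite (F n)" and "F n \<noteq> {}" using F by (auto simp: folner_sequence_def)
    then obtain g where g: "g \<in> F n" by blast
    have "K + {g} \<subseteq> K + F n" using g by (intro set_plus_mono2) auto
    then have "2 * m \<le> card (K + F n)"
      using card_mono[of "K + F n" "K + {g}"] K fin by (simp add: finite_set_plus)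
    also have "\<dots> \<le> card ((K + F n) - F n) + card (F n)"
      using K fin
      by (metis Un_Diff_cancel2 card_Un_le card_mono finite_Diff finite_UnI finite_set_plus order_trans sup_ge1)
    finally show ?case using elim by simp
  qed
qed

text \<open>
  This says that the upper Banach density of \<open>V\<close> is at most \<open>d\<close>. Uniformity in the translate \<open>h\<close> is
  what later allows one finite window to serve at every place of the group.
\<close>

definition density_le :: "(nat \<Rightarrow> 'g::group_add set) \<Rightarrow> 'g set \<Rightarrow> real \<Rightarrow> bool" where
  "density_le F V d \<longleftrightarrow> (\<forall>\<delta>>0. \<forall>\<^sub>F n in sequentially. \<forall>h.
     real (card (V \<inter> (F n + {h}))) \<le> (d + \<delta>) * card (F n))"

lemma density_le_mono:
  assumes F: "folner_sequence F" and "density_le F V d" "V' \<subseteq> V" "d \<le> d'"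
  shows "density_le F V' d'"
  unfolding density_le_def
proof (intro allI impI)
  fix \<delta> :: real assume "\<delta> > 0"
  with assms have "\<forall>\<^sub>F n in sequentially. \<forall>h. real (card (V \<inter> (F n + {h}))) \<le> (d + \<delta>) * card (F n)"
    by (auto simp: density_le_def)
  then show "\<forall>\<^sub>F n in sequentially. \<forall>h. real (card (V' \<inter> (F n + {h}))) \<le> (d' + \<delta>) * card (F n)"
  proof (eventually_elim, intro allI)
    fix n h assume a: "\<forall>h. real (card (V \<inter> (F n + {h}))) \<le> (d + \<delta>) * card (F n)"
    have "finite (F n)" using F by (auto simp: folner_sequence_def)
    then have "card (V' \<inter> (F n + {h})) \<le> card (V \<inter> (F n + {h}))"
      using assms(3) by (intro card_mono) auto
    also have "real \<dots> \<le> (d + \<delta>) * card (F n)" using a by blast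
    also have "\<dots> \<le> (d' + \<delta>) * card (F n)" using assms(4) by (intro mult_right_mono) auto
    finally show "real (card (V' \<inter> (F n + {h}))) \<le> (d' + \<delta>) * card (F n)" by simp
  qed
qed

lemma density_le_UNIV: "folner_sequence F \<Longrightarrow> density_le F V 1"
  unfolding density_le_def
proof (intro allI impI always_eventually)
  fix \<delta> :: real and n h assume F: "folner_sequence F" and "\<delta> > 0"
  have "finite (F n)" using F by (auto simp: folner_sequence_def)
  then have "card (V \<inter> (F n + {h})) \<le> card (F n + {h})" by (intro card_mono) auto
  then have "real (card (V \<inter> (F n + {h}))) \<le> 1 * real (card (F n))" by simp
  also have "\<dots> \<le> (1 + \<delta>) * card (F n)" using \<open>\<delta> > 0\<close> by (intro mult_right_mono) auto
  finally show "real (card (V \<inter> (F n + {h}))) \<le> (1 + \<delta>) * card (F n)" .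
qed

lemma density_le_empty: "density_le F {} 0"
  by (simp add: density_le_def)

lemma density_le_Un:
  assumes "density_le F V d" "density_le F V' d'"
  shows "density_le F (V \<union> V') (d + d')"
  unfolding density_le_def
proof (intro allI impI)
  fix \<delta> :: real assume "\<delta> > 0"
  then have "\<forall>\<^sub>F n in sequentially. \<forall>h. real (card (V \<inter> (F n + {h}))) \<le> (d + \<delta>/2) * card (F n)"
    and "\<forall>\<^sub>F n in sequentially. \<forall>h. real (card (V' \<inter> (F n + {h}))) \<le> (d' + \<delta>/2) * card (F n)"
    using assms by (auto simp: density_le_def)
  then show "\<forall>\<^sub>F n in sequentially. \<forall>h. real (card ((V \<union> V') \<inter> (F n + {h}))) \<le> (d + d' + \<delta>) * card (F n)"
  proof (eventually_elim, intro allI)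
    fix n h assume a: "\<forall>h. real (card (V \<inter> (F n + {h}))) \<le> (d + \<delta>/2) * card (F n)"
      and b: "\<forall>h. real (card (V' \<inter> (F n + {h}))) \<le> (d' + \<delta>/2) * card (F n)"
    have "card ((V \<union> V') \<inter> (F n + {h})) \<le> card (V \<inter> (F n + {h})) + card (V' \<inter> (F n + {h}))"
      by (metis card_Un_le boolean_algebra.conj_disj_distrib2)
    then have "real (card ((V \<union> V') \<inter> (F n + {h})))
        \<le> real (card (V \<inter> (F n + {h}))) + real (card (V' \<inter> (F n + {h})))" by simp
    also have "\<dots> \<le> (d + \<delta>/2) * card (F n) + (d' + \<delta>/2) * card (F n)"
      by (intro add_mono a[rule_format] b[rule_format])
    also have "\<dots> = (d + d' + \<delta>) * card (F n)" by (simp add: algebra_simps)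
    finally show "real (card ((V \<union> V') \<inter> (F n + {h}))) \<le> (d + d' + \<delta>) * card (F n)" .
  qed
qed

lemma density_le_left_translate:
  fixes F :: "nat \<Rightarrow> 'g::group_add set"
  assumes F: "folner_sequence F" and V: "density_le F V d"
  shows "density_le F ({g} + V) d"
  unfolding density_le_def
proof (intro allI impI)
  fix \<delta> :: real assume "\<delta> > 0"
  then have "\<forall>\<^sub>F n in sequentially. \<forall>h. real (card (V \<inter> (F n + {h}))) \<le> (d + \<delta>/2) * card (F n)"
    and "\<forall>\<^sub>F n in sequentially. real (card (({-g} + F n) - F n)) \<le> \<delta>/2 * card (F n)"
    using V folner_expand[OF F, of "{-g}" "\<delta>/2"] by (auto simp: density_le_def)
  then show "\<forall>\<^sub>F n in sequentially. \<forall>h. real (card (({g} + V) \<inter> (F n + {h}))) \<le> (d + \<delta>) * card (F n)"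
  proof (eventually_elim, intro allI)
    fix n h assume a: "\<forall>h. real (card (V \<inter> (F n + {h}))) \<le> (d + \<delta>/2) * card (F n)"
      and b: "real (card (({-g} + F n) - F n)) \<le> \<delta>/2 * card (F n)"
    have fin: "finite (F n)" using F by (auto simp: folner_sequence_def)
    have "card (({g} + V) \<inter> (F n + {h})) = card ({g} + (V \<inter> ({-g} + F n + {h})))"
      by (rule arg_cong[where f = card]) (auto simp: mem_translate mem_left_translate add_diff_eq)
    also have "\<dots> = card (V \<inter> ({-g} + F n + {h}))" by (rule card_left_translate)
    also have "\<dots> \<le> card ((V \<inter> (F n + {h})) \<union> ((({-g} + F n) - F n) + {h}))"
      using fin by (intro card_mono) (auto simp: mem_translate finite_set_plus)
    also have "\<dots> \<le> card (V \<inter> (F n + {h})) + card ((({-g} + F n) - F n) + {h})"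
      by (rule card_Un_le)
    also have "\<dots> = card (V \<inter> (F n + {h})) + card (({-g} + F n) - F n)" by simp
    finally have "real (card (({g} + V) \<inter> (F n + {h})))
      \<le> real (card (V \<inter> (F n + {h}))) + real (card (({-g} + F n) - F n))" by simp
    also have "\<dots> \<le> (d + \<delta>/2) * card (F n) + \<delta>/2 * card (F n)"
      by (intro add_mono a[rule_format] b)
    also have "\<dots> = (d + \<delta>) * card (F n)" by (simp add: algebra_simps)
    finally show "real (card (({g} + V) \<inter> (F n + {h}))) \<le> (d + \<delta>) * card (F n)" .
  qed
qed

lemma density_le_set_plus:
  fixes F :: "nat \<Rightarrow> 'g::group_add set" and d :: real
  assumes F: "folner_sequence F" and K: "finite K" and V: "density_le F V d"
  shows "density_le F (K + V) (card K * d)"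
  using K
proof (induction K rule: finite_induct)
  case empty
  then show ?case by (simp add: set_plus_def density_le_empty)
next
  case (insert k K)
  have "insert k K + V = ({k} + V) \<union> (K + V)" by (auto simp: set_plus_def)
  then show ?case
    using density_le_Un[OF density_le_left_translate[OF F V, of k] insert.IH] insert.hyps
    by (simp add: algebra_simps)
qed

text \<open>
  Mass transport over a bounded distance. Charge the cells of \<open>Y i\<close> to the core \<open>R i\<close>: the cores are
  disjoint subsets of \<open>V\<close> within bounded distance, so a window sees at most \<open>c\<close> times the cells of
  \<open>V\<close> in a slightly larger window. All density estimates for parts of tiles are instances.
\<close>

lemma density_le_tiles:
  fixes F :: "nat \<Rightarrow> 'g::group_add set" and R Y :: "'i \<Rightarrow> 'g set" and c d :: real
  assumes F: "folner_sequence F" and K: "finite K"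
    and disj: "disjoint_family_on R I" and RV: "\<And>i. i \<in> I \<Longrightarrow> R i \<subseteq> V"
    and near: "\<And>i y r. i \<in> I \<Longrightarrow> y \<in> Y i \<Longrightarrow> r \<in> R i \<Longrightarrow> r - y \<in> K"
    and card: "\<And>i. i \<in> I \<Longrightarrow> finite (Y i) \<and> real (card (Y i)) \<le> c * card (R i)"
    and c: "c \<ge> 0" and V: "density_le F V d"
  shows "density_le F (\<Union>i\<in>I. Y i) (c * d)"
  unfolding density_le_def
proof (intro allI impI)
  fix \<delta> :: real assume "\<delta> > 0"
  define \<delta>' where "\<delta>' = \<delta> / (2 * (c + 1))"
  have \<delta>': "\<delta>' > 0" and c\<delta>': "2 * (c * \<delta>') \<le> \<delta>"
    using \<open>\<delta> > 0\<close> c by (auto simp: \<delta>'_def divide_simps)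
  have "\<forall>\<^sub>F n in sequentially. \<forall>h. real (card (V \<inter> (F n + {h}))) \<le> (d + \<delta>') * card (F n)"
    and "\<forall>\<^sub>F n in sequentially. real (card ((K + F n) - F n)) \<le> \<delta>' * card (F n)"
    using V \<delta>' K folner_expand[OF F K \<delta>'] by (auto simp: density_le_def)
  then show "\<forall>\<^sub>F n in sequentially. \<forall>h. real (card ((\<Union>i\<in>I. Y i) \<inter> (F n + {h}))) \<le> (c * d + \<delta>) * card (F n)"
  proof (eventually_elim, intro allI)
    fix n h assume a: "\<forall>h. real (card (V \<inter> (F n + {h}))) \<le> (d + \<delta>') * card (F n)"
      and b: "real (card ((K + F n) - F n)) \<le> \<delta>' * card (F n)"
    have fin: "finite (F n)" using F by (auto simp: folner_sequence_def)
    define B where "B = F n + {h}"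
    have finB: "finite B" "finite (K + B)" using fin K by (auto simp: B_def finite_set_plus)
    define J where "J = {i \<in> I. Y i \<inter> B \<noteq> {}}"
    have RJ: "R i \<subseteq> V \<inter> (K + B)" if i: "i \<in> J" for i
    proof
      fix r assume r: "r \<in> R i"
      obtain y where y: "y \<in> Y i" "y \<in> B" using i by (auto simp: J_def)
      have "r - y \<in> K" using near[of i y r] i r y by (auto simp: J_def)
      then have "(r - y) + y \<in> K + B" using y by (intro set_plus_intro)
      then show "r \<in> V \<inter> (K + B)" using RV i r by (auto simp: J_def)
    qed
    have finRJ: "finite (R i)" if "i \<in> J" for i
      using RJ[OF that] finB(2) by (auto intro: finite_subset)
    have Rne: "R i \<noteq> {}" if i: "i \<in> J" for i
    proof
      assume "R i = {}"
      then have "card (Y i) = 0" using card[of i] i by (auto simp: J_def)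
      then show False using card[of i] i by (auto simp: J_def)
    qed
    have disjJ: "disjoint_family_on R J" using disj by (auto simp: disjoint_family_on_def J_def)
    have "inj_on R J"
      using disjJ Rne unfolding inj_on_def disjoint_family_on_def by (metis Int_absorb)
    moreover have "finite (R ` J)"
      by (rule finite_subset[of _ "Pow (K + B)"]) (use RJ finB in auto)
    ultimately have finJ: "finite J" by (rule finite_imageD[rotated])
    have "card ((\<Union>i\<in>I. Y i) \<inter> B) \<le> card (\<Union>i\<in>J. Y i)"
      using finJ card by (intro card_mono) (auto simp: J_def)
    also have "\<dots> \<le> (\<Sum>i\<in>J. card (Y i))" by (rule card_UN_le[OF finJ])
    finally have "real (card ((\<Union>i\<in>I. Y i) \<inter> B)) \<le> (\<Sum>i\<in>J. real (card (Y i)))"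
      by (simp flip: of_nat_sum)
    also have "\<dots> \<le> (\<Sum>i\<in>J. c * card (R i))"
      by (rule sum_mono) (use card in \<open>auto simp: J_def\<close>)
    also have "\<dots> = c * real (\<Sum>i\<in>J. card (R i))" by (simp add: sum_distrib_left)
    also have "(\<Sum>i\<in>J. card (R i)) = card (\<Union>i\<in>J. R i)"
      using disjJ finJ finRJ
      by (intro card_UN_disjoint[symmetric]) (auto simp: disjoint_family_on_def)
    also have "c * real (card (\<Union>i\<in>J. R i)) \<le> c * real (card (V \<inter> (K + B)))"
      using c RJ finB by (intro mult_left_mono of_nat_mono card_mono) auto
    also have "real (card (V \<inter> (K + B))) \<le> real (card (V \<inter> B) + card ((K + B) - B))"
    proof (rule of_nat_mono)
      have "card (V \<inter> (K + B)) \<le> card ((V \<inter> B) \<union> ((K + B) - B))"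
        using finB by (intro card_mono) auto
      then show "card (V \<inter> (K + B)) \<le> card (V \<inter> B) + card ((K + B) - B)"
        using card_Un_le order_trans by blast
    qed
    also have "card ((K + B) - B) = card (((K + F n) - F n) + {h})"
      by (rule arg_cong[where f = card]) (auto simp: B_def mem_translate add.assoc[symmetric])
    also have "\<dots> = card ((K + F n) - F n)" by simp
    also have "real (card (V \<inter> B) + card ((K + F n) - F n))
        \<le> (d + \<delta>') * card (F n) + \<delta>' * card (F n)"
      using a[rule_format, of h] b by (simp add: B_def)
    also have "c * ((d + \<delta>') * card (F n) + \<delta>' * card (F n)) = (c * d + 2 * (c * \<delta>')) * card (F n)"
      by (simp add: algebra_simps)
    also have "\<dots> \<le> (c * d + \<delta>) * card (F n)"
      using c\<delta>' by (intro mult_right_mono) auto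
    finally show "real (card ((\<Union>i\<in>I. Y i) \<inter> (F n + {h}))) \<le> (c * d + \<delta>) * card (F n)"
      using c by (simp add: B_def mult_left_mono)
  qed
qed

section \<open>Quasi-tilings\<close>

text \<open>
  One level of the Ornstein-Weiss construction. The group is run through in the order of \<open>e\<close>, and a
  translate of \<open>F0\<close> is accepted if it overlaps what is already covered in a proportion of at most
  \<open>\<epsilon>\<close> and its part \<open>Q\<close>, reserved for a marker, is entirely free. The last conclusion is the
  maximality of the choice: a rejected translate meets the covered set in a large proportion or in
  its marker zone.
\<close>

lemma greedy_level:
  fixes U F0 Q :: "'g::group_add set" and \<epsilon> :: real and e :: "nat \<Rightarrow> 'g"
  assumes e: "bij e" and F0: "finite F0" "F0 \<noteq> {}" "Q \<subseteq> F0" and \<epsilon>: "0 < \<epsilon>" "\<epsilon> < 1"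
  obtains C R where
    "\<And>c. c \<in> C \<Longrightarrow> R c \<subseteq> F0 + {c}" "\<And>c. c \<in> C \<Longrightarrow> R c \<inter> U = {}"
    "\<And>c. c \<in> C \<Longrightarrow> (1 - \<epsilon>) * real (card F0) \<le> real (card (R c))"
    "\<And>c. c \<in> C \<Longrightarrow> (Q + {c}) \<inter> U = {}"
    "disjoint_family_on R C" "disjoint_family_on (\<lambda>c. Q + {c}) C"
    "\<And>g. \<epsilon> * real (card F0) \<le> real (card ((F0 + {g}) \<inter> (U \<union> (\<Union>c\<in>C. F0 + {c}))))
       \<or> (Q + {g}) \<inter> (U \<union> (\<Union>c\<in>C. F0 + {c})) \<noteq> {}"
proof -
  define ok where "ok S g \<longleftrightarrow> real (card ((F0 + {g}) \<inter> S)) \<le> \<epsilon> * card F0 \<and> (Q + {g}) \<inter> S = {}"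
    for S :: "'g set" and g
  define cov where "cov = rec_nat U (\<lambda>n S. if ok S (e n) then S \<union> (F0 + {e n}) else S)"
  have cov0: "cov 0 = U"
    and covS: "cov (Suc n) = (if ok (cov n) (e n) then cov n \<union> (F0 + {e n}) else cov n)" for n
    by (simp_all add: cov_def)
  have mono: "cov m \<subseteq> cov n" if "m \<le> n" for m n
    using that by (rule lift_Suc_mono_le[rotated]) (simp add: covS)
  define A where "A = {n. ok (cov n) (e n)}"
  define C where "C = e ` A"
  define R where "R c = (F0 + {c}) - cov (inv e c)" for c
  have inve: "inv e (e n) = n" for n using e by (simp add: bij_is_inj)
  have tile: "F0 + {e n} \<subseteq> cov (Suc n)" if "n \<in> A" for n
    using that by (simp add: covS A_def)
  have covU': "cov n \<subseteq> U \<union> (\<Union>c\<in>C. F0 + {c})" for n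
  proof (induction n)
    case (Suc n)
    show ?case
    proof (cases "n \<in> A")
      case True
      then have "e n \<in> C" by (simp add: C_def)
      then show ?thesis using Suc True by (auto simp: covS A_def)
    next
      case False
      then show ?thesis using Suc by (simp add: covS A_def)
    qed
  qed (simp add: cov0)
  have QF: "Q + {g} \<subseteq> F0 + {g}" for g using F0(3) by (intro set_plus_mono2) auto
  show ?thesis
  proof (rule that[of C R])
    fix c assume "c \<in> C"
    then obtain n where n: "c = e n" "n \<in> A" by (auto simp: C_def)
    have U: "U \<subseteq> cov n" using mono[of 0 n] by (simp add: cov0)
    show "R c \<subseteq> F0 + {c}" by (auto simp: R_def)
    show "R c \<inter> U = {}" using U by (auto simp: R_def n inve)
    show "(Q + {c}) \<inter> U = {}" using n U by (auto simp: A_def ok_def)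
    have "real (card F0) = real (card (F0 + {c}))" by simp
    also have "card (F0 + {c}) = card (R c) + card ((F0 + {c}) \<inter> cov n)"
      using card_Int_Diff[of "F0 + {c}" "cov n"] F0 by (simp add: R_def n inve)
    also have "real \<dots> \<le> real (card (R c)) + \<epsilon> * card F0"
      using n by (simp add: A_def ok_def)
    finally show "(1 - \<epsilon>) * real (card F0) \<le> real (card (R c))" by (simp add: algebra_simps)
  next
    have *: "R (e m) \<inter> R (e n) = {} \<and> (Q + {e m}) \<inter> (Q + {e n}) = {}"
      if "m \<in> A" "n \<in> A" "m < n" for m n
    proof -
      have "F0 + {e m} \<subseteq> cov n" using tile[OF that(1)] mono[of "Suc m" n] that(3) by auto
      moreover have "(Q + {e n}) \<inter> cov n = {}" using that(2) by (simp add: A_def ok_def)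
      ultimately show ?thesis using QF[of "e m"] by (auto simp: R_def inve)
    qed
    have **: "R (e m) \<inter> R (e n) = {} \<and> (Q + {e m}) \<inter> (Q + {e n}) = {}"
      if "m \<in> A" "n \<in> A" "m \<noteq> n" for m n
    proof (cases "m < n")
      case True
      then show ?thesis using * that by blast
    next
      case False
      then have "n < m" using that by simp
      then show ?thesis using *[of n m] that by blast
    qed
    show "disjoint_family_on R C" "disjoint_family_on (\<lambda>c. Q + {c}) C"
      using ** unfolding disjoint_family_on_def C_def by blast+
  next
    fix g
    obtain n where n: "g = e n" using e by (metis bij_pointE)
    let ?U' = "U \<union> (\<Union>c\<in>C. F0 + {c})"
    show "\<epsilon> * real (card F0) \<le> real (card ((F0 + {g}) \<inter> ?U')) \<or> (Q + {g}) \<inter> ?U' \<noteq> {}"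
    proof (cases "n \<in> A")
      case True
      then have "F0 + {g} \<subseteq> ?U'" using tile[OF True] covU'[of "Suc n"] n by simp
      then have "(F0 + {g}) \<inter> ?U' = F0 + {g}" by auto
      then show ?thesis using \<epsilon> by (simp add: mult_left_le_one_le)
    next
      case False
      show ?thesis
      proof (cases "(Q + {g}) \<inter> cov n = {}")
        case True
        then have "\<epsilon> * card F0 < card ((F0 + {g}) \<inter> cov n)"
          using False n by (auto simp: A_def ok_def)
        also have "card ((F0 + {g}) \<inter> cov n) \<le> card ((F0 + {g}) \<inter> ?U')"
          using covU'[of n] F0 by (intro card_mono) auto
        finally show ?thesis by simp
      next
        case False
        then show ?thesis using covU'[of n] by blast
      qed
    qed
  qed
qed

text \<open>
  Where \<open>F0 + {g}\<close> lies in the complement of \<open>U\<close>, what it hits is new. Double counting of such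
  \<open>g\<close> shows that a proportion of at least \<open>\<gamma>\<close> of the complement becomes covered: a cell of the
  new part is responsible for at most \<open>1 / \<epsilon>\<close> (on average) translates hit in a proportion \<open>\<epsilon>\<close>,
  and for at most \<open>card Q\<close> translates hit in the marker zone. The remaining \<open>g\<close> lie near the boundary
  of \<open>U\<close>.
\<close>

lemma density_step:
  fixes U U' F0 Q :: "'g::group_add set" and \<epsilon> d \<delta>\<^sub>0 \<gamma> :: real
  assumes F: "folner_sequence F" and F0: "finite F0" "F0 \<noteq> {}" "Q \<subseteq> F0" and \<epsilon>: "0 < \<epsilon>" "\<epsilon> \<le> 1"
    and sub: "U \<subseteq> U'"
    and hit: "\<And>g. \<epsilon> * real (card F0) \<le> real (card ((F0 + {g}) \<inter> U')) \<or> (Q + {g}) \<inter> U' \<noteq> {}"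
    and d: "density_le F (- U) d"
    and bd: "density_le F {g. g \<notin> U \<and> (F0 + {g}) \<inter> U \<noteq> {}} \<delta>\<^sub>0" and \<delta>\<^sub>0: "\<delta>\<^sub>0 \<ge> 0"
    and \<gamma>: "\<gamma> = 1 / (1 / \<epsilon> + card Q)"
  shows "density_le F (- U') ((1 - \<gamma>) * d + \<delta>\<^sub>0)"
  unfolding density_le_def
proof (intro allI impI)
  fix \<delta> :: real assume "\<delta> > 0"
  define \<delta>' where "\<delta>' = \<delta> / 3"
  have \<delta>': "\<delta>' > 0" using \<open>\<delta> > 0\<close> by (simp add: \<delta>'_def)
  have "1 / \<epsilon> \<ge> 1" using \<epsilon> by simp
  then have ge1: "1 / \<epsilon> + card Q \<ge> 1" by linarith
  then have \<gamma>01: "0 < \<gamma>" "\<gamma> \<le> 1" by (auto simp: \<gamma> divide_simps)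
  have "\<forall>\<^sub>F n in sequentially. \<forall>h. real (card (- U \<inter> (F n + {h}))) \<le> (d + \<delta>') * card (F n)"
    and "\<forall>\<^sub>F n in sequentially. \<forall>h. real (card ({g. g \<notin> U \<and> (F0 + {g}) \<inter> U \<noteq> {}} \<inter> (F n + {h}))) \<le> (\<delta>\<^sub>0 + \<delta>') * card (F n)"
    and "\<forall>\<^sub>F n in sequentially. real (card ((F0 + F n) - F n)) \<le> \<delta>' * card (F n)"
    using d bd \<delta>' folner_expand[OF F F0(1) \<delta>'] by (auto simp: density_le_def)
  then show "\<forall>\<^sub>F n in sequentially. \<forall>h. real (card (- U' \<inter> (F n + {h}))) \<le> ((1 - \<gamma>) * d + \<delta>\<^sub>0 + \<delta>) * card (F n)"
  proof (eventually_elim, intro allI)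
    fix n h
    assume 1: "\<forall>h. real (card (- U \<inter> (F n + {h}))) \<le> (d + \<delta>') * card (F n)"
      and 2: "\<forall>h. real (card ({g. g \<notin> U \<and> (F0 + {g}) \<inter> U \<noteq> {}} \<inter> (F n + {h}))) \<le> (\<delta>\<^sub>0 + \<delta>') * card (F n)"
      and 3: "real (card ((F0 + F n) - F n)) \<le> \<delta>' * card (F n)"
    define B where "B = F n + {h}"
    have finB: "finite B" using F by (auto simp: B_def folner_sequence_def)
    define New where "New = U' - U"
    define Z where "Z = {g. g \<notin> U \<and> (F0 + {g}) \<inter> U \<noteq> {}} \<inter> B"
    define M where "M = (F0 + B) \<inter> New"
    define A\<^sub>1 where "A\<^sub>1 = {g\<in>B. \<epsilon> * card F0 \<le> card ((F0 + {g}) \<inter> New)}"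
    define A\<^sub>2 where "A\<^sub>2 = {g\<in>B. (Q + {g}) \<inter> New \<noteq> {}}"
    have finM: "finite M" using finB F0 by (auto simp: M_def finite_set_plus)
    have finA: "finite A\<^sub>1" "finite A\<^sub>2" using finB by (auto simp: A\<^sub>1_def A\<^sub>2_def)
    have F0g: "F0 + {g} \<subseteq> F0 + B" if "g \<in> B" for g using that by (intro set_plus_mono2) auto
    have cover: "- U \<inter> B \<subseteq> A\<^sub>1 \<union> A\<^sub>2 \<union> Z"
    proof
      fix g assume g: "g \<in> - U \<inter> B"
      show "g \<in> A\<^sub>1 \<union> A\<^sub>2 \<union> Z"
      proof (cases "(F0 + {g}) \<inter> U = {}")
        case True
        moreover have "Q + {g} \<subseteq> F0 + {g}" using F0(3) by (intro set_plus_mono2) auto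
        ultimately have "(F0 + {g}) \<inter> U' = (F0 + {g}) \<inter> New" "(Q + {g}) \<inter> U' = (Q + {g}) \<inter> New"
          by (auto simp: New_def)
        then show ?thesis using hit[of g] g by (auto simp: A\<^sub>1_def A\<^sub>2_def)
      qed (use g in \<open>auto simp: Z_def\<close>)
    qed
    have "A\<^sub>2 \<subseteq> uminus ` Q + M"
    proof
      fix g assume "g \<in> A\<^sub>2"
      then obtain x where x: "g \<in> B" "x \<in> Q + {g}" "x \<in> New" by (auto simp: A\<^sub>2_def)
      then obtain q where q: "q \<in> Q" "x = q + g" by (auto simp: set_plus_def)
      have "x \<in> M" using x q F0(3) by (auto simp: M_def intro!: set_plus_intro)
      then have "- q + x \<in> uminus ` Q + M" using q by (intro set_plus_intro) auto
      then show "g \<in> uminus ` Q + M" using q by (simp add: add.assoc[symmetric])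
    qed
    then have "card A\<^sub>2 \<le> card (uminus ` Q + M)"
      using finM F0 by (intro card_mono finite_set_plus) (auto intro: finite_subset)
    also have "\<dots> \<le> card (uminus ` Q) * card M"
      by (rule card_set_plus_le) (use finM F0 in \<open>auto intro: finite_subset\<close>)
    also have "card (uminus ` Q) = card Q" by (rule card_uminus_image)
    finally have cA2: "real (card A\<^sub>2) \<le> real (card Q) * card M" by (metis of_nat_le_iff of_nat_mult)
    have "\<epsilon> * card F0 * card A\<^sub>1 = (\<Sum>g\<in>A\<^sub>1. \<epsilon> * card F0)" by simp
    also have "\<dots> \<le> (\<Sum>g\<in>A\<^sub>1. real (card ((F0 + {g}) \<inter> New)))"
      by (rule sum_mono) (auto simp: A\<^sub>1_def)
    also have "\<dots> = real (\<Sum>g\<in>A\<^sub>1. card ((F0 + {g}) \<inter> New))" by simp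
    also have "(\<Sum>g\<in>A\<^sub>1. card ((F0 + {g}) \<inter> New)) = card (SIGMA g:A\<^sub>1. (F0 + {g}) \<inter> New)"
      using finA F0 by (intro card_SigmaI[symmetric]) auto
    also have "\<dots> \<le> card (F0 \<times> M)"
    proof (rule card_inj_on_le)
      show "inj_on (\<lambda>(g, x). (x - g, x)) (SIGMA g:A\<^sub>1. (F0 + {g}) \<inter> New)"
        by (auto simp: inj_on_def diff_conv_add_uminus simp del: add_uminus_conv_diff)
      show "(\<lambda>(g, x). (x - g, x)) ` (SIGMA g:A\<^sub>1. (F0 + {g}) \<inter> New) \<subseteq> F0 \<times> M"
        using F0g by (auto simp: M_def A\<^sub>1_def mem_translate)
      show "finite (F0 \<times> M)" using F0 finM by simp
    qed
    finally have "\<epsilon> * card F0 * card A\<^sub>1 \<le> real (card F0) * card M"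
      by (simp add: card_cartesian_product)
    then have cA1: "real (card A\<^sub>1) \<le> card M / \<epsilon>"
      using F0 \<epsilon> by (simp add: field_simps card_gt_0_iff)
    have "card (- U \<inter> B) \<le> card (A\<^sub>1 \<union> A\<^sub>2 \<union> Z)"
      using cover finA finB by (intro card_mono) (auto simp: Z_def)
    also have "\<dots> \<le> card A\<^sub>1 + card A\<^sub>2 + card Z"
      using card_Un_le[of "A\<^sub>1 \<union> A\<^sub>2" Z] card_Un_le[of A\<^sub>1 A\<^sub>2] by linarith
    finally have cU: "real (card (- U \<inter> B)) \<le> card M * (1 / \<epsilon> + card Q) + card Z"
      using cA1 cA2 by (simp add: algebra_simps)
    have cZ: "card Z \<le> (\<delta>\<^sub>0 + \<delta>') * card (F n)" using 2 by (simp add: Z_def B_def)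
    have "\<gamma> * card (- U \<inter> B) \<le> \<gamma> * (card M * (1 / \<epsilon> + card Q) + card Z)"
      using cU \<gamma>01 by (intro mult_left_mono) auto
    also have "\<dots> = card M + \<gamma> * card Z"
      using ge1 by (simp add: \<gamma> divide_simps)
    also have "\<gamma> * card Z \<le> 1 * real (card Z)" using \<gamma>01 by (intro mult_right_mono) auto
    finally have g1: "\<gamma> * card (- U \<inter> B) \<le> card M + (\<delta>\<^sub>0 + \<delta>') * card (F n)" using cZ by simp
    have "card M \<le> card ((New \<inter> B) \<union> ((F0 + B) - B))"
      using finB F0 by (intro card_mono) (auto simp: M_def finite_set_plus)
    also have "\<dots> \<le> card (New \<inter> B) + card ((F0 + B) - B)" by (rule card_Un_le)
    also have "card ((F0 + B) - B) = card (((F0 + F n) - F n) + {h})"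
      by (rule arg_cong[where f = card]) (auto simp: B_def mem_translate add.assoc[symmetric])
    also have "\<dots> = card ((F0 + F n) - F n)" by simp
    finally have cM: "real (card M) \<le> card (New \<inter> B) + \<delta>' * card (F n)" using 3 by simp
    have "card (- U \<inter> B) = card ((- U' \<inter> B) \<union> (New \<inter> B))"
      by (rule arg_cong[where f = card]) (use sub in \<open>auto simp: New_def\<close>)
    also have "\<dots> = card (- U' \<inter> B) + card (New \<inter> B)"
      using finB by (intro card_Un_disjoint) (auto simp: New_def)
    finally have "real (card (- U' \<inter> B)) = card (- U \<inter> B) - real (card (New \<inter> B))" by simp
    also have "\<dots> \<le> (1 - \<gamma>) * card (- U \<inter> B) + (\<delta>\<^sub>0 + 2 * \<delta>') * card (F n)"
      using g1 cM by (simp add: algebra_simps)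
    also have "(1 - \<gamma>) * card (- U \<inter> B) \<le> (1 - \<gamma>) * ((d + \<delta>') * card (F n))"
      using 1 \<gamma>01 by (intro mult_left_mono) (auto simp: B_def)
    also have "(1 - \<gamma>) * ((d + \<delta>') * card (F n)) + (\<delta>\<^sub>0 + 2 * \<delta>') * card (F n)
        = ((1 - \<gamma>) * d + \<delta>\<^sub>0 + 3 * \<delta>' - \<gamma> * \<delta>') * card (F n)" by (simp add: algebra_simps)
    also have "\<dots> \<le> ((1 - \<gamma>) * d + \<delta>\<^sub>0 + \<delta>) * card (F n)"
      using \<gamma>01 \<delta>' by (intro mult_right_mono) (auto simp: \<delta>'_def)
    finally show "real (card (- U' \<inter> (F n + {h}))) \<le> ((1 - \<gamma>) * d + \<delta>\<^sub>0 + \<delta>) * card (F n)"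
      by (simp add: B_def)
  qed
qed

text \<open>
  The sets \<open>C j\<close> are the centers of the tiles of shape \<open>T j\<close>. Tiles may overlap, but each has a core
  \<open>R (j, c)\<close> of almost full size, and cores are disjoint. The marker zones \<open>Q + {c}\<close> are disjoint as
  well.
\<close>

definition quasi_tiling ::
  "nat \<Rightarrow> (nat \<Rightarrow> 'g::group_add set) \<Rightarrow> (nat \<Rightarrow> 'g set) \<Rightarrow> (nat \<times> 'g \<Rightarrow> 'g set) \<Rightarrow> real \<Rightarrow> 'g set \<Rightarrow> bool" where
  "quasi_tiling k T C R \<epsilon> Q \<longleftrightarrow>
     (\<forall>j<k. \<forall>c\<in>C j. R (j, c) \<subseteq> T j + {c} \<and> (1 - \<epsilon>) * real (card (T j)) \<le> real (card (R (j, c)))) \<and>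
     disjoint_family_on R (Sigma {..<k} C) \<and>
     disjoint_family_on (\<lambda>(j, c). Q + {c}) (Sigma {..<k} C)"

definition covered :: "nat \<Rightarrow> (nat \<Rightarrow> 'g::group_add set) \<Rightarrow> (nat \<Rightarrow> 'g set) \<Rightarrow> 'g set" where
  "covered k T C = (\<Union>j<k. \<Union>c\<in>C j. T j + {c})"

text \<open>
  Level \<open>0\<close> uses the largest tiles. The boundary of the union of the earlier tiles is negligible for
  the next shape because every earlier shape is almost invariant under it; hence each level multiplies
  the uncovered density by about \<open>1 - \<gamma>\<close>.
\<close>

lemma quasi_tiling_levels:
  fixes T :: "nat \<Rightarrow> 'g::group_add set" and \<epsilon> \<delta> \<gamma> :: real
  assumes F: "folner_sequence F" and cnt: "countable (UNIV :: 'g set)" "infinite (UNIV :: 'g set)"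
    and \<epsilon>: "0 < \<epsilon>" "\<epsilon> < 1" and \<delta>: "\<delta> \<ge> 0" and \<gamma>: "\<gamma> = 1 / (1 / \<epsilon> + card Q)"
    and T: "\<And>j. j < k \<Longrightarrow> finite (T j) \<and> T j \<noteq> {} \<and> Q \<subseteq> T j"
    and inv: "\<And>i j. i < j \<Longrightarrow> j < k \<Longrightarrow> real (card ((uminus ` T j + T i) - T i)) \<le> \<delta> * real (card (T i))"
  shows "\<exists>C R. quasi_tiling k T C R \<epsilon> Q \<and>
           density_le F (- covered k T C) ((1 - \<gamma>) ^ k + k * (\<delta> / (1 - \<epsilon>)))"
  using T inv
proof (induction k)
  case 0
  then show ?case using density_le_UNIV[OF F, of UNIV]
    by (auto simp: quasi_tiling_def disjoint_family_on_def covered_def)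
next
  case (Suc k)
  have "\<exists>C R. quasi_tiling k T C R \<epsilon> Q \<and>
           density_le F (- covered k T C) ((1 - \<gamma>) ^ k + k * (\<delta> / (1 - \<epsilon>)))"
    by (rule Suc.IH) (use Suc.prems in auto)
  then obtain C R where CR: "quasi_tiling k T C R \<epsilon> Q"
      and dens: "density_le F (- covered k T C) ((1 - \<gamma>) ^ k + k * (\<delta> / (1 - \<epsilon>)))" by blast
  define U where "U = covered k T C"
  obtain e :: "nat \<Rightarrow> 'g" where e: "bij e"
    using cnt by (metis bij_betw_from_nat_into)
  have Tk: "finite (T k)" "T k \<noteq> {}" "Q \<subseteq> T k" using Suc.prems(1)[of k] by auto
  obtain C1 R1 where
    R1: "\<And>c. c \<in> C1 \<Longrightarrow> R1 c \<subseteq> T k + {c}" "\<And>c. c \<in> C1 \<Longrightarrow> R1 c \<inter> U = {}"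
    "\<And>c. c \<in> C1 \<Longrightarrow> (1 - \<epsilon>) * real (card (T k)) \<le> real (card (R1 c))"
    and Q1: "\<And>c. c \<in> C1 \<Longrightarrow> (Q + {c}) \<inter> U = {}"
    and disj: "disjoint_family_on R1 C1" "disjoint_family_on (\<lambda>c. Q + {c}) C1"
    and hit: "\<And>g. \<epsilon> * real (card (T k)) \<le> real (card ((T k + {g}) \<inter> (U \<union> (\<Union>c\<in>C1. T k + {c}))))
       \<or> (Q + {g}) \<inter> (U \<union> (\<Union>c\<in>C1. T k + {c})) \<noteq> {}"
    by (rule greedy_level[OF e Tk \<epsilon>, of U]) blast
  define C' where "C' = C(k := C1)"
  define R' where "R' = (\<lambda>(j, c). if j = k then R1 c else R (j, c))"
  have RU: "R (j, c) \<subseteq> U" "Q + {c} \<subseteq> U" if "j < k" "c \<in> C j" for j c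
  proof -
    have "T j + {c} \<subseteq> U" using that by (auto simp: U_def covered_def)
    moreover have "Q + {c} \<subseteq> T j + {c}" using Suc.prems(1)[of j] that by (intro set_plus_mono2) auto
    moreover have "R (j, c) \<subseteq> T j + {c}" using CR that by (auto simp: quasi_tiling_def)
    ultimately show "R (j, c) \<subseteq> U" "Q + {c} \<subseteq> U" by blast+
  qed
  have qt: "quasi_tiling (Suc k) T C' R' \<epsilon> Q"
    unfolding quasi_tiling_def
  proof (intro conjI)
    show "\<forall>j<Suc k. \<forall>c\<in>C' j. R' (j, c) \<subseteq> T j + {c} \<and> (1 - \<epsilon>) * real (card (T j)) \<le> real (card (R' (j, c)))"
      using CR R1 by (auto simp: quasi_tiling_def C'_def R'_def less_Suc_eq)
    have Sig: "Sigma {..<Suc k} C' = Sigma {..<k} C \<union> {k} \<times> C1"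
      by (auto simp: C'_def less_Suc_eq split: if_splits)
    have d0: "disjoint_family_on R (Sigma {..<k} C)" "disjoint_family_on (\<lambda>(j, c). Q + {c}) (Sigma {..<k} C)"
      using CR by (auto simp: quasi_tiling_def)
    show "disjoint_family_on R' (Sigma {..<Suc k} C')"
      unfolding disjoint_family_on_def Sig
    proof (intro ballI impI)
      fix m n assume mn: "m \<in> Sigma {..<k} C \<union> {k} \<times> C1" "n \<in> Sigma {..<k} C \<union> {k} \<times> C1" "m \<noteq> n"
      show "R' m \<inter> R' n = {}"
      proof (cases "fst m = k"; cases "fst n = k")
        assume "fst m = k" "fst n = k"
        then obtain c c' where "m = (k, c)" "n = (k, c')" "c \<in> C1" "c' \<in> C1" "c \<noteq> c'"
          using mn by (cases m; cases n) auto
        then show ?thesis using disj(1) by (simp add: R'_def disjoint_family_on_def)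
      next
        assume "fst m = k" "fst n \<noteq> k"
        then obtain c j c' where "m = (k, c)" "n = (j, c')" "c \<in> C1" "c' \<in> C j" "j < k"
          using mn by (cases m; cases n) auto
        then show ?thesis using R1(2)[of c] RU(1)[of j c'] by (auto simp: R'_def)
      next
        assume "fst m \<noteq> k" "fst n = k"
        then obtain c j c' where "n = (k, c)" "m = (j, c')" "c \<in> C1" "c' \<in> C j" "j < k"
          using mn by (cases m; cases n) auto
        then show ?thesis using R1(2)[of c] RU(1)[of j c'] by (auto simp: R'_def)
      next
        assume "fst m \<noteq> k" "fst n \<noteq> k"
        then obtain i c j c' where "m = (i, c)" "n = (j, c')" "c \<in> C i" "c' \<in> C j" "i < k" "j < k" "(i, c) \<noteq> (j, c')"
          using mn by (cases m; cases n) auto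
        then show ?thesis using disjoint_family_onD[OF d0(1), of "(i, c)" "(j, c')"] by (simp add: R'_def)
      qed
    qed
    show "disjoint_family_on (\<lambda>(j, c). Q + {c}) (Sigma {..<Suc k} C')"
      unfolding disjoint_family_on_def Sig
    proof (intro ballI impI)
      fix m n assume mn: "m \<in> Sigma {..<k} C \<union> {k} \<times> C1" "n \<in> Sigma {..<k} C \<union> {k} \<times> C1" "m \<noteq> n"
      show "(case m of (j, c) \<Rightarrow> Q + {c}) \<inter> (case n of (j, c) \<Rightarrow> Q + {c}) = {}"
      proof (cases "fst m = k"; cases "fst n = k")
        assume "fst m = k" "fst n = k"
        then obtain c c' where "m = (k, c)" "n = (k, c')" "c \<in> C1" "c' \<in> C1" "c \<noteq> c'"
          using mn by (cases m; cases n) auto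
        then show ?thesis using disj(2) by (simp add: R'_def disjoint_family_on_def)
      next
        assume "fst m = k" "fst n \<noteq> k"
        then obtain c j c' where "m = (k, c)" "n = (j, c')" "c \<in> C1" "c' \<in> C j" "j < k"
          using mn by (cases m; cases n) auto
        then show ?thesis using Q1[of c] RU(2)[of j c'] by (auto simp: R'_def)
      next
        assume "fst m \<noteq> k" "fst n = k"
        then obtain c j c' where "n = (k, c)" "m = (j, c')" "c \<in> C1" "c' \<in> C j" "j < k"
          using mn by (cases m; cases n) auto
        then show ?thesis using Q1[of c] RU(2)[of j c'] by (auto simp: R'_def)
      next
        assume "fst m \<noteq> k" "fst n \<noteq> k"
        then obtain i c j c' where "m = (i, c)" "n = (j, c')" "c \<in> C i" "c' \<in> C j" "i < k" "j < k" "(i, c) \<noteq> (j, c')"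
          using mn by (cases m; cases n) auto
        then show ?thesis using disjoint_family_onD[OF d0(2), of "(i, c)" "(j, c')"] by (simp add: R'_def)
      qed
    qed
  qed
  have cov': "covered (Suc k) T C' = U \<union> (\<Union>c\<in>C1. T k + {c})"
  proof -
    have "(\<Union>j<k. \<Union>c\<in>C' j. T j + {c}) = U"
      unfolding U_def covered_def by (rule SUP_cong) (simp_all add: C'_def)
    then show ?thesis by (simp add: covered_def lessThan_Suc C'_def Un_commute)
  qed
  define K where "K = (\<Union>i<k. T i + uminus ` (uminus ` T k + T i))"
  have K: "finite K" unfolding K_def using Suc.prems(1) by (auto intro!: finite_set_plus finite_imageI)
  have bd: "density_le F (\<Union>i\<in>Sigma {..<k} C. ((uminus ` T k + T (fst i)) - T (fst i)) + {snd i}) (\<delta> / (1 - \<epsilon>) * 1)"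
  proof (rule density_le_tiles[OF F K])
    show "disjoint_family_on R (Sigma {..<k} C)" using CR by (auto simp: quasi_tiling_def)
    show "R i \<subseteq> UNIV" for i by simp
    show "density_le F UNIV 1" by (rule density_le_UNIV[OF F])
    show "0 \<le> \<delta> / (1 - \<epsilon>)" using \<delta> \<epsilon> by simp
    show "r - y \<in> K" if i: "i \<in> Sigma {..<k} C" and y: "y \<in> ((uminus ` T k + T (fst i)) - T (fst i)) + {snd i}"
        and r: "r \<in> R i" for i y r
    proof -
      obtain j c where jc: "i = (j, c)" "j < k" "c \<in> C j" using i by auto
      then have "R i \<subseteq> T j + {c}" using CR by (simp add: quasi_tiling_def)
      then have "r \<in> T (fst i) + {snd i}" using r jc by auto
      then have "r - snd i \<in> T (fst i)" by (simp add: mem_translate)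
      moreover have "y - snd i \<in> uminus ` T k + T (fst i)" using y by (simp add: mem_translate)
      ultimately have "(r - snd i) + - (y - snd i) \<in> T (fst i) + uminus ` (uminus ` T k + T (fst i))"
        by (intro set_plus_intro imageI)
      then have "r - y \<in> T (fst i) + uminus ` (uminus ` T k + T (fst i))"
        by (simp add: add_diff_eq)
      then show ?thesis using i by (auto simp: K_def)
    qed
    fix i assume i: "i \<in> Sigma {..<k} C"
    then have Ti: "finite (T (fst i))" using Suc.prems(1)[of "fst i"] by auto
    have "card (((uminus ` T k + T (fst i)) - T (fst i)) + {snd i}) = card ((uminus ` T k + T (fst i)) - T (fst i))" by simp
    also have "real \<dots> \<le> \<delta> * real (card (T (fst i)))" using i Suc.prems(2)[of "fst i" k] by auto
    also have "\<dots> = \<delta> / (1 - \<epsilon>) * ((1 - \<epsilon>) * real (card (T (fst i))))" using \<epsilon> by simp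
    also have "\<dots> \<le> \<delta> / (1 - \<epsilon>) * real (card (R i))"
      using CR i \<delta> \<epsilon> by (intro mult_left_mono) (auto simp: quasi_tiling_def)
    finally show "finite (((uminus ` T k + T (fst i)) - T (fst i)) + {snd i}) \<and>
        real (card (((uminus ` T k + T (fst i)) - T (fst i)) + {snd i})) \<le> \<delta> / (1 - \<epsilon>) * real (card (R i))"
      using Ti Tk by (simp add: finite_set_plus)
  qed
  have bd': "density_le F {g. g \<notin> U \<and> (T k + {g}) \<inter> U \<noteq> {}} (\<delta> / (1 - \<epsilon>))"
  proof (rule density_le_mono[OF F bd])
    show "{g. g \<notin> U \<and> (T k + {g}) \<inter> U \<noteq> {}}
      \<subseteq> (\<Union>i\<in>Sigma {..<k} C. ((uminus ` T k + T (fst i)) - T (fst i)) + {snd i})"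
    proof
      fix g assume "g \<in> {g. g \<notin> U \<and> (T k + {g}) \<inter> U \<noteq> {}}"
      then obtain x where g: "g \<notin> U" and x: "x \<in> T k + {g}" "x \<in> U" by auto
      obtain i c where i: "i < k" "c \<in> C i" "x \<in> T i + {c}" using x by (auto simp: U_def covered_def)
      obtain t where t: "t \<in> T k" "x = t + g" using x by (auto simp: set_plus_def)
      have "- t + (x - c) \<in> uminus ` T k + T i" using t i by (intro set_plus_intro) (auto simp: mem_translate)
      moreover have "- t + (x - c) = g - c" by (simp add: t add_diff_eq)
      moreover have "g - c \<notin> T i" using g i by (auto simp: U_def covered_def mem_translate)
      ultimately have "g \<in> ((uminus ` T k + T i) - T i) + {c}" by (simp add: mem_translate)
      then show "g \<in> (\<Union>i\<in>Sigma {..<k} C. ((uminus ` T k + T (fst i)) - T (fst i)) + {snd i})"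
        using i by force
    qed
  qed simp
  have ge1: "1 / \<epsilon> + card Q \<ge> 1" using \<epsilon> by (simp add: add_increasing2)
  then have \<gamma>01: "0 < \<gamma>" "\<gamma> \<le> 1" by (auto simp: \<gamma> divide_simps)
  have "density_le F (- covered (Suc k) T C') ((1 - \<gamma>) * ((1 - \<gamma>) ^ k + k * (\<delta> / (1 - \<epsilon>))) + \<delta> / (1 - \<epsilon>))"
    unfolding cov'
    by (rule density_step[OF F Tk, where \<epsilon> = \<epsilon> and U = U])
       (use \<epsilon> hit dens bd' \<gamma> \<delta> in \<open>auto simp: U_def\<close>)
  then have "density_le F (- covered (Suc k) T C') ((1 - \<gamma>) ^ Suc k + Suc k * (\<delta> / (1 - \<epsilon>)))"
  proof (rule density_le_mono[OF F _ subset_refl])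
    have aux: "(1 - \<gamma>) * (p + k * D) + D \<le> (1 - \<gamma>) * p + Suc k * D"
      if "D \<ge> 0" for p D :: real
    proof -
      have "(1 - \<gamma>) * (k * D) \<le> 1 * (k * D)" using \<gamma>01 that by (intro mult_right_mono) auto
      then show ?thesis by (simp add: algebra_simps)
    qed
    have "0 \<le> \<delta> / (1 - \<epsilon>)" using \<delta> \<epsilon> by simp
    from aux[OF this]
    show "(1 - \<gamma>) * ((1 - \<gamma>) ^ k + k * (\<delta> / (1 - \<epsilon>))) + \<delta> / (1 - \<epsilon>)
        \<le> (1 - \<gamma>) ^ Suc k + Suc k * (\<delta> / (1 - \<epsilon>))" by simp
  qed
  with qt show ?case by blast
qed

text \<open>
  Every new shape is put in front of the earlier ones, since it has to be almost invariant under
  all of them.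
\<close>

lemma invariant_tower:
  fixes P :: "'g::group_add set \<Rightarrow> bool" and \<delta> :: real and k :: nat
  assumes "\<And>K. finite K \<Longrightarrow> \<exists>S. finite S \<and> P S \<and> real (card ((K + S) - S)) \<le> \<delta> * card S"
  shows "\<exists>T. (\<forall>j<k. finite (T j) \<and> P (T j)) \<and>
    (\<forall>i j. i < j \<longrightarrow> j < k \<longrightarrow> real (card ((uminus ` T j + T i) - T i)) \<le> \<delta> * real (card (T i)))"
proof (induction k)
  case (Suc k)
  then obtain T where T: "\<And>j. j < k \<Longrightarrow> finite (T j) \<and> P (T j)"
    "\<And>i j. i < j \<Longrightarrow> j < k \<Longrightarrow> real (card ((uminus ` T j + T i) - T i)) \<le> \<delta> * real (card (T i))" by blast
  define K where "K = (\<Union>j<k. uminus ` T j)"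
  have K: "finite K" using T by (auto simp: K_def)
  obtain S where S: "finite S" "P S" "real (card ((K + S) - S)) \<le> \<delta> * card S"
    using assms[OF K] by blast
  define T' where "T' = case_nat S T"
  show ?case
  proof (intro exI[of _ T'] conjI allI impI)
    fix j assume "j < Suc k"
    then show "finite (T' j)" "P (T' j)" using S T by (auto simp: T'_def split: nat.split)
  next
    fix i j assume ij: "i < j" "j < Suc k"
    then obtain j' where j': "j = Suc j'" "j' < k" by (cases j) auto
    show "real (card ((uminus ` T' j + T' i) - T' i)) \<le> \<delta> * real (card (T' i))"
    proof (cases i)
      case 0
      have "uminus ` T j' + S \<subseteq> K + S" using j' by (intro set_plus_mono2) (auto simp: K_def)
      then have "card ((uminus ` T j' + S) - S) \<le> card ((K + S) - S)"
        using K S by (intro card_mono) (auto simp: finite_set_plus)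
      then show ?thesis using S(3) by (simp add: T'_def 0 j')
    next
      case (Suc i')
      then show ?thesis using T(2)[of i' j'] ij j' by (simp add: T'_def)
    qed
  qed
qed simp

lemma quasi_tilingD:
  assumes "quasi_tiling k T C R \<epsilon> Q" and "i \<in> Sigma {..<k} C"
  shows "R i \<subseteq> T (fst i) + {snd i}" "(1 - \<epsilon>) * real (card (T (fst i))) \<le> real (card (R i))"
proof -
  obtain j c where i: "i = (j, c)" "j < k" "c \<in> C j" using assms(2) by blast
  have "R (j, c) \<subseteq> T j + {c} \<and> (1 - \<epsilon>) * real (card (T j)) \<le> real (card (R (j, c)))"
    using assms(1) i(2,3) unfolding quasi_tiling_def by blast
  then show "R i \<subseteq> T (fst i) + {snd i}" "(1 - \<epsilon>) * real (card (T (fst i))) \<le> real (card (R i))"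
    by (simp_all add: i(1))
qed


lemma quasi_tiling_exists:
  fixes F :: "nat \<Rightarrow> 'g::group_add set" and \<epsilon> \<delta> \<gamma> :: real and k :: nat
  assumes F: "folner_sequence F" and cnt: "countable (UNIV :: 'g set)" "infinite (UNIV :: 'g set)"
    and \<epsilon>: "0 < \<epsilon>" "\<epsilon> < 1" and \<delta>: "\<delta> > 0" and \<gamma>: "\<gamma> = 1 / (1 / \<epsilon> + card Q)"
    and P: "\<And>K (\<delta> :: real). finite K \<Longrightarrow> \<delta> > 0 \<Longrightarrow>
      \<exists>S. finite S \<and> S \<noteq> {} \<and> Q \<subseteq> S \<and> P S \<and> real (card ((K + S) - S)) \<le> \<delta> * card S"
  obtains T C R where "\<And>j. j < k \<Longrightarrow> finite (T j) \<and> T j \<noteq> {} \<and> Q \<subseteq> T j \<and> P (T j)"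
    "quasi_tiling k T C R \<epsilon> Q" "density_le F (- covered k T C) ((1 - \<gamma>) ^ k + \<delta>)"
proof -
  define \<delta>' where "\<delta>' = \<delta> * (1 - \<epsilon>) / (k + 1)"
  have \<delta>': "\<delta>' > 0" using \<delta> \<epsilon> by (simp add: \<delta>'_def)
  obtain T where T: "\<And>j. j < k \<Longrightarrow> finite (T j) \<and> T j \<noteq> {} \<and> Q \<subseteq> T j \<and> P (T j)"
    and inv: "\<And>i j. i < j \<Longrightarrow> j < k \<Longrightarrow> real (card ((uminus ` T j + T i) - T i)) \<le> \<delta>' * real (card (T i))"
    using invariant_tower[of "\<lambda>S. S \<noteq> {} \<and> Q \<subseteq> S \<and> P S" \<delta>' k] P[OF _ \<delta>'] by blast
  obtain C R where CR: "quasi_tiling k T C R \<epsilon> Q"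
    and d: "density_le F (- covered k T C) ((1 - \<gamma>) ^ k + k * (\<delta>' / (1 - \<epsilon>)))"
    using quasi_tiling_levels[OF F cnt \<epsilon> _ \<gamma>, of \<delta>' k T] T inv \<delta>' by fastforce
  have "k * (\<delta>' / (1 - \<epsilon>)) = \<delta> * (k / (k + 1))" using \<epsilon> by (simp add: \<delta>'_def)
  also have "\<dots> \<le> \<delta> * 1" using \<delta> by (intro mult_left_mono) auto
  finally have "density_le F (- covered k T C) ((1 - \<gamma>) ^ k + \<delta>)"
    using density_le_mono[OF F d] by simp
  with that T CR show ?thesis by blast
qed

section \<open>Comparison and local matchings\<close>

lemma full_shift_UNIV [simp]: "full_shift UNIV = UNIV"
  by (auto simp: full_shift_def)

text \<open>
  Openness in terms of finite windows; with it all topological arguments on shift spaces become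
  combinatorial.
\<close>

lemma openin_subshift_iff:
  assumes X: "X \<subseteq> full_shift \<Lambda>"
  shows "openin (subtopology (shift_topology \<Lambda>) X) S \<longleftrightarrow>
    S \<subseteq> X \<and> (\<forall>x\<in>S. \<exists>K. finite K \<and> (\<forall>y\<in>X. (\<forall>k\<in>K. y k = x k) \<longrightarrow> y \<in> S))"
    (is "_ \<longleftrightarrow> ?R")
proof
  assume "openin (subtopology (shift_topology \<Lambda>) X) S"
  then obtain T where T: "openin (shift_topology \<Lambda>) T" "S = T \<inter> X" by (auto simp: openin_subtopology)
  show ?R
  proof (intro conjI ballI)
    fix x assume x: "x \<in> S"
    then have "x \<in> T" using T by simp
    then obtain U where U: "finite {i. U i \<noteq> \<Lambda>}" "\<forall>i. U i \<subseteq> \<Lambda>" "x \<in> Pi UNIV U" "Pi UNIV U \<subseteq> T"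
      using T(1) unfolding shift_topology_def openin_product_topology_alt by (auto simp: PiE_UNIV_domain)
    show "\<exists>K. finite K \<and> (\<forall>y\<in>X. (\<forall>k\<in>K. y k = x k) \<longrightarrow> y \<in> S)"
    proof (intro exI[of _ "{i. U i \<noteq> \<Lambda>}"] conjI ballI impI U(1))
      fix y assume y: "y \<in> X" "\<forall>k\<in>{i. U i \<noteq> \<Lambda>}. y k = x k"
      have "y i \<in> U i" for i
      proof (cases "U i = \<Lambda>")
        case True
        then show ?thesis using y X by (auto simp: full_shift_def)
      next
        case False
        then show ?thesis using y U(3) by (auto simp: Pi_def)
      qed
      then show "y \<in> S" using U(4) T y by auto
    qed
  qed (use T in auto)
next
  assume R: ?R
  show "openin (subtopology (shift_topology \<Lambda>) X) S"
  proof (subst openin_subopen, intro ballI)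
    fix x assume x: "x \<in> S"
    then obtain K where K: "finite K" "\<And>y. y \<in> X \<Longrightarrow> (\<forall>k\<in>K. y k = x k) \<Longrightarrow> y \<in> S" using R by blast
    define U where "U i = (if i \<in> K then {x i} else \<Lambda>)" for i
    have xX: "x \<in> X" using x R by auto
    then have xL: "x i \<in> \<Lambda>" for i using X by (auto simp: full_shift_def)
    have "openin (shift_topology \<Lambda>) (Pi\<^sub>E UNIV U)"
      unfolding shift_topology_def openin_PiE_gen
    proof (intro disjI2 conjI ballI)
      show "finite {i \<in> UNIV. U i \<noteq> topspace (discrete_topology \<Lambda>)}"
        by (rule finite_subset[OF _ K(1)]) (auto simp: U_def)
      show "openin (discrete_topology \<Lambda>) (U i)" for i using xL by (auto simp: U_def)
    qed
    then have "openin (subtopology (shift_topology \<Lambda>) X) (Pi\<^sub>E UNIV U \<inter> X)"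
      by (auto simp: openin_subtopology)
    moreover have "x \<in> Pi\<^sub>E UNIV U \<inter> X" using xX xL by (auto simp: U_def PiE_UNIV_domain)
    moreover have "Pi\<^sub>E UNIV U \<inter> X \<subseteq> S"
    proof
      fix y assume y: "y \<in> Pi\<^sub>E UNIV U \<inter> X"
      then have "y i \<in> U i" for i by auto
      then have "\<forall>k\<in>K. y k = x k" by (metis U_def singletonD)
      then show "y \<in> S" using K(2) y by blast
    qed
    ultimately show "\<exists>T. openin (subtopology (shift_topology \<Lambda>) X) T \<and> x \<in> T \<and> T \<subseteq> S" by blast
  qed
qed

lemma topspace_subshift: "X \<subseteq> full_shift \<Lambda> \<Longrightarrow> topspace (subtopology (shift_topology \<Lambda>) X) = X"
  by (auto simp: topspace_shift_topology)

lemma openin_shift_iff: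
  "openin (shift_topology \<Lambda>) S \<longleftrightarrow>
    S \<subseteq> full_shift \<Lambda> \<and> (\<forall>x\<in>S. \<exists>K. finite K \<and> (\<forall>y\<in>full_shift \<Lambda>. (\<forall>k\<in>K. y k = x k) \<longrightarrow> y \<in> S))"
  using openin_subshift_iff[of "full_shift \<Lambda>" \<Lambda> S]
  by (metis order_refl subtopology_topspace topspace_shift_topology)

lemma compact_space_shift: "finite \<Lambda> \<Longrightarrow> compact_space (shift_topology \<Lambda>)"
  unfolding shift_topology_def compact_space_product_topology
  by (auto simp: compact_space_discrete_topology)

lemma clopenin_subshift_iff:
  assumes X: "X \<subseteq> full_shift \<Lambda>"
  shows "clopenin (subtopology (shift_topology \<Lambda>) X) P \<longleftrightarrow>
    P \<subseteq> X \<and> (\<forall>x\<in>X. \<exists>K. finite K \<and> (\<forall>y\<in>X. (\<forall>k\<in>K. y k = x k) \<longrightarrow> (y \<in> P \<longleftrightarrow> x \<in> P)))"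
    (is "?L \<longleftrightarrow> ?R")
proof -
  define N where "N x S \<longleftrightarrow> (\<exists>K. finite K \<and> (\<forall>y\<in>X. (\<forall>k\<in>K. y k = x k) \<longrightarrow> y \<in> S))" for x S
  have *: "(\<exists>K. finite K \<and> (\<forall>y\<in>X. (\<forall>k\<in>K. y k = x k) \<longrightarrow> (y \<in> P \<longleftrightarrow> x \<in> P)))
      \<longleftrightarrow> (if x \<in> P then N x P else N x (X - P))" for x
    by (cases "x \<in> P") (simp_all add: N_def)
  have "?L \<longleftrightarrow> (P \<subseteq> X \<and> (\<forall>x\<in>P. N x P)) \<and> P \<subseteq> X \<and> X - P \<subseteq> X \<and> (\<forall>x\<in>X - P. N x (X - P))"
    unfolding clopenin_def closedin_def openin_subshift_iff[OF X] topspace_subshift[OF X] N_def ..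
  also have "\<dots> \<longleftrightarrow> P \<subseteq> X \<and> (\<forall>x\<in>X. if x \<in> P then N x P else N x (X - P))" by auto
  finally show ?thesis unfolding * .
qed

text \<open>
  The windows of the single points give an open cover on whose members \<open>P\<close> is constant; a finite
  subcover has a common window.
\<close>

lemma clopen_finite_window:
  assumes fin: "finite \<Lambda>" and X: "closedin (shift_topology \<Lambda>) X"
    and P: "clopenin (subtopology (shift_topology \<Lambda>) X) P"
  obtains K where "finite K" "\<And>x y. x \<in> X \<Longrightarrow> y \<in> X \<Longrightarrow> (\<forall>k\<in>K. x k = y k) \<Longrightarrow> x \<in> P \<longleftrightarrow> y \<in> P"
proof -
  let ?W = "subtopology (shift_topology \<Lambda>) X"
  have sub: "X \<subseteq> full_shift \<Lambda>" using closedin_subset[OF X] by (simp add: topspace_shift_topology)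
  have "\<forall>x\<in>X. \<exists>K. finite K \<and> (\<forall>y\<in>X. (\<forall>k\<in>K. y k = x k) \<longrightarrow> (y \<in> P \<longleftrightarrow> x \<in> P))"
    using P unfolding clopenin_subshift_iff[OF sub] by blast
  from bchoice[OF this] obtain k where "\<forall>x\<in>X. finite (k x) \<and>
    (\<forall>y\<in>X. (\<forall>i\<in>k x. y i = x i) \<longrightarrow> (y \<in> P \<longleftrightarrow> x \<in> P))" by blast
  then have k: "\<And>x. x \<in> X \<Longrightarrow> finite (k x)"
    "\<And>x y. x \<in> X \<Longrightarrow> y \<in> X \<Longrightarrow> (\<forall>i\<in>k x. y i = x i) \<Longrightarrow> y \<in> P \<longleftrightarrow> x \<in> P" by blast+
  define cyl where "cyl x = {y \<in> X. \<forall>i\<in>k x. y i = x i}" for x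
  have "compact_space ?W"
    using closedin_compact_space[OF compact_space_shift[OF fin] X] by (simp add: compact_space_subtopology)
  moreover have "\<forall>U\<in>cyl ` X. openin ?W U"
  proof
    fix U assume "U \<in> cyl ` X"
    then obtain x where x: "x \<in> X" "U = cyl x" by blast
    show "openin ?W U"
      unfolding openin_subshift_iff[OF sub] x(2)
      by (auto simp: cyl_def intro!: exI[of _ "k x"] k(1)[OF x(1)])
  qed
  moreover have "topspace ?W \<subseteq> \<Union> (cyl ` X)"
    by (auto simp: topspace_subshift[OF sub] cyl_def)
  ultimately obtain \<F> where \<F>: "finite \<F>" "\<F> \<subseteq> cyl ` X" "topspace ?W \<subseteq> \<Union> \<F>"
    unfolding compact_space_alt by meson
  obtain Y where Y: "finite Y" "Y \<subseteq> X" "\<F> = cyl ` Y" using finite_subset_image[OF \<F>(1,2)] by blast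
  show ?thesis
  proof (rule that[of "\<Union> (k ` Y)"])
    show "finite (\<Union> (k ` Y))" using Y k(1) by auto
    fix x y assume xy: "x \<in> X" "y \<in> X" "\<forall>i\<in>\<Union> (k ` Y). x i = y i"
    obtain z where z: "z \<in> Y" "x \<in> cyl z" using \<F>(3) xy(1) Y topspace_subshift[OF sub] by auto
    have "\<forall>i\<in>k z. x i = z i" "\<forall>i\<in>k z. y i = z i" using z xy by (auto simp: cyl_def)
    then show "x \<in> P \<longleftrightarrow> y \<in> P" using k(2)[of z x] k(2)[of z y] z Y xy by auto
  qed
qed

text \<open>
  The pairs \<open>(L, S)\<close> of sets that satisfy the strict inequality in every translate of \<open>B\<close> form a
  subshift over two bits, here transported to \<^typ>\<open>nat \<Rightarrow> bool\<close> by an enumeration \<open>b\<close> of the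
  coordinates. Summing the indicator functions of the translates over \<open>B\<close> and integrating shows that
  an invariant measure gives the event that the neutral element is in \<open>L\<close> less mass than the event
  that it is in \<open>S\<close>. Comparison for these two events yields pieces \<open>P i\<close> and elements \<open>h i\<close>; a cell
  \<open>g\<close> of \<open>L\<close> is sent to \<open>h i + g\<close> when the configuration seen from \<open>g\<close> lies in \<open>P i\<close>. Injectivity is the
  disjointness of the images of the pieces, and locality holds because the pieces are clopen.
\<close>

lemma comparison_matching:
  fixes L S B :: "'g::group_add set"
  assumes cnt: "countable (UNIV :: 'g set)" "infinite (UNIV :: 'g set)"
    and comp: "comparison_property TYPE('g)"
    and B: "finite B" and less: "\<And>h. card {t \<in> B. t + h \<in> L} < card {t \<in> B. t + h \<in> S}"
  obtains \<eta> :: "'g \<Rightarrow> 'g" and H K :: "'g set" where "finite H" "finite K"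
    "\<And>g. g \<in> L \<Longrightarrow> \<eta> g \<in> H" "\<And>g. g \<in> L \<Longrightarrow> \<eta> g + g \<in> S" "inj_on (\<lambda>g. \<eta> g + g) L"
    "\<And>g g'. g \<in> L \<Longrightarrow> g' \<in> L \<Longrightarrow>
      (\<forall>t\<in>K. (t + g \<in> L \<longleftrightarrow> t + g' \<in> L) \<and> (t + g \<in> S \<longleftrightarrow> t + g' \<in> S)) \<Longrightarrow> \<eta> g = \<eta> g'"
proof -
  have cnt2: "countable (UNIV :: ('g \<times> bool) set)" "infinite (UNIV :: ('g \<times> bool) set)"
  proof -
    show "countable (UNIV :: ('g \<times> bool) set)"
      using cnt(1) by (simp flip: UNIV_Times_UNIV)
    show "infinite (UNIV :: ('g \<times> bool) set)"
      using cnt(2) finite_imageI[of "UNIV :: ('g \<times> bool) set" fst] by (auto simp: surj_def)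
  qed
  obtain b :: "nat \<Rightarrow> 'g \<times> bool" where b: "bij b"
    using bij_betw_from_nat_into[OF cnt2] by blast
  define idx where "idx = inv b"
  have idx [simp]: "b (idx p) = p" "idx (b n) = n" for p n
    using b by (auto simp: idx_def bij_is_surj surj_f_inv_f bij_is_inj)
  define act :: "'g \<Rightarrow> (nat \<Rightarrow> bool) \<Rightarrow> (nat \<Rightarrow> bool)"
    where "act h f = (\<lambda>n. f (idx (fst (b n) + h, snd (b n))))" for h f
  have act_idx [simp]: "act h f (idx (g, i)) = f (idx (g + h, i))" for h f g i
    by (simp add: act_def)
  have act0: "act 0 f = f" for f by (simp add: act_def)
  have act_add: "act (g + h) f = act g (act h f)" for g h f
    by (simp add: act_def add.assoc)
  define \<Omega> where "\<Omega> = {f. \<forall>h. card {t \<in> B. f (idx (t + h, True))} < card {t \<in> B. f (idx (t + h, False))}}"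
  define W where "W = subtopology (shift_topology (UNIV :: bool set)) \<Omega>"
  have sub: "\<Omega> \<subseteq> full_shift UNIV" by simp
  have topW: "topspace W = \<Omega>" unfolding W_def by (rule topspace_subshift[OF sub])
  have closed: "closedin (shift_topology (UNIV :: bool set)) \<Omega>"
    unfolding closedin_def topspace_shift_topology openin_shift_iff
  proof (intro conjI ballI)
    fix f assume "f \<in> full_shift UNIV - \<Omega>"
    then obtain h where h: "\<not> card {t \<in> B. f (idx (t + h, True))} < card {t \<in> B. f (idx (t + h, False))}"
      by (auto simp: \<Omega>_def)
    let ?K = "(\<lambda>(t, i). idx (t + h, i)) ` (B \<times> UNIV)"
    show "\<exists>K. finite K \<and> (\<forall>y\<in>full_shift UNIV. (\<forall>k\<in>K. y k = f k) \<longrightarrow> y \<in> full_shift UNIV - \<Omega>)"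
    proof (intro exI[of _ ?K] conjI ballI impI)
      show "finite ?K" using B by simp
      fix y assume y: "\<forall>k\<in>?K. y k = f k"
      then have "{t \<in> B. y (idx (t + h, i))} = {t \<in> B. f (idx (t + h, i))}" for i by force
      then have "\<not> card {t \<in> B. y (idx (t + h, True))} < card {t \<in> B. y (idx (t + h, False))}"
        using h by simp
      then show "y \<in> full_shift UNIV - \<Omega>" by (auto simp: \<Omega>_def)
    qed
  qed auto
  have metr: "metrizable_space W"
    unfolding W_def shift_topology_def
    by (intro metrizable_space_subtopology)
       (auto simp: metrizable_space_product_topology metrizable_space_discrete_topology)
  have compW: "compact_space W"
    unfolding W_def using closedin_compact_space[OF compact_space_shift closed]
    by (simp add: compact_space_subtopology)
  have zero: "zero_dimensional_space W"
    unfolding zero_dimensional_space_def neighbourhood_base_of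
  proof (intro allI impI)
    fix V f assume V: "openin W V \<and> f \<in> V"
    then obtain K where K: "finite K" "\<forall>y\<in>\<Omega>. (\<forall>k\<in>K. y k = f k) \<longrightarrow> y \<in> V" and f: "f \<in> \<Omega>"
      unfolding W_def openin_subshift_iff[OF sub] by blast
    let ?U = "{y \<in> \<Omega>. \<forall>k\<in>K. y k = f k}"
    have "clopenin W ?U"
      unfolding W_def clopenin_subshift_iff[OF sub] using K(1) by (auto intro!: exI[of _ K])
    then show "\<exists>U V'. openin W U \<and> clopenin W V' \<and> f \<in> U \<and> U \<subseteq> V' \<and> V' \<subseteq> V"
      using K(2) f by (intro exI[of _ ?U]) (auto simp: clopenin_def)
  qed
  have act\<Omega>: "act g f \<in> \<Omega>" if "f \<in> \<Omega>" for f g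
    using that by (simp add: \<Omega>_def add.assoc)
  have cont: "continuous_map W W (act g)" for g
    unfolding W_def
  proof (rule continuous_map_into_subtopology)
    have "continuous_map (shift_topology UNIV) (shift_topology UNIV) (act g)"
      unfolding shift_topology_def continuous_map_componentwise_UNIV act_def
      by (intro allI continuous_map_product_projection) simp
    then show "continuous_map (subtopology (shift_topology UNIV) \<Omega>) (shift_topology UNIV) (act g)"
      by (rule continuous_map_from_subtopology)
    show "act g \<in> topspace (subtopology (shift_topology UNIV) \<Omega>) \<rightarrow> \<Omega>" using act\<Omega> by auto
  qed
  have homeo: "homeomorphic_map W W (act g)" for g
    by (rule homeomorphic_maps_imp_map[of _ _ _ "act (- g)"])
       (simp add: homeomorphic_maps_def cont act_add[symmetric] act0)
  have acts: "acts_by_homeomorphisms W act"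
    by (simp add: acts_by_homeomorphisms_def homeo act0 act_add)
  define C where "C i g = {f \<in> \<Omega>. f (idx (g, i))}" for i g
  have clopC: "clopenin W (C i g)" for i g
    unfolding W_def clopenin_subshift_iff[OF sub] by (auto simp: C_def intro!: exI[of _ "{idx (g, i)}"])
  have smaller: "measure \<mu> (C True 0) < measure \<mu> (C False 0)"
    if \<mu>: "invariant_probability_measure W act \<mu>" for \<mu>
  proof -
    interpret prob_space \<mu> using \<mu> by (simp add: invariant_probability_measure_def)
    have sets: "sets \<mu> = sigma_sets \<Omega> {U. openin W U}"
      using \<mu> by (simp add: invariant_probability_measure_def topW)
    have pow: "{U. openin W U} \<subseteq> Pow \<Omega>" using openin_subset[of W] topW by auto
    have space: "space \<mu> = \<Omega>"
      using sets_eq_imp_space_eq[of \<mu> "sigma \<Omega> {U. openin W U}"] sets pow by (simp add: sets_measure_of space_measure_of)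
    have Csets: "C i g \<in> sets \<mu>" for i g
      using clopC[of i g] by (auto simp: sets clopenin_def)
    have meas: "act g \<in> measurable \<mu> \<mu>" for g
    proof (rule measurable_sigma_sets[OF sets pow])
      show "act g \<in> space \<mu> \<rightarrow> \<Omega>" using act\<Omega> by (auto simp: space)
      fix U assume "U \<in> {U. openin W U}"
      then have "openin W {f \<in> topspace W. act g f \<in> U}"
        using openin_continuous_map_preimage[OF cont] by blast
      moreover have "act g -` U \<inter> space \<mu> = {f \<in> topspace W. act g f \<in> U}" by (auto simp: space topW)
      ultimately show "act g -` U \<inter> space \<mu> \<in> sets \<mu>" by (auto simp: sets)
    qed
    have inv: "prob (C i g) = prob (C i 0)" for i g
    proof -
      have "prob (C i 0) = measure (distr \<mu> \<mu> (act g)) (C i 0)"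
        using \<mu> by (simp add: invariant_probability_measure_def)
      also have "\<dots> = prob (act g -` C i 0 \<inter> space \<mu>)" by (rule measure_distr[OF meas Csets])
      also have "act g -` C i 0 \<inter> space \<mu> = C i g" by (auto simp: C_def space act\<Omega>)
      finally show ?thesis by simp
    qed
    have sumC: "(\<Sum>t\<in>B. prob (C i t)) = card B * prob (C i 0)" for i
      by (rule trans[OF sum.cong[OF refl inv]]) simp
    have int: "integrable \<mu> (indicat_real (C i g))" for i g
      using Csets by (intro integrable_real_indicator) (auto simp: emeasure_eq_measure)
    have sum: "(\<Sum>t\<in>B. indicat_real (C i t) f) = card {t \<in> B. f (idx (t, i))}" if "f \<in> \<Omega>" for f i
      using that B by (simp add: C_def indicator_def sum.If_cases Int_def)
    \<comment> \<open>The strict inequality between integers leaves a gap of one in every configuration, which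
      survives integration.\<close>
    have "card B * prob (C True 0) + 1 = (\<Sum>t\<in>B. prob (C True t)) + 1" by (simp add: sumC)
    also have "\<dots> = (\<integral>f. (\<Sum>t\<in>B. indicat_real (C True t) f) + 1 \<partial>\<mu>)"
      using int Csets by (simp add: prob_space Bochner_Integration.integral_add integrable_sum)
    also have "\<dots> \<le> (\<integral>f. (\<Sum>t\<in>B. indicat_real (C False t) f) \<partial>\<mu>)"
    proof (rule integral_mono)
      fix f assume "f \<in> space \<mu>"
      then have f: "f \<in> \<Omega>" by (simp add: space)
      then have "card {t \<in> B. f (idx (t + 0, True))} < card {t \<in> B. f (idx (t + 0, False))}"
        unfolding \<Omega>_def by blast
      then show "(\<Sum>t\<in>B. indicat_real (C True t) f) + 1 \<le> (\<Sum>t\<in>B. indicat_real (C False t) f)"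
        unfolding sum[OF f] by simp
    qed (use int in \<open>auto intro!: integrable_sum Bochner_Integration.integrable_add\<close>)
    also have "\<dots> = (\<Sum>t\<in>B. prob (C False t))" using int Csets by simp
    also have "\<dots> = card B * prob (C False 0)" by (rule sumC)
    finally have "real (card B) * prob (C True 0) < real (card B) * prob (C False 0)" by linarith
    then show ?thesis by (meson mult_left_mono not_le of_nat_0_le_iff)
  qed
  have "admits_comparison W act"
    using comp metr compW zero acts unfolding comparison_property_def by blast
  then have "subequivalent W act (C True 0) (C False 0)"
    unfolding admits_comparison_def using clopC smaller by blast
  then obtain m :: nat and P h where P: "C True 0 = (\<Union>i<m. P i)" "disjoint_family_on P {..<m}"
      "\<And>i. i < m \<Longrightarrow> clopenin W (P i)" "disjoint_family_on (\<lambda>i. act (h i) ` P i) {..<m}"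
      "\<And>i. i < m \<Longrightarrow> act (h i) ` P i \<subseteq> C False 0"
    unfolding subequivalent_def by blast
  have "\<forall>i\<in>{..<m}. \<exists>k. finite k \<and> (\<forall>x\<in>\<Omega>. \<forall>y\<in>\<Omega>. (\<forall>j\<in>k. x j = y j) \<longrightarrow> (x \<in> P i \<longleftrightarrow> y \<in> P i))"
  proof
    fix i assume "i \<in> {..<m}"
    then have "clopenin (subtopology (shift_topology UNIV) \<Omega>) (P i)" using P(3) by (simp add: W_def)
    from clopen_finite_window[OF _ closed this]
    show "\<exists>k. finite k \<and> (\<forall>x\<in>\<Omega>. \<forall>y\<in>\<Omega>. (\<forall>j\<in>k. x j = y j) \<longrightarrow> (x \<in> P i \<longleftrightarrow> y \<in> P i))"
      by (metis finite)
  qed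
  from bchoice[OF this] obtain k where "\<forall>i\<in>{..<m}. finite (k i) \<and>
    (\<forall>x\<in>\<Omega>. \<forall>y\<in>\<Omega>. (\<forall>j\<in>k i. x j = y j) \<longrightarrow> (x \<in> P i \<longleftrightarrow> y \<in> P i))" by blast
  then have k: "\<And>i. i < m \<Longrightarrow> finite (k i)"
    "\<And>i x y. i < m \<Longrightarrow> x \<in> \<Omega> \<Longrightarrow> y \<in> \<Omega> \<Longrightarrow> (\<forall>j\<in>k i. x j = y j) \<Longrightarrow> x \<in> P i \<longleftrightarrow> y \<in> P i"
    by blast+
  define f0 where "f0 n = (if snd (b n) then fst (b n) \<in> L else fst (b n) \<in> S)" for n
  have f0 [simp]: "f0 (idx (g, i)) = (if i then g \<in> L else g \<in> S)" for g i by (simp add: f0_def)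
  have f0\<Omega>: "act g f0 \<in> \<Omega>" for g
    by (rule act\<Omega>) (simp add: \<Omega>_def less)
  have inC: "act g f0 \<in> C i 0 \<longleftrightarrow> (if i then g \<in> L else g \<in> S)" for g i
    using f0\<Omega> by (simp add: C_def)
  define r where "r g = (SOME i. i < m \<and> act g f0 \<in> P i)" for g
  have r: "r g < m \<and> act g f0 \<in> P (r g)" if "g \<in> L" for g
  proof -
    have "\<exists>i. i < m \<and> act g f0 \<in> P i" using inC[of g True] that P(1) by auto
    then show ?thesis unfolding r_def by (rule someI_ex)
  qed
  have r_unique: "i = r g" if "g \<in> L" "i < m" "act g f0 \<in> P i" for g i
    using r[OF that(1)] that P(2) unfolding disjoint_family_on_def by blast
  define K where "K = (\<Union>i<m. (fst \<circ> b) ` k i)"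
  show ?thesis
  proof (rule that[of "h ` {..<m}" K "\<lambda>g. h (r g)"])
    show "finite (h ` {..<m})" by simp
    show "finite K" using k(1) by (auto simp: K_def)
    show "h (r g) \<in> h ` {..<m}" if "g \<in> L" for g using r[OF that] by blast
    show "h (r g) + g \<in> S" if "g \<in> L" for g
    proof -
      have "act (h (r g)) (act g f0) \<in> C False 0" using r[OF that] P(5) by blast
      then show ?thesis using inC[of "h (r g) + g" False] by (simp add: act_add)
    qed
    show "inj_on (\<lambda>g. h (r g) + g) L"
    proof (rule inj_onI)
      fix g g' assume g: "g \<in> L" "g' \<in> L" "h (r g) + g = h (r g') + g'"
      have "act (h (r g)) (act g f0) = act (h (r g')) (act g' f0)"
        using g(3) by (simp flip: act_add)
      then have "r g = r g'"
        using r[OF g(1)] r[OF g(2)] P(4) unfolding disjoint_family_on_def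
        by (metis IntI empty_iff imageI lessThan_iff)
      then show "g = g'" using g(3) by simp
    qed
    fix g g' assume g: "g \<in> L" "g' \<in> L"
      and eq: "\<forall>t\<in>K. (t + g \<in> L \<longleftrightarrow> t + g' \<in> L) \<and> (t + g \<in> S \<longleftrightarrow> t + g' \<in> S)"
    have "act g f0 j = act g' f0 j" if "j \<in> k (r g)" for j
    proof -
      have "fst (b j) \<in> K" using that r[OF g(1)] by (auto simp: K_def)
      then show ?thesis using eq by (simp add: act_def)
    qed
    then have "act g' f0 \<in> P (r g)" using k(2)[of "r g" "act g f0" "act g' f0"] r[OF g(1)] f0\<Omega> by auto
    then show "h (r g) = h (r g')" using r_unique[OF g(2)] r[OF g(1)] by metis
  qed
qed

section \<open>Blocks, gluing and the entropy limit\<close>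

lemma subshift_subset: "subshift \<Lambda> X \<Longrightarrow> X \<subseteq> full_shift \<Lambda>"
  unfolding subshift_def by (metis closedin_subset topspace_shift_topology)

lemma subshift_shift: "subshift \<Lambda> X \<Longrightarrow> x \<in> X \<Longrightarrow> shift g x \<in> X"
  by (simp add: subshift_def)

lemma blocks_eq:
  assumes "subshift \<Lambda> X"
  shows "blocks X T = (\<lambda>x. restrict x T) ` X"
proof (intro equalityI subsetI)
  fix B assume "B \<in> blocks X T"
  then obtain x g where x: "B \<in> extensional T" "x \<in> X" "occurs_at T B x g" by (auto simp: blocks_def)
  then have "B = restrict (shift g x) T"
    by (auto simp: fun_eq_iff occurs_at_def shift_def restrict_def extensional_def)
  then show "B \<in> (\<lambda>x. restrict x T) ` X" using subshift_shift[OF assms x(2)] by blast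
next
  fix B assume "B \<in> (\<lambda>x. restrict x T) ` X"
  then obtain x where "x \<in> X" "B = restrict x T" by blast
  then show "B \<in> blocks X T"
    unfolding blocks_def by (auto simp: occurs_at_def intro!: bexI[of _ x] exI[of _ 0])
qed

lemma blocks_subset:
  assumes "subshift \<Lambda> X" shows "blocks X T \<subseteq> T \<rightarrow>\<^sub>E \<Lambda>"
  using subshift_subset[OF assms] by (auto simp: blocks_eq[OF assms] full_shift_def)

lemma finite_blocks:
  assumes "subshift \<Lambda> X" "finite \<Lambda>" "finite T" shows "finite (blocks X T)"
  using blocks_subset[OF assms(1), of T] finite_PiE[of T "\<lambda>_. \<Lambda>"] assms by (auto intro: finite_subset)

lemma card_blocks_le:
  assumes "subshift \<Lambda> X" "finite \<Lambda>" "finite T" shows "card (blocks X T) \<le> card \<Lambda> ^ card T"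
proof -
  have "card (blocks X T) \<le> card (T \<rightarrow>\<^sub>E \<Lambda>)"
    using blocks_subset[OF assms(1), of T] finite_PiE[of T "\<lambda>_. \<Lambda>"] assms by (intro card_mono) auto
  then show ?thesis using assms by (simp add: card_PiE)
qed

lemma card_blocks_pos:
  assumes "subshift \<Lambda> X" "finite \<Lambda>" "finite T" "X \<noteq> {}" shows "1 \<le> card (blocks X T)"
proof -
  have "blocks X T \<noteq> {}" using assms by (auto simp: blocks_eq[OF assms(1)])
  then show ?thesis using finite_blocks[OF assms(1-3)] by (simp add: Suc_le_eq card_gt_0_iff)
qed

lemma card_blocks_mono:
  assumes "subshift \<Lambda> X" "finite \<Lambda>" "finite T" "S \<subseteq> T" shows "card (blocks X S) \<le> card (blocks X T)"
proof -
  have "blocks X S = (\<lambda>b. restrict b S) ` blocks X T"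
    using assms(4) by (auto simp: blocks_eq[OF assms(1)] image_image inf_absorb2)
  then show ?thesis using finite_blocks[OF assms(1-3)] by (simp add: card_image_le)
qed

lemma card_blocks_Un:
  assumes "subshift \<Lambda> X" "finite \<Lambda>" "finite S" "finite T"
  shows "card (blocks X (S \<union> T)) \<le> card (blocks X S) * card (blocks X T)"
proof -
  have "card (blocks X (S \<union> T)) \<le> card (blocks X S \<times> blocks X T)"
  proof (rule card_inj_on_le[of "\<lambda>b. (restrict b S, restrict b T)"])
    show "inj_on (\<lambda>b. (restrict b S, restrict b T)) (blocks X (S \<union> T))"
    proof (rule inj_onI)
      fix a b assume "a \<in> blocks X (S \<union> T)" "b \<in> blocks X (S \<union> T)"
        and eq: "(restrict a S, restrict a T) = (restrict b S, restrict b T)"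
      then have ext: "a \<in> extensional (S \<union> T)" "b \<in> extensional (S \<union> T)" by (auto simp: blocks_def)
      have "a x = b x" if "x \<in> S \<union> T" for x using eq that by (metis Pair_inject UnE restrict_apply')
      then show "a = b" using ext by (intro extensionalityI) auto
    qed
    show "(\<lambda>b. (restrict b S, restrict b T)) ` blocks X (S \<union> T) \<subseteq> blocks X S \<times> blocks X T"
      by (auto simp: blocks_eq[OF assms(1)])
  qed (use assms in \<open>auto intro: finite_blocks\<close>)
  then show ?thesis by (simp add: card_cartesian_product)
qed

lemma card_blocks_UN:
  assumes "subshift \<Lambda> X" "finite \<Lambda>" "finite I" "\<And>i. i \<in> I \<Longrightarrow> finite (S i)"
  shows "card (blocks X (\<Union>i\<in>I. S i)) \<le> (\<Prod>i\<in>I. card (blocks X (S i)))"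
  using assms(3,4)
proof (induction I rule: finite_induct)
  case empty
  then show ?case using card_blocks_le[OF assms(1,2), of "{}"] by simp
next
  case (insert i I)
  have "card (blocks X (\<Union>i\<in>insert i I. S i)) \<le> card (blocks X (S i)) * card (blocks X (\<Union>i\<in>I. S i))"
    using card_blocks_Un[OF assms(1,2), of "S i" "\<Union>i\<in>I. S i"] insert by simp
  also have "\<dots> \<le> card (blocks X (S i)) * (\<Prod>i\<in>I. card (blocks X (S i)))"
    using insert by (intro mult_left_mono) auto
  finally show ?case using insert by simp
qed

lemma card_blocks_diff:
  assumes "subshift \<Lambda> X" "finite \<Lambda>" "finite T" "S \<subseteq> T"
  shows "card (blocks X T) \<le> card (blocks X S) * card \<Lambda> ^ card (T - S)"
proof -
  have fin: "finite S" using assms(3,4) by (rule finite_subset[rotated])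
  have "card (blocks X T) \<le> card (blocks X S) * card (blocks X (T - S))"
    using card_blocks_Un[OF assms(1,2) fin, of "T - S"] assms(3,4) by (simp add: Un_absorb1)
  also have "\<dots> \<le> card (blocks X S) * card \<Lambda> ^ card (T - S)"
    using card_blocks_le[OF assms(1,2), of "T - S"] assms(3) by (intro mult_left_mono) auto
  finally show ?thesis .
qed

lemma card_blocks_translate:
  assumes "subshift \<Lambda> X" "finite \<Lambda>" "finite T"
  shows "card (blocks X (T + {g})) = card (blocks X T)"
proof -
  have le: "card (blocks X (T + {g})) \<le> card (blocks X T)" if "finite T" for T g
  proof (rule card_inj_on_le[of "\<lambda>b. restrict (\<lambda>t. b (t + g)) T"])
    show "inj_on (\<lambda>b. restrict (\<lambda>t. b (t + g)) T) (blocks X (T + {g}))"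
    proof (rule inj_onI)
      fix a b assume "a \<in> blocks X (T + {g})" "b \<in> blocks X (T + {g})"
        and eq: "restrict (\<lambda>t. a (t + g)) T = restrict (\<lambda>t. b (t + g)) T"
      then have ext: "a \<in> extensional (T + {g})" "b \<in> extensional (T + {g})" by (auto simp: blocks_def)
      have "a x = b x" if "x \<in> T + {g}" for x
        using fun_cong[OF eq, of "x - g"] that by (simp add: mem_translate)
      then show "a = b" using ext by (intro extensionalityI) auto
    qed
    show "(\<lambda>b. restrict (\<lambda>t. b (t + g)) T) ` blocks X (T + {g}) \<subseteq> blocks X T"
    proof safe
      fix b assume "b \<in> blocks X (T + {g})"
      then obtain x where x: "x \<in> X" "b = restrict x (T + {g})" by (auto simp: blocks_eq[OF assms(1)])
      then have "restrict (\<lambda>t. b (t + g)) T = restrict (shift g x) T"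
        by (auto simp: fun_eq_iff shift_def mem_translate)
      then show "restrict (\<lambda>t. b (t + g)) T \<in> blocks X T"
        using subshift_shift[OF assms(1) x(1)] by (auto simp: blocks_eq[OF assms(1)])
    qed
    show "finite (blocks X T)" using that assms by (intro finite_blocks)
  qed
  have "T + {g} + {- g} = T" by (auto simp: mem_translate)
  then show ?thesis using le[of T g] le[of "T + {g}" "- g"] assms(3) by simp
qed

lemma irreducible_glue_two:
  assumes X: "subshift \<Lambda> X" and D: "irreducibility_distance X D"
    and S: "finite S" "finite S'" "(D + S) \<inter> S' = {}" and x: "x \<in> X" "x' \<in> X"
  shows "\<exists>z\<in>X. (\<forall>s\<in>S. z s = x s) \<and> (\<forall>s\<in>S'. z s = x' s)"
proof -
  have "restrict x S \<in> blocks X S" "restrict x' S' \<in> blocks X S'"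
    using x by (auto simp: blocks_eq[OF X])
  moreover have "(D + S + {0}) \<inter> (S' + {0}) = {}" using S(3) by (auto simp: mem_translate)
  ultimately obtain z where "z \<in> X" "occurs_at S (restrict x S) z 0" "occurs_at S' (restrict x' S') z 0"
    using D S unfolding irreducibility_distance_def by blast
  then show ?thesis by (auto simp: occurs_at_def)
qed

lemma irreducible_glue_finite:
  assumes X: "subshift \<Lambda> X" and D: "irreducibility_distance X D" and ne: "X \<noteq> {}"
    and I: "finite I" "\<And>i. i \<in> I \<Longrightarrow> finite (S i) \<and> x i \<in> X"
    and sep: "\<And>i j. i \<in> I \<Longrightarrow> j \<in> I \<Longrightarrow> i \<noteq> j \<Longrightarrow> (D + S i) \<inter> S j = {}"
  shows "\<exists>z\<in>X. \<forall>i\<in>I. \<forall>s\<in>S i. z s = x i s"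
  using I sep
proof (induction I rule: finite_induct)
  case empty
  then show ?case using ne by auto
next
  case (insert i I)
  then obtain z where z: "z \<in> X" "\<forall>j\<in>I. \<forall>s\<in>S j. z s = x j s" by blast
  have "(D + S j) \<inter> S i = {}" if "j \<in> I" for j using insert that by blast
  then have "(D + (\<Union>j\<in>I. S j)) \<inter> S i = {}" by (fastforce simp: set_plus_def)
  then obtain y where "y \<in> X" "\<forall>s\<in>\<Union>j\<in>I. S j. y s = z s" "\<forall>s\<in>S i. y s = x i s"
    using irreducible_glue_two[OF X D _ _ _ z(1), of "\<Union>j\<in>I. S j" "S i" "x i"] insert by auto
  then show ?case using z by (auto intro!: bexI[of _ y])
qed

text \<open>
  The finite case is iterated strong irreducibility; the general case follows by compactness of \<open>X\<close>.
\<close>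

lemma irreducible_glue:
  assumes X: "subshift \<Lambda> X" and fin: "finite \<Lambda>" and D: "irreducibility_distance X D" and ne: "X \<noteq> {}"
    and I: "\<And>i. i \<in> I \<Longrightarrow> finite (S i) \<and> x i \<in> X"
    and sep: "\<And>i j. i \<in> I \<Longrightarrow> j \<in> I \<Longrightarrow> i \<noteq> j \<Longrightarrow> (D + S i) \<inter> S j = {}"
  shows "\<exists>z\<in>X. \<forall>i\<in>I. \<forall>s\<in>S i. z s = x i s"
proof -
  let ?W = "subtopology (shift_topology \<Lambda>) X"
  have cl: "closedin (shift_topology \<Lambda>) X" using X by (simp add: subshift_def)
  have sub: "X \<subseteq> full_shift \<Lambda>" by (rule subshift_subset[OF X])
  have comp: "compact_space ?W"
    using closedin_compact_space[OF compact_space_shift[OF fin] cl] by (simp add: compact_space_subtopology)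
  define A where "A i = {z \<in> X. \<forall>s\<in>S i. z s = x i s}" for i
  have clA: "closedin ?W (A i)" if "i \<in> I" for i
    unfolding closedin_def openin_subshift_iff[OF sub] topspace_subshift[OF sub]
    using I[OF that] by (auto simp: A_def intro!: exI[of _ "S i"])
  have "(\<forall>C\<in>insert X (A ` I). closedin ?W C) \<and>
    (\<forall>\<F>. finite \<F> \<and> \<F> \<subseteq> insert X (A ` I) \<longrightarrow> \<Inter> \<F> \<noteq> {})"
  proof (intro conjI ballI allI impI)
    fix C assume "C \<in> insert X (A ` I)"
    then show "closedin ?W C"
      using clA closedin_topspace[of ?W, unfolded topspace_subshift[OF sub]] by auto
  next
    fix \<F> assume \<F>: "finite \<F> \<and> \<F> \<subseteq> insert X (A ` I)"
    then have "finite (\<F> - {X})" "\<F> - {X} \<subseteq> A ` I" by auto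
    then obtain J where J: "J \<subseteq> I" "finite J" "\<F> - {X} = A ` J" using finite_subset_image by metis
    have "\<exists>z\<in>X. \<forall>i\<in>J. \<forall>s\<in>S i. z s = x i s"
      by (rule irreducible_glue_finite[OF X D ne J(2)]) (use J(1) I sep in blast)+
    then obtain z where z: "z \<in> X" "\<forall>i\<in>J. \<forall>s\<in>S i. z s = x i s" by blast
    have "z \<in> \<Inter> (insert X (A ` J))" using z by (auto simp: A_def)
    moreover have "\<F> \<subseteq> insert X (A ` J)" using J(3) by auto
    ultimately show "\<Inter> \<F> \<noteq> {}" by blast
  qed
  then have "\<Inter> (insert X (A ` I)) \<noteq> {}" using comp unfolding compact_space_fip by blast
  then show ?thesis by (auto simp: A_def)
qed


lemma log_prod_pos:
  fixes f :: "'i \<Rightarrow> real"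
  shows "finite J \<Longrightarrow> (\<And>i. i \<in> J \<Longrightarrow> 0 < f i) \<Longrightarrow> log b (\<Prod>i\<in>J. f i) = (\<Sum>i\<in>J. log b (f i))"
  by (induction J rule: finite_induct) (auto simp: log_mult_pos prod_pos)

text \<open>
  If the ratio is at most \<open>a\<close> infinitely often, then shapes with this property can be used for a
  quasi-tiling. A late \<open>F n\<close> is covered by the tiles inside it up to a small proportion, the disjoint
  cores bound the total size of these tiles, and the number of blocks is submultiplicative.
\<close>

lemma entropy_ratio_eventually_le:
  fixes F :: "nat \<Rightarrow> 'g::group_add set" and a \<eta> :: real
  assumes F: "folner_sequence F" and cnt: "countable (UNIV :: 'g set)" "infinite (UNIV :: 'g set)"
    and fin: "finite \<Lambda>" and X: "subshift \<Lambda> X" and ne: "X \<noteq> {}"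
    and freq: "\<exists>\<^sub>F n in sequentially. log 2 (card (blocks X (F n))) / card (F n) \<le> a" and \<eta>: "\<eta> > 0"
  shows "\<forall>\<^sub>F n in sequentially. log 2 (card (blocks X (F n))) / card (F n) \<le> a + \<eta>"
proof -
  have finF: "finite (F n)" "F n \<noteq> {}" "card (F n) > 0" for n
    using F by (auto simp: folner_sequence_def card_gt_0_iff)
  have pos: "1 \<le> card (blocks X T)" if "finite T" for T by (rule card_blocks_pos[OF X fin that ne])
  have lognn: "0 \<le> log 2 (card (blocks X T))" if "finite T" for T
    using pos[OF that] by simp
  obtain n where "log 2 (card (blocks X (F n))) / card (F n) \<le> a" using freq by (auto dest: frequently_ex)
  moreover have "0 \<le> log 2 (card (blocks X (F n))) / card (F n)" using lognn finF by simp
  ultimately have a0: "a \<ge> 0" by linarith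
  define l where "l = log 2 (card \<Lambda>)"
  have "\<Lambda> \<noteq> {}" using ne subshift_subset[OF X] by (auto simp: full_shift_def)
  then have card\<Lambda>: "1 \<le> card \<Lambda>" using fin by (simp add: Suc_le_eq card_gt_0_iff)
  then have l0: "l \<ge> 0" by (simp add: l_def)
  have logle: "log 2 (card (blocks X T)) \<le> card T * l" if "finite T" for T
  proof -
    have "real (card (blocks X T)) \<le> real (card \<Lambda>) ^ card T"
      using card_blocks_le[OF X fin that] by (metis of_nat_le_iff of_nat_power)
    then have "log 2 (card (blocks X T)) \<le> log 2 (real (card \<Lambda>) ^ card T)"
      using pos[OF that] card\<Lambda> by (subst log_le_cancel_iff) auto
    then show ?thesis using card\<Lambda> by (simp add: l_def log_nat_power)
  qed
  define \<epsilon> where "\<epsilon> = min (1 / 2) (\<eta> / (2 * a + 4 * l + 1))"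
  have \<epsilon>: "0 < \<epsilon>" "\<epsilon> \<le> 1 / 2" using \<eta> a0 l0 by (simp_all only: \<epsilon>_def min.cobounded1) simp
  then have \<epsilon>1: "\<epsilon> < 1" by simp
  have "\<epsilon> * (2 * a + 4 * l) \<le> \<epsilon> * (2 * a + 4 * l + 1)" using \<epsilon> by (intro mult_left_mono) auto
  also have "\<dots> \<le> \<eta> / (2 * a + 4 * l + 1) * (2 * a + 4 * l + 1)"
    using a0 l0 by (intro mult_right_mono) (auto simp: \<epsilon>_def)
  also have "\<dots> = \<eta>" using a0 l0 by (simp add: add_nonneg_eq_0_iff)
  finally have \<epsilon>\<eta>: "\<epsilon> * (2 * a + 4 * l) \<le> \<eta>" .
  obtain k where k: "(1 - \<epsilon>) ^ k < \<epsilon>"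
    using real_arch_pow_inv[of \<epsilon> "1 - \<epsilon>"] \<epsilon> by auto
  define P where "P S \<longleftrightarrow> log 2 (card (blocks X S)) \<le> a * card S" for S
  have ex: "\<exists>S. finite S \<and> S \<noteq> {} \<and> {} \<subseteq> S \<and> P S \<and> real (card ((K + S) - S)) \<le> \<delta> * card S"
    if K: "finite K" "\<delta> > 0" for K and \<delta> :: real
  proof -
    have "\<exists>\<^sub>F n in sequentially. log 2 (card (blocks X (F n))) / card (F n) \<le> a \<and>
       real (card ((K + F n) - F n)) \<le> \<delta> * card (F n)"
      using frequently_eventually_conj[OF freq folner_expand[OF F K]] by (simp add: conj_commute)
    then obtain n where "log 2 (card (blocks X (F n))) / card (F n) \<le> a"
       "real (card ((K + F n) - F n)) \<le> \<delta> * card (F n)" by (auto dest: frequently_ex)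
    then show ?thesis using finF[of n] by (intro exI[of _ "F n"]) (auto simp: P_def field_simps)
  qed
  obtain T C R where T: "\<And>j. j < k \<Longrightarrow> finite (T j) \<and> T j \<noteq> {} \<and> P (T j)"
    and CR: "quasi_tiling k T C R \<epsilon> {}"
    and dens: "density_le F (- covered k T C) ((1 - \<epsilon>) ^ k + \<epsilon>)"
    by (rule quasi_tiling_exists[where k = k, OF F cnt \<epsilon>(1) \<epsilon>1 \<epsilon>(1) _ ex]) (simp_all, blast)
  define K where "K = (\<Union>j<k. T j + uminus ` T j)"
  have K: "finite K" using T by (auto simp: K_def intro!: finite_set_plus)
  have "\<forall>\<^sub>F n in sequentially. \<forall>h. real (card (- covered k T C \<inter> (F n + {h}))) \<le> (((1 - \<epsilon>) ^ k + \<epsilon>) + \<epsilon>) * card (F n)"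
    and "\<forall>\<^sub>F n in sequentially. real (card {g \<in> F n. \<exists>k\<in>K. k + g \<notin> F n}) \<le> \<epsilon> * card (F n)"
    using dens \<epsilon> folner_interior[OF F K \<epsilon>(1)] by (auto simp: density_le_def)
  then show ?thesis
  proof eventually_elim
    case (elim n)
    define Z where "Z = (- covered k T C \<inter> F n) \<union> {g \<in> F n. \<exists>k\<in>K. k + g \<notin> F n}"
    have finZ: "finite Z" using finF by (auto simp: Z_def)
    have e1: "F n + {0} = F n" by (auto simp: mem_translate)
    have "card Z \<le> card (- covered k T C \<inter> F n) + card {g \<in> F n. \<exists>k\<in>K. k + g \<notin> F n}"
      unfolding Z_def by (rule card_Un_le)
    then have "real (card Z) \<le> (((1 - \<epsilon>) ^ k + \<epsilon>) + \<epsilon>) * card (F n) + \<epsilon> * card (F n)"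
      using elim(1)[rule_format, of 0] elim(2) unfolding e1 by linarith
    also have "\<dots> = ((1 - \<epsilon>) ^ k + 3 * \<epsilon>) * card (F n)" by (simp add: algebra_simps)
    also have "\<dots> \<le> (4 * \<epsilon>) * card (F n)" using k by (intro mult_right_mono) auto
    finally have cZ: "real (card Z) \<le> 4 * \<epsilon> * card (F n)" .
    define J where "J = {i \<in> Sigma {..<k} C. T (fst i) + {snd i} \<subseteq> F n}"
    have RT: "R i \<subseteq> T (fst i) + {snd i}" "(1 - \<epsilon>) * real (card (T (fst i))) \<le> real (card (R i))"
      if "i \<in> Sigma {..<k} C" for i
      by (rule quasi_tilingD[OF CR that])+
    have disj: "disjoint_family_on R J"
      using CR by (auto simp: quasi_tiling_def disjoint_family_on_def J_def)
    have RF: "R i \<subseteq> F n" if "i \<in> J" for i using RT[of i] that by (auto simp: J_def)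
    have Rne: "R i \<noteq> {}" if "i \<in> J" for i
    proof
      assume "R i = {}"
      moreover have "0 < card (T (fst i))" using T[of "fst i"] that by (auto simp: J_def card_gt_0_iff)
      ultimately show False using RT(2)[of i] that \<epsilon> by (auto simp: J_def mult_le_0_iff)
    qed
    have finJ: "finite J"
    proof (rule finite_imageD)
      show "finite (R ` J)" by (rule finite_subset[of _ "Pow (F n)"]) (use RF finF in auto)
      show "inj_on R J" using disj Rne unfolding inj_on_def disjoint_family_on_def by (metis Int_absorb)
    qed
    have cover: "F n \<subseteq> (\<Union>i\<in>J. T (fst i) + {snd i}) \<union> Z"
    proof
      fix g assume g: "g \<in> F n"
      show "g \<in> (\<Union>i\<in>J. T (fst i) + {snd i}) \<union> Z"
      proof (cases "g \<in> covered k T C")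
        case True
        then obtain j c where jc: "j < k" "c \<in> C j" "g \<in> T j + {c}" by (auto simp: covered_def)
        show ?thesis
        proof (cases "T j + {c} \<subseteq> F n")
          case True
          then have "(j, c) \<in> J" using jc by (auto simp: J_def)
          then show ?thesis using jc by force
        next
          case False
          then obtain y where y: "y \<in> T j + {c}" "y \<notin> F n" by blast
          have "(y - c) + - (g - c) \<in> T j + uminus ` T j"
            using y jc by (intro set_plus_intro imageI) (auto simp: mem_translate)
          then have "y - g \<in> K" using jc by (auto simp: K_def add_diff_eq)
          moreover have "(y - g) + g \<notin> F n" using y by simp
          ultimately show ?thesis using g unfolding Z_def by blast
        qed
      qed (use g in \<open>auto simp: Z_def\<close>)
    qed
    have finT: "finite (T (fst i) + {snd i})" if "i \<in> J" for i using T[of "fst i"] that by (auto simp: J_def)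
    have "card (blocks X (F n)) \<le> card (blocks X ((\<Union>i\<in>J. T (fst i) + {snd i}) \<union> Z))"
      using cover finJ finT finZ by (intro card_blocks_mono[OF X fin]) auto
    also have "\<dots> \<le> card (blocks X (\<Union>i\<in>J. T (fst i) + {snd i})) * card (blocks X Z)"
      using finJ finT finZ by (intro card_blocks_Un[OF X fin]) auto
    also have "\<dots> \<le> (\<Prod>i\<in>J. card (blocks X (T (fst i) + {snd i}))) * card (blocks X Z)"
      using finJ finT by (intro mult_right_mono card_blocks_UN[OF X fin]) auto
    also have "(\<Prod>i\<in>J. card (blocks X (T (fst i) + {snd i}))) = (\<Prod>i\<in>J. card (blocks X (T (fst i))))"
      using T by (intro prod.cong refl card_blocks_translate[OF X fin]) (auto simp: J_def)
    finally have "real (card (blocks X (F n))) \<le> (\<Prod>i\<in>J. real (card (blocks X (T (fst i))))) * card (blocks X Z)"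
      by (metis of_nat_le_iff of_nat_mult of_nat_prod)
    moreover have posT: "0 < real (card (blocks X (T (fst i))))" if "i \<in> J" for i
      using pos[of "T (fst i)"] T[of "fst i"] that by (auto simp: J_def)
    moreover have "0 < real (card (blocks X Z))" "0 < real (card (blocks X (F n)))"
      using pos[OF finZ] pos[OF finF(1)[of n]] by linarith+
    ultimately have "log 2 (card (blocks X (F n))) \<le> log 2 ((\<Prod>i\<in>J. real (card (blocks X (T (fst i))))) * card (blocks X Z))"
      by (subst log_le_cancel_iff) (auto intro!: mult_pos_pos prod_pos)
    also have "\<dots> = log 2 (\<Prod>i\<in>J. real (card (blocks X (T (fst i))))) + log 2 (card (blocks X Z))"
      using posT pos[OF finZ] by (intro log_mult_pos) (auto intro!: prod_pos)
    also have "log 2 (\<Prod>i\<in>J. real (card (blocks X (T (fst i))))) = (\<Sum>i\<in>J. log 2 (card (blocks X (T (fst i)))))"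
      using posT finJ by (intro log_prod_pos) auto
    also have "\<dots> \<le> (\<Sum>i\<in>J. (a / (1 - \<epsilon>)) * card (R i))"
    proof (rule sum_mono)
      fix i assume i: "i \<in> J"
      then have "log 2 (card (blocks X (T (fst i)))) \<le> a * card (T (fst i))"
        using T[of "fst i"] by (auto simp: J_def P_def)
      also have "\<dots> = (a / (1 - \<epsilon>)) * ((1 - \<epsilon>) * card (T (fst i)))" using \<epsilon> by simp
      also have "\<dots> \<le> (a / (1 - \<epsilon>)) * card (R i)"
        using RT(2)[of i] i a0 \<epsilon> by (intro mult_left_mono) (auto simp: J_def)
      finally show "log 2 (card (blocks X (T (fst i)))) \<le> (a / (1 - \<epsilon>)) * card (R i)" .
    qed
    also have "\<dots> = (a / (1 - \<epsilon>)) * real (\<Sum>i\<in>J. card (R i))" by (simp add: sum_distrib_left)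
    also have "(\<Sum>i\<in>J. card (R i)) = card (\<Union>i\<in>J. R i)"
    proof (rule card_UN_disjoint[symmetric, OF finJ])
      show "\<forall>i\<in>J. finite (R i)" using RF finF(1)[of n] by (meson finite_subset)
      show "\<forall>i\<in>J. \<forall>j\<in>J. i \<noteq> j \<longrightarrow> R i \<inter> R j = {}" using disj by (auto simp: disjoint_family_on_def)
    qed
    also have "(a / (1 - \<epsilon>)) * real (card (\<Union>i\<in>J. R i)) \<le> (a / (1 - \<epsilon>)) * real (card (F n))"
      using a0 \<epsilon> RF finF by (intro mult_left_mono of_nat_mono card_mono) auto
    also have "a / (1 - \<epsilon>) \<le> a + 2 * \<epsilon> * a"
    proof -
      have "1 / (1 - \<epsilon>) \<le> 1 + 2 * \<epsilon>"
      proof -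
        have "\<epsilon> * \<epsilon> \<le> \<epsilon> * (1 / 2)" using \<epsilon> by (intro mult_left_mono) auto
        then have "1 \<le> (1 + 2 * \<epsilon>) * (1 - \<epsilon>)" using \<epsilon> by (simp add: algebra_simps)
        then show ?thesis using \<epsilon> by (simp add: pos_divide_le_eq)
      qed
      then have "a * (1 / (1 - \<epsilon>)) \<le> a * (1 + 2 * \<epsilon>)" using a0 by (rule mult_left_mono)
      then show ?thesis by (simp add: algebra_simps)
    qed
    also have "log 2 (card (blocks X Z)) \<le> card Z * l" by (rule logle[OF finZ])
    also have "card Z * l \<le> (4 * \<epsilon> * card (F n)) * l" using cZ l0 by (rule mult_right_mono)
    finally have "log 2 (card (blocks X (F n))) \<le> (a + 2 * \<epsilon> * a) * card (F n) + (4 * \<epsilon> * card (F n)) * l"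
      by (simp add: mult_right_mono)
    also have "\<dots> = (a + \<epsilon> * (2 * a + 4 * l)) * card (F n)" by (simp add: algebra_simps)
    also have "\<dots> \<le> (a + \<eta>) * card (F n)" using \<epsilon>\<eta> by (intro mult_right_mono) auto
    finally show ?case using finF(3)[of n] by (simp add: divide_le_eq)
  qed
qed

text \<open>
  By the preceding lemma the limit superior of the ratios does not exceed their limit inferior; the
  latter is \<open>Inf S\<close>.
\<close>

lemma entropy_tendsto:
  fixes F :: "nat \<Rightarrow> 'g::group_add set"
  assumes F: "folner_sequence F" and cnt: "countable (UNIV :: 'g set)" "infinite (UNIV :: 'g set)"
    and fin: "finite \<Lambda>" and X: "subshift \<Lambda> X" and ne: "X \<noteq> {}"
  shows "(\<lambda>n. log 2 (card (blocks X (F n))) / card (F n)) \<longlonglongrightarrow> entropy F X"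
proof -
  define a where "a = (\<lambda>n. log 2 (card (blocks X (F n))) / card (F n))"
  have finF: "finite (F n)" "F n \<noteq> {}" "card (F n) > 0" for n
    using F by (auto simp: folner_sequence_def card_gt_0_iff)
  have pos: "1 \<le> card (blocks X (F n))" for n by (rule card_blocks_pos[OF X fin finF(1) ne])
  have a0: "0 \<le> a n" for n using pos[of n] by (simp add: a_def)
  have "\<Lambda> \<noteq> {}" using ne subshift_subset[OF X] by (auto simp: full_shift_def)
  then have card\<Lambda>: "1 \<le> card \<Lambda>" using fin by (simp add: Suc_le_eq card_gt_0_iff)
  have al: "a n \<le> log 2 (card \<Lambda>)" for n
  proof -
    have "real (card (blocks X (F n))) \<le> real (card \<Lambda>) ^ card (F n)"
      using card_blocks_le[OF X fin finF(1)] by (metis of_nat_le_iff of_nat_power)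
    then have "log 2 (card (blocks X (F n))) \<le> log 2 (real (card \<Lambda>) ^ card (F n))"
      using pos[of n] card\<Lambda> by (subst log_le_cancel_iff) auto
    then have "log 2 (card (blocks X (F n))) \<le> card (F n) * log 2 (card \<Lambda>)"
      using card\<Lambda> by (simp add: log_nat_power)
    then show ?thesis using finF(3)[of n] by (simp add: a_def divide_le_eq mult.commute)
  qed
  define S where "S = {r. \<exists>\<^sub>F n in sequentially. a n \<le> r}"
  have Sne: "log 2 (card \<Lambda>) \<in> S" using al by (simp add: S_def)
  have Sbd: "0 \<le> r" if r: "r \<in> S" for r
  proof -
    obtain n where "a n \<le> r" using r frequently_ex unfolding S_def by blast
    then show ?thesis using a0[of n] by linarith
  qed
  then have bdd: "bdd_below S" by (auto simp: bdd_below_def)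
  have "a \<longlonglongrightarrow> Inf S"
  proof (rule order_tendstoI)
    fix r assume "r < Inf S"
    then have "r \<notin> S" using cInf_lower[OF _ bdd, of r] by auto
    then have "\<forall>\<^sub>F n in sequentially. \<not> a n \<le> r" by (simp add: S_def frequently_def)
    then show "\<forall>\<^sub>F n in sequentially. r < a n" by (simp add: not_le)
  next
    fix r assume r: "Inf S < r"
    then obtain q where q: "q \<in> S" "q < r" using cInf_lessD[of S r] Sne by blast
    have "\<forall>\<^sub>F n in sequentially. a n \<le> q + (r - q) / 2"
      unfolding a_def
      by (rule entropy_ratio_eventually_le[OF F cnt fin X ne]) (use q in \<open>auto simp: S_def a_def\<close>)
    then show "\<forall>\<^sub>F n in sequentially. a n < r"
    proof eventually_elim
      case (elim n)
      moreover have "q + (r - q) / 2 < r" using q by (simp add: field_simps)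
      ultimately show ?case by linarith
    qed
  qed
  moreover from this have "entropy F X = Inf S" unfolding entropy_def a_def by (rule limI)
  ultimately show ?thesis by (simp add: a_def)
qed

section \<open>Rigid sets and separated sets\<close>

text \<open>
  If the centralizer of \<open>p\<close> is infinite, its elements fix \<open>p\<close> under conjugation. If it is finite, each
  conjugate of \<open>p\<close> arises from finitely many \<open>a\<close> only.
\<close>

lemma infinite_conjugates_avoid:
  fixes E :: "'g::group_add set"
  assumes inf: "infinite (UNIV :: 'g set)" and E: "finite E" and p: "p \<notin> E"
  shows "infinite {a. a + p - a \<notin> E}"
proof (cases "finite {a. a + p = p + a}")
  case False
  have "{a. a + p = p + a} \<subseteq> {a. a + p - a \<notin> E}"
  proof
    fix a assume "a \<in> {a. a + p = p + a}"
    then have "a + p - a = p" by simp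
    then show "a \<in> {a. a + p - a \<notin> E}" using p by simp
  qed
  then show ?thesis using False by (rule infinite_super)
next
  case True
  have "finite {a. a + p - a = e}" for e
  proof (cases "{a. a + p - a = e} = {}")
    case False
    then obtain a where a: "a + p - a = e" by blast
    have "{b. b + p - b = e} \<subseteq> (\<lambda>c. a + c) ` {c. c + p = p + c}"
    proof
      fix b assume "b \<in> {b. b + p - b = e}"
      then have "(b + p - b) + b = e + b" by simp
      then have b: "b + p = e + b" by simp
      have "(a + p - a) + a = e + a" using a by simp
      then have a': "a + p = e + a" by simp
      have "- a + e = - a + (e + a) + - a" by (simp flip: add.assoc)
      also have "\<dots> = p + - a" by (simp flip: a')
      finally have pa: "- a + e = p + - a" .
      have "- a + b + p = - a + e + b" using b by (simp add: add.assoc)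
      also note pa
      finally have "(- a + b) + p = p + (- a + b)" by (simp only: add.assoc)
      moreover have "b = a + (- a + b)" by simp
      ultimately show "b \<in> (\<lambda>c. a + c) ` {c. c + p = p + c}" by blast
    qed
    then show ?thesis using True by (auto intro: finite_subset)
  qed simp
  then have fin: "finite (\<Union>e\<in>E. {a. a + p - a = e})" using E by blast
  have U: "UNIV = {a. a + p - a \<notin> E} \<union> (\<Union>e\<in>E. {a. a + p - a = e})" by auto
  show ?thesis
  proof
    assume "finite {a. a + p - a \<notin> E}"
    from finite_UnI[OF this fin] show False using inf U by simp
  qed
qed

text \<open>
  A finite set \<open>A\<close> far away from \<open>T\<close> whose right translates by \<open>p\<close> stay close to \<open>T \<union> A\<close> only if
  \<open>p\<close> is in \<open>E\<close>. Note that \<open>E\<close> is chosen before \<open>T\<close>, so that \<open>T\<close> may be the domain of a block that is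
  aperiodic with respect to \<open>E\<close>.
  
  Start with two elements \<open>a1\<close> and \<open>a2\<close> in general position. Every \<open>p \<notin> E\<close> that moves \<open>a1\<close> close to
  \<open>T\<close>, \<open>a1\<close> or \<open>a2\<close> is one of finitely many, the set \<open>B0\<close>, and for each of them an element \<open>a\<close> is added
  which \<open>p\<close> moves away from everything; such an \<open>a\<close> exists since \<open>a + p - a \<notin> E\<close> for infinitely many
  \<open>a\<close>. If \<open>p\<close> moves \<open>a1\<close> close to a later element, then \<open>a2\<close> is moved away from everything.
\<close>

lemma rigid_set:
  fixes E T :: "'g::group_add set"
  assumes inf: "infinite (UNIV :: 'g set)" and E: "finite E" and T: "finite T"
  obtains A where "finite A" "m \<le> card A" "A \<inter> (E + T) = {}"
    "\<And>a a'. a \<in> A \<Longrightarrow> a' \<in> A \<Longrightarrow> a \<noteq> a' \<Longrightarrow> a \<notin> E + {a'}"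
    "\<And>p. A + {p} \<subseteq> E + (T \<union> A) \<Longrightarrow> p \<in> E"
proof -
  have nE: "finite (uminus ` E)" using E by simp
  obtain a1 where a1: "a1 \<notin> E + T"
    using ex_new_if_finite[OF inf finite_set_plus[OF E T]] by blast
  have "finite ((E + T) \<union> (E + {a1}) \<union> (uminus ` E + {a1}) \<union> (E + uminus ` E + {a1}) \<union> {a1})"
    using E T nE by (simp add: finite_set_plus)
  from ex_new_if_finite[OF inf this] obtain a2 where "a2 \<notin> (E + T) \<union> (E + {a1}) \<union> (uminus ` E + {a1}) \<union> (E + uminus ` E + {a1}) \<union> {a1}"
    by (rule exE)
  then have a2: "a2 \<notin> E + T" "a2 \<notin> E + {a1}" "a2 \<notin> uminus ` E + {a1}" "a2 \<notin> E + uminus ` E + {a1}" "a2 \<noteq> a1"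
    by blast+
  have a12: "a1 \<notin> E + {a2}"
  proof
    assume "a1 \<in> E + {a2}"
    then have "a1 - a2 \<in> E" by (simp add: mem_translate)
    then have "- (a1 - a2) \<in> uminus ` E" by blast
    then show False using a2(3) by (simp add: mem_translate)
  qed
  have a21: "a2 - a1 + f \<notin> E" if "f \<in> E" for f
  proof
    assume "a2 - a1 + f \<in> E"
    then have "(a2 - a1 + f) + - f \<in> E + uminus ` E" using that by (intro set_plus_intro imageI)
    moreover have "(a2 - a1 + f) + - f = a2 - a1" by (simp only: add.assoc right_minus add_0_right)
    ultimately show False using a2(4) unfolding mem_translate by simp
  qed
  have "\<exists>A. finite A \<and> a1 \<in> A \<and> a2 \<in> A \<and> card Bd \<le> card A \<and> A \<inter> (E + T) = {} \<and>
      (\<forall>a\<in>A. \<forall>a'\<in>A. a \<noteq> a' \<longrightarrow> a \<notin> E + {a'}) \<and>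
      (\<forall>p\<in>Bd. \<exists>a\<in>A. a + p \<notin> E + (T \<union> A)) \<and>
      (\<forall>l\<in>A - {a1, a2}. \<forall>f\<in>E. (a2 - a1 + f) + l \<notin> E + (T \<union> A))"
    if "finite Bd" "Bd \<inter> E = {}" for Bd
    using that
  proof (induction Bd rule: finite_induct)
    case empty
    show ?case using a1 a2 a12 by (intro exI[of _ "{a1, a2}"]) auto
  next
    case (insert p Bd)
    then obtain A where A: "finite A" "a1 \<in> A" "a2 \<in> A" "card Bd \<le> card A" "A \<inter> (E + T) = {}"
      "\<And>a a'. a \<in> A \<Longrightarrow> a' \<in> A \<Longrightarrow> a \<noteq> a' \<Longrightarrow> a \<notin> E + {a'}"
      "\<And>p. p \<in> Bd \<Longrightarrow> \<exists>a\<in>A. a + p \<notin> E + (T \<union> A)"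
      "\<And>l f. l \<in> A - {a1, a2} \<Longrightarrow> f \<in> E \<Longrightarrow> (a2 - a1 + f) + l \<notin> E + (T \<union> A)" by auto
    define G where "G = E + (T \<union> A)"
    have G: "finite G" using E T A(1) by (simp add: G_def finite_set_plus)
    \<comment> \<open>The positions that the new element has to avoid: it must be far from all earlier elements, and
      it must not come close to an image that was arranged to be far from everything.\<close>
    define Y where "Y = A \<union> (E + T) \<union> (E + A) \<union> (uminus ` E + A) \<union> (G + {- p})
      \<union> (uminus ` E + (A + Bd)) \<union> (uminus ` E + ((\<lambda>f. a2 - a1 + f) ` E + A))
      \<union> ((\<lambda>f. - (a2 - a1 + f)) ` E + G)"
    have "finite Y" using E T A(1) G nE insert.hyps by (simp add: Y_def finite_set_plus)
    moreover have "infinite {a. a + p - a \<notin> E}"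
      by (rule infinite_conjugates_avoid[OF inf E]) (use insert.prems in auto)
    ultimately have "\<not> {a. a + p - a \<notin> E} \<subseteq> Y" using finite_subset by blast
    then obtain a where aE: "a + p - a \<notin> E" and aY: "a \<notin> Y" by blast
    have neg: "y \<notin> E + {a}" if "\<forall>e\<in>E. a \<noteq> - e + y" for y
    proof
      assume "y \<in> E + {a}"
      then obtain e where e: "e \<in> E" "y = e + a" by (auto simp: set_plus_def)
      then have "a = - e + y" by simp
      then show False using e(1) that by blast
    qed
    have *: "y \<notin> E + (T \<union> insert a A)" if "y \<notin> G" "y \<notin> E + {a}" for y
    proof
      assume "y \<in> E + (T \<union> insert a A)"
      then obtain e x where ex: "y = e + x" "e \<in> E" "x \<in> T \<union> insert a A" by (rule set_plus_elim)
      have "y \<in> E + {a} \<or> y \<in> G"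
      proof (cases "x = a")
        case True
        then show ?thesis using ex by (simp add: set_plus_intro)
      next
        case False
        then have "x \<in> T \<union> A" using ex by blast
        then show ?thesis using ex by (simp add: G_def set_plus_intro)
      qed
      then show False using that by blast
    qed
    show ?case
    proof (intro exI[of _ "insert a A"] conjI ballI impI)
      have aA: "a \<notin> A" using aY unfolding Y_def by blast
      show "card (insert p Bd) \<le> card (insert a A)" using insert.hyps A aA by simp
      show "insert a A \<inter> (E + T) = {}" using A(5) aY unfolding Y_def by blast
      show "x \<notin> E + {y}" if "x \<in> insert a A" "y \<in> insert a A" "x \<noteq> y" for x y
      proof -
        have "a \<notin> E + {y}" if "y \<in> A"
        proof -
          have "E + {y} \<subseteq> E + A" using that by (intro set_plus_mono2) auto
          then show ?thesis using aY unfolding Y_def by blast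
        qed
        moreover have "x \<notin> E + {a}" if "x \<in> A"
        proof (rule neg, intro ballI notI)
          fix e assume e: "e \<in> E" "a = - e + x"
          have "a \<in> uminus ` E + A" unfolding e(2) by (intro set_plus_intro imageI e(1) that)
          then show False using aY unfolding Y_def by blast
        qed
        ultimately show ?thesis using that A(6) by (metis insertE)
      qed
      show "\<exists>x\<in>insert a A. x + q \<notin> E + (T \<union> insert a A)" if "q \<in> insert p Bd" for q
      proof (cases "q = p")
        case True
        have "a + p \<notin> G"
        proof
          assume "a + p \<in> G"
          then have "a \<in> G + {- p}" by (simp add: mem_translate)
          then show False using aY unfolding Y_def by blast
        qed
        moreover have "a + p \<notin> E + {a}" using aE by (simp add: mem_translate)
        ultimately show ?thesis using True * by blast
      next
        case False
        then have q: "q \<in> Bd" using that by simp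
        then obtain x where x: "x \<in> A" "x + q \<notin> G" using A(7) unfolding G_def by blast
        have "x + q \<notin> E + {a}"
        proof (rule neg, intro ballI notI)
          fix e assume e: "e \<in> E" "a = - e + (x + q)"
          have "a \<in> uminus ` E + (A + Bd)" unfolding e(2) by (intro set_plus_intro imageI e(1) x(1) q)
          then show False using aY unfolding Y_def by blast
        qed
        then show ?thesis using x * by blast
      qed
      show "(a2 - a1 + f) + l \<notin> E + (T \<union> insert a A)" if l: "l \<in> insert a A - {a1, a2}" and f: "f \<in> E" for l f
      proof (rule *)
        show "(a2 - a1 + f) + l \<notin> G"
        proof (cases "l = a")
          case True
          show ?thesis
          proof
            assume "(a2 - a1 + f) + l \<in> G"
            then have "(a2 - a1 + f) + a \<in> G" by (simp only: True)
            from set_plus_intro[OF imageI[OF f, of "\<lambda>f. - (a2 - a1 + f)"] this]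
            have "- (a2 - a1 + f) + ((a2 - a1 + f) + a) \<in> (\<lambda>f. - (a2 - a1 + f)) ` E + G" .
            then have "a \<in> (\<lambda>f. - (a2 - a1 + f)) ` E + G" by (simp only: minus_add_cancel)
            then show False using aY unfolding Y_def by blast
          qed
        next
          case False
          then show ?thesis using A(8)[of l f] l f by (simp add: G_def)
        qed
        show "(a2 - a1 + f) + l \<notin> E + {a}"
        proof (cases "l = a")
          case True
          then show ?thesis using a21[OF f] by (simp add: mem_translate)
        next
          case False
          show ?thesis
          proof (rule neg, intro ballI notI)
            fix e assume e: "e \<in> E" "a = - e + ((a2 - a1 + f) + l)"
            have lA: "l \<in> A" using l False by blast
            have "a \<in> uminus ` E + ((\<lambda>f. a2 - a1 + f) ` E + A)"
              unfolding e(2) by (intro set_plus_intro imageI[OF e(1)] imageI[OF f, of "\<lambda>f. a2 - a1 + f"] lA)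
            then show False using aY unfolding Y_def by blast
          qed
        qed
      qed
    qed (simp_all add: A(1-3))
  qed
  note step = this
  define B0 where "B0 = ({- a1} + (E + (T \<union> {a1, a2}))) - E"
  have B0: "finite B0" using E T by (simp add: B0_def finite_set_plus)
  have "infinite (UNIV - E)" using inf E by (simp add: Diff_infinite_finite)
  then obtain Bm where Bm: "finite Bm" "card Bm = m" "Bm \<subseteq> UNIV - E"
    by (metis infinite_arbitrarily_large)
  have "finite (B0 \<union> Bm)" "(B0 \<union> Bm) \<inter> E = {}" using B0 Bm by (auto simp: B0_def)
  from step[OF this] obtain A where A': "finite A \<and> a1 \<in> A \<and> a2 \<in> A \<and> card (B0 \<union> Bm) \<le> card A \<and> A \<inter> (E + T) = {} \<and>
      (\<forall>a\<in>A. \<forall>a'\<in>A. a \<noteq> a' \<longrightarrow> a \<notin> E + {a'}) \<and>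
      (\<forall>p\<in>B0 \<union> Bm. \<exists>a\<in>A. a + p \<notin> E + (T \<union> A)) \<and>
      (\<forall>l\<in>A - {a1, a2}. \<forall>f\<in>E. (a2 - a1 + f) + l \<notin> E + (T \<union> A))" by (rule exE)
  then have A: "finite A" "a1 \<in> A" "a2 \<in> A" "card (B0 \<union> Bm) \<le> card A" "A \<inter> (E + T) = {}"
      "\<And>a a'. a \<in> A \<Longrightarrow> a' \<in> A \<Longrightarrow> a \<noteq> a' \<Longrightarrow> a \<notin> E + {a'}"
    and A7: "\<And>p. p \<in> B0 \<union> Bm \<Longrightarrow> \<exists>a\<in>A. a + p \<notin> E + (T \<union> A)"
    and A8: "\<And>l f. l \<in> A - {a1, a2} \<Longrightarrow> f \<in> E \<Longrightarrow> (a2 - a1 + f) + l \<notin> E + (T \<union> A)"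
    by simp_all
  show ?thesis
  proof (rule that[OF A(1) _ A(5,6)])
    have "card Bm \<le> card (B0 \<union> Bm)" using B0 Bm by (intro card_mono) auto
    then show "m \<le> card A" using A(4) Bm by simp
    fix p assume p: "A + {p} \<subseteq> E + (T \<union> A)"
    have mem: "a + p \<in> E + (T \<union> A)" if "a \<in> A" for a
    proof -
      have "a + p \<in> A + {p}" using that by (rule set_plus_intro) simp
      then show ?thesis using p by blast
    qed
    show "p \<in> E"
    proof (rule ccontr)
      assume pE: "p \<notin> E"
      obtain f l where fl: "a1 + p = f + l" "f \<in> E" "l \<in> T \<union> A"
        using mem[OF A(2)] by (rule set_plus_elim)
      show False
      proof (cases "l \<in> T \<union> {a1, a2}")
        case True
        have "- a1 + (f + l) \<in> {- a1} + (E + (T \<union> {a1, a2}))"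
          by (intro set_plus_intro fl(2) True) simp
        moreover have "- a1 + (f + l) = p" by (simp flip: fl(1))
        ultimately have "p \<in> B0" using pE by (simp add: B0_def)
        then show False using A7 mem by blast
      next
        case False
        then have "(a2 - a1 + f) + l \<notin> E + (T \<union> A)" using A8 fl by blast
        moreover have "(a2 - a1 + f) + l = a2 - a1 + (a1 + p)" by (simp only: fl(1) add.assoc)
        moreover have "a2 - a1 + (a1 + p) = a2 + p" by (simp flip: add.assoc)
        ultimately show False using mem[OF A(3)] by simp
      qed
    qed
  qed
qed

text \<open>
  By Zorn's lemma.
\<close>

lemma maximal_separated:
  fixes Y Z :: "'g::group_add set"
  assumes "Z \<noteq> {}"
  shows "\<exists>S\<subseteq>Y. (\<forall>s\<in>S. \<forall>s'\<in>S. s \<noteq> s' \<longrightarrow> (Z + {s}) \<inter> (Z + {s'}) = {}) \<and>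
     (\<forall>y\<in>Y. \<exists>s\<in>S. (Z + {y}) \<inter> (Z + {s}) \<noteq> {})"
proof -
  define \<A> where "\<A> = {S. S \<subseteq> Y \<and> (\<forall>s\<in>S. \<forall>s'\<in>S. s \<noteq> s' \<longrightarrow> (Z + {s}) \<inter> (Z + {s'}) = {})}"
  have "\<exists>M\<in>\<A>. \<forall>S\<in>\<A>. M \<subseteq> S \<longrightarrow> S = M"
  proof (rule subset_Zorn')
    fix \<C> assume ch: "subset.chain \<A> \<C>"
    then have sub: "\<C> \<subseteq> \<A>" and tot: "\<And>S S'. S \<in> \<C> \<Longrightarrow> S' \<in> \<C> \<Longrightarrow> S \<subseteq> S' \<or> S' \<subseteq> S"
      by (auto simp: subset_chain_def)
    have "(Z + {s}) \<inter> (Z + {s'}) = {}" if ss: "s \<in> \<Union> \<C>" "s' \<in> \<Union> \<C>" "s \<noteq> s'" for s s'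
    proof -
      obtain S S' where S: "S \<in> \<C>" "s \<in> S" "S' \<in> \<C>" "s' \<in> S'" using ss by blast
      then have "(s \<in> S' \<and> s' \<in> S') \<or> (s \<in> S \<and> s' \<in> S)" using tot[of S S'] by blast
      then show ?thesis using S sub ss(3) unfolding \<A>_def by blast
    qed
    then show "\<Union> \<C> \<in> \<A>" using sub by (auto simp: \<A>_def)
  qed
  then obtain M where M: "M \<in> \<A>" "\<And>S. S \<in> \<A> \<Longrightarrow> M \<subseteq> S \<Longrightarrow> S = M" by blast
  show ?thesis
  proof (intro exI[of _ M] conjI)
    show "\<forall>y\<in>Y. \<exists>s\<in>M. (Z + {y}) \<inter> (Z + {s}) \<noteq> {}"
    proof (rule ballI, rule ccontr)
      fix y assume y: "y \<in> Y" and n: "\<not> (\<exists>s\<in>M. (Z + {y}) \<inter> (Z + {s}) \<noteq> {})"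
      have "insert y M \<in> \<A>" using M(1) y n by (auto simp: \<A>_def Int_commute)
      then have "y \<in> M" using M(2) by blast
      moreover have "Z + {y} \<noteq> {}" using assms by (auto simp: set_plus_def)
      ultimately show False using n by blast
    qed
  qed (use M(1) in \<open>auto simp: \<A>_def\<close>)
qed

section \<open>Fillers and structured blocks\<close>

lemma finite_superset_card:
  fixes S :: "'g set"
  assumes "infinite (UNIV :: 'g set)" "finite S" "card S \<le> n"
  obtains Z where "S \<subseteq> Z" "finite Z" "card Z = n"
proof -
  have "infinite (UNIV - S)" using assms by (simp add: Diff_infinite_finite)
  then obtain B where B: "finite B" "card B = n - card S" "B \<subseteq> UNIV - S"
    by (metis infinite_arbitrarily_large)
  have "card (S \<union> B) = n" using assms B by (subst card_Un_disjoint) auto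
  with that[of "S \<union> B"] assms B show ?thesis by auto
qed

text \<open>
  The set \<open>D\<close> is a symmetric irreducibility distance. Fillers are copies of \<open>u\<close> on translates of \<open>U\<close>;
  they are placed at positions \<open>s\<close> with disjoint \<open>Z + {s}\<close>, so \<open>sizeZ\<close> bounds the proportion of cells
  lost to them by \<open>\<delta>\<close>. The set \<open>E\<close> is the distance kept between data and the places where something
  else may happen. The set \<open>V\<close> is so large that, whenever fillers form a maximal separated set among
  the permitted positions, each translate of \<open>V\<close> contains a filler or comes close to a marker. The
  blocks \<open>v0\<close> and \<open>v1\<close> do not contain \<open>u\<close>.
\<close>

locale filler_system =
  fixes \<Lambda> :: "'a set" and X :: "('g::group_add \<Rightarrow> 'a) set" and D U Z E V :: "'g set"
    and u v0 v1 :: "'g \<Rightarrow> 'a" and \<delta> :: real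
  assumes fin\<Lambda>: "finite \<Lambda>" and subshift: "subshift \<Lambda> X"
    and irr: "irreducibility_distance X D" and symD: "uminus ` D = D"
    and finU: "finite U" and neU: "U \<noteq> {}" and finZ: "finite Z" and DUZ: "D + U \<subseteq> Z"
    and sizeZ: "real (card D * card U) \<le> \<delta> * card Z"
    and E_def: "E = {0} \<union> D \<union> (uminus ` U + D)"
    and V_def: "V = U + (uminus ` Z + (Z + ({0} \<union> (E + Z))))"
    and uX: "u \<in> blocks X U" and vX: "v0 \<in> blocks X V" "v1 \<in> blocks X V" and v01: "v0 \<noteq> v1"
    and u_free: "\<And>s. U + {s} \<subseteq> V \<Longrightarrow> \<exists>t\<in>U. v0 (t + s) \<noteq> u t"
      "\<And>s. U + {s} \<subseteq> V \<Longrightarrow> \<exists>t\<in>U. v1 (t + s) \<noteq> u t"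

text \<open>
  The size of \<open>V\<close> is polynomial in the size \<open>m\<close> of \<open>U\<close>, since \<open>Z\<close> may be taken of size proportional to
  \<open>m\<close>. Two blocks on \<open>V\<close> contain at most \<open>2 * card V\<close> blocks on translates of \<open>U\<close>, fewer than the at
  least \<open>2 powr (h * m)\<close> candidates for \<open>u\<close> as soon as \<open>m\<close> is large.
\<close>

lemma filler_system_exists:
  fixes F :: "nat \<Rightarrow> 'g::group_add set" and h \<delta> :: real
  assumes F: "folner_sequence F" and inf: "infinite (UNIV :: 'g set)"
    and fin: "finite \<Lambda>" and X: "subshift \<Lambda> X"
    and D: "irreducibility_distance X D" "uminus ` D = D"
    and h: "h > 0" "\<forall>\<^sub>F n in sequentially. 2 powr (h * card (F n)) \<le> card (blocks X (F n))"
    and \<delta>: "\<delta> > 0"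
  obtains U Z E V u v0 v1 where "filler_system \<Lambda> X D U Z E V u v0 v1 \<delta>"
proof -
  have D0: "finite D" "0 \<in> D" using D by (auto simp: irreducibility_distance_def)
  define d where "d = card D"
  have d1: "d \<ge> 1" using D0 by (auto simp: d_def Suc_le_eq card_gt_0_iff)
  obtain c1 :: nat where c1: "d \<le> c1" "real d \<le> \<delta> * c1"
  proof -
    obtain c :: nat where c: "real d / \<delta> \<le> c" using real_arch_simple by blast
    have "real d \<le> \<delta> * c" using c \<delta> by (simp add: divide_le_eq mult.commute)
    also have "\<dots> \<le> \<delta> * max c d" using \<delta> by (intro mult_left_mono) auto
    finally show ?thesis using that[of "max c d"] by simp
  qed
  define c2 where "c2 = c1 * c1 * (1 + (1 + 2 * d) * c1)"
  have "\<forall>\<^sub>F m in sequentially. 2 * real c2 * real m ^ 5 < 2 powr (h * real m)"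
    using h(1) by real_asymp
  then obtain m0 where m0: "\<And>m. m \<ge> m0 \<Longrightarrow> 2 * real c2 * real m ^ 5 < 2 powr (h * real m)"
    unfolding eventually_sequentially by blast
  have "\<forall>\<^sub>F n in sequentially. max m0 1 \<le> card (F n) \<and> 2 powr (h * card (F n)) \<le> card (blocks X (F n))"
    using folner_card_unbounded[OF F inf, of "max m0 1"] h(2) by (rule eventually_conj)
  then obtain n where n: "max m0 1 \<le> card (F n)" "2 powr (h * card (F n)) \<le> card (blocks X (F n))"
    using eventually_happens' sequentially_bot by blast
  define U where "U = F n"
  define m where "m = card U"
  have finU: "finite U" and neU: "U \<noteq> {}" using F by (auto simp: U_def folner_sequence_def)
  have m: "m0 \<le> m" "1 \<le> m" using n by (auto simp: m_def U_def)
  have "card (D + U) \<le> d * m" unfolding d_def m_def by (rule card_set_plus_le[OF D0(1) finU])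
  also have "\<dots> \<le> c1 * m" using c1 by simp
  finally obtain Z where Z: "D + U \<subseteq> Z" "finite Z" "card Z = c1 * m"
    using finite_superset_card[OF inf, of "D + U" "c1 * m"] D0 finU by (metis finite_set_plus)
  define E where "E = {0} \<union> D \<union> (uminus ` U + D)"
  define V where "V = U + (uminus ` Z + (Z + ({0} \<union> (E + Z))))"
  have finnU: "finite (uminus ` U)" "finite (uminus ` Z)" using finU Z by auto
  have finE: "finite E" using D0 finnU by (simp add: E_def finite_set_plus)
  have finEZ: "finite (E + Z)" using finE Z by (simp add: finite_set_plus)
  have finV: "finite V" using finU Z finEZ finnU unfolding V_def by (intro finite_set_plus) auto
  have cE: "card E \<le> m * (1 + 2 * d)"
  proof -
    have "card E \<le> card {0 :: 'g} + card D + card (uminus ` U + D)"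
      unfolding E_def using card_Un_le[of "{0} \<union> D" "uminus ` U + D"] card_Un_le[of "{0 :: 'g}" D] by linarith
    also have "\<dots> \<le> 1 + d + m * d"
      using card_set_plus_le[OF finnU(1) D0(1)] by (simp add: card_uminus_image d_def m_def)
    also have "\<dots> \<le> m + m * d + m * d" using m by (intro add_mono) auto
    finally show ?thesis by (simp add: algebra_simps)
  qed
  have cV: "card V \<le> c2 * m ^ 5"
  proof -
    have "card ({0} \<union> (E + Z)) \<le> 1 + card E * card Z"
      using card_Un_le[of "{0 :: 'g}" "E + Z"] card_set_plus_le[OF finE Z(2)] by simp
    also have "\<dots> \<le> m ^ 2 + (m * (1 + 2 * d)) * (c1 * m)"
      using cE m Z(3) by (intro add_mono mult_mono) auto
    also have "\<dots> = m ^ 2 * (1 + (1 + 2 * d) * c1)" by (simp add: algebra_simps power2_eq_square)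
    finally have 1: "card ({0} \<union> (E + Z)) \<le> m ^ 2 * (1 + (1 + 2 * d) * c1)" .
    have "card (Z + ({0} \<union> (E + Z))) \<le> card Z * card ({0} \<union> (E + Z))"
      using Z finEZ by (intro card_set_plus_le) auto
    also have "\<dots> \<le> (c1 * m) * (m ^ 2 * (1 + (1 + 2 * d) * c1))"
      unfolding Z(3) using 1 by (rule mult_left_mono) simp
    finally have 2: "card (Z + ({0} \<union> (E + Z))) \<le> (c1 * m) * (m ^ 2 * (1 + (1 + 2 * d) * c1))" .
    have "card (uminus ` Z + (Z + ({0} \<union> (E + Z)))) \<le> card (uminus ` Z) * card (Z + ({0} \<union> (E + Z)))"
      using finnU Z finEZ by (intro card_set_plus_le finite_set_plus) auto
    also have "\<dots> \<le> (c1 * m) * ((c1 * m) * (m ^ 2 * (1 + (1 + 2 * d) * c1)))"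
      unfolding card_uminus_image Z(3) using 2 by (rule mult_left_mono) simp
    finally have 3: "card (uminus ` Z + (Z + ({0} \<union> (E + Z)))) \<le> (c1 * m) * ((c1 * m) * (m ^ 2 * (1 + (1 + 2 * d) * c1)))" .
    have "card V \<le> card U * card (uminus ` Z + (Z + ({0} \<union> (E + Z))))"
      unfolding V_def using finU finnU Z finEZ by (intro card_set_plus_le finite_set_plus) auto
    also have "\<dots> \<le> m * ((c1 * m) * ((c1 * m) * (m ^ 2 * (1 + (1 + 2 * d) * c1))))"
      unfolding m_def[symmetric] using 3 by (rule mult_left_mono) simp
    also have "\<dots> = c2 * m ^ 5" by (simp add: c2_def algebra_simps power2_eq_square eval_nat_numeral)
    finally show ?thesis .
  qed
  have "real (2 * card V) \<le> 2 * real c2 * real m ^ 5"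
    using cV by (metis (mono_tags, lifting) mult.assoc mult_le_mono2 of_nat_le_iff of_nat_mult of_nat_numeral of_nat_power)
  also have "\<dots> < 2 powr (h * real m)" by (rule m0[OF m(1)])
  also have "\<dots> \<le> card (blocks X U)" using n(2) by (simp add: U_def m_def)
  finally have big: "2 * card V < card (blocks X U)" by simp
  obtain u0 where u0: "u0 \<in> U" using neU by blast
  have UZ: "U \<subseteq> Z"
  proof
    fix t assume "t \<in> U"
    then have "0 + t \<in> D + U" using D0 by (intro set_plus_intro)
    then show "t \<in> Z" using Z(1) by auto
  qed
  have UV: "U + {0} \<subseteq> V"
  proof -
    have "- u0 + (u0 + 0) \<in> uminus ` Z + (Z + ({0} \<union> (E + Z)))"
      using u0 UZ by (intro set_plus_intro) auto
    then show ?thesis unfolding V_def by (intro set_plus_mono2) auto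
  qed
  then have "U \<subseteq> V" by (auto simp: translate_eq_image)
  then have VU: "card U \<le> card V" using finV by (intro card_mono)
  have "2 \<le> card (blocks X U)" using big VU m by (simp add: m_def)
  also have "\<dots> \<le> card (blocks X V)" using \<open>U \<subseteq> V\<close> by (intro card_blocks_mono[OF X fin finV])
  finally have "2 \<le> card (blocks X V)" .
  then obtain v0 v1 where v: "v0 \<in> blocks X V" "v1 \<in> blocks X V" "v0 \<noteq> v1"
    by (metis (no_types, lifting) card_le_Suc0_iff_eq finite_blocks[OF X fin finV] not_less_eq_eq numeral_2_eq_2)
  define S where "S = {s. u0 + s \<in> V}"
  have "S = {- u0} + V" by (auto simp: S_def mem_left_translate)
  then have S: "finite S" "card S = card V" using finV by (simp_all add: finite_set_plus card_left_translate)
  define bad where "bad = (\<lambda>(v, s). restrict (\<lambda>t. v (t + s)) U) ` ({v0, v1} \<times> S)"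
  have "card bad \<le> card ({v0, v1} \<times> S)" unfolding bad_def using S by (intro card_image_le) auto
  also have "\<dots> = 2 * card V" using v S by (simp add: card_cartesian_product)
  finally have "card bad < card (blocks X U)" using big by simp
  then have "\<not> blocks X U \<subseteq> bad"
    using S card_mono[of bad "blocks X U"] by (auto simp: bad_def)
  then obtain u where u: "u \<in> blocks X U" "u \<notin> bad" by blast
  have free: "\<exists>t\<in>U. v (t + s) \<noteq> u t" if v: "v \<in> {v0, v1}" and s: "U + {s} \<subseteq> V" for v s
  proof (rule ccontr)
    assume "\<not> (\<exists>t\<in>U. v (t + s) \<noteq> u t)"
    then have "u = restrict (\<lambda>t. v (t + s)) U"
      using u(1) by (auto simp: blocks_def extensional_def fun_eq_iff)
    moreover have "u0 + s \<in> U + {s}" using u0 by (rule set_plus_intro) simp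
    then have "s \<in> S" using s by (auto simp: S_def)
    ultimately have "u \<in> bad" using v unfolding bad_def by (intro image_eqI[of _ _ "(v, s)"]) auto
    then show False using u(2) by blast
  qed
  have sz: "real (card D * card U) \<le> \<delta> * card Z"
  proof -
    have "real d * m \<le> (\<delta> * c1) * m" using c1(2) by (rule mult_right_mono) simp
    then show ?thesis by (simp add: d_def m_def Z(3) mult.assoc)
  qed
  have "filler_system \<Lambda> X D U Z E V u v0 v1 \<delta>"
    by (rule filler_system.intro)
       (use fin X D finU neU Z sz E_def V_def u v free in auto)
  then show ?thesis by (rule that)
qed

context filler_system
begin

lemma D: "finite D" "0 \<in> D"
  using irr by (auto simp: irreducibility_distance_def)

lemma neX: "X \<noteq> {}"
  using uX by (auto simp: blocks_def)

lemma UZ: "U \<subseteq> Z"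
proof
  fix t assume "t \<in> U"
  then have "0 + t \<in> D + U" using D by (intro set_plus_intro)
  then show "t \<in> Z" using DUZ by auto
qed

lemma neZ: "Z \<noteq> {}"
  using UZ neU by auto

lemma finE: "finite E"
  using D finU by (simp add: E_def finite_set_plus)

lemma finV: "finite V"
  using finU finZ finE by (simp add: V_def finite_set_plus)

text \<open>
  With this separation, blocks on \<open>S\<close> and \<open>S'\<close> can be prescribed independently.
\<close>

definition sep :: "'g set \<Rightarrow> 'g set \<Rightarrow> bool" where
  "sep S S' \<longleftrightarrow> (D + S) \<inter> S' = {}"

lemma sepI: "(\<And>d s. d \<in> D \<Longrightarrow> s \<in> S \<Longrightarrow> d + s \<in> S' \<Longrightarrow> False) \<Longrightarrow> sep S S'"
  unfolding sep_def set_plus_def by blast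

lemma sepD: "sep S S' \<Longrightarrow> d \<in> D \<Longrightarrow> s \<in> S \<Longrightarrow> d + s \<in> S' \<Longrightarrow> False"
  unfolding sep_def set_plus_def by blast

lemma neg_D: "d \<in> D \<Longrightarrow> - d \<in> D"
  using symD by blast

lemma sep_sym: assumes "sep S S'" shows "sep S' S"
proof (rule sepI)
  fix d s assume d: "d \<in> D" and s: "s \<in> S'" and ds: "d + s \<in> S"
  have "- d + (d + s) \<in> S'" unfolding minus_add_cancel by (rule s)
  from sepD[OF assms neg_D[OF d] ds this] show False .
qed

lemma glue:
  assumes "\<And>i. i \<in> I \<Longrightarrow> finite (S i) \<and> y i \<in> X"
    and "\<And>i j. i \<in> I \<Longrightarrow> j \<in> I \<Longrightarrow> i \<noteq> j \<Longrightarrow> sep (S i) (S j)"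
  shows "\<exists>z\<in>X. \<forall>i\<in>I. \<forall>s\<in>S i. z s = y i s"
  by (rule irreducible_glue[OF subshift fin\<Lambda> irr neX]) (use assms in \<open>auto simp: sep_def\<close>)

lemma block_at:
  assumes "b \<in> blocks X T" shows "\<exists>y\<in>X. \<forall>t\<in>T. y (t + g) = b t"
proof -
  obtain x where x: "x \<in> X" "b = restrict x T" using assms by (auto simp: blocks_eq[OF subshift])
  then have "\<forall>t\<in>T. shift (- g) x (t + g) = b t" by (simp add: shift_def add.assoc)
  then show ?thesis using subshift_shift[OF subshift x(1)] by blast
qed

definition fillers :: "'g set \<Rightarrow> 'g set" where
  "fillers P = (SOME S. S \<subseteq> {s. Z + {s} \<subseteq> P} \<and>
     (\<forall>s\<in>S. \<forall>s'\<in>S. s \<noteq> s' \<longrightarrow> (Z + {s}) \<inter> (Z + {s'}) = {}) \<and>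
     (\<forall>y\<in>{s. Z + {s} \<subseteq> P}. \<exists>s\<in>S. (Z + {y}) \<inter> (Z + {s}) \<noteq> {}))"

lemma fillers:
  shows "s \<in> fillers P \<Longrightarrow> Z + {s} \<subseteq> P"
    and "s \<in> fillers P \<Longrightarrow> s' \<in> fillers P \<Longrightarrow> s \<noteq> s' \<Longrightarrow> (Z + {s}) \<inter> (Z + {s'}) = {}"
    and "Z + {y} \<subseteq> P \<Longrightarrow> \<exists>s\<in>fillers P. (Z + {y}) \<inter> (Z + {s}) \<noteq> {}"
  using someI_ex[OF maximal_separated[OF neZ, of "{s. Z + {s} \<subseteq> P}"]]
  unfolding fillers_def[symmetric] by blast+

text \<open>
  The blocks that occur in \<open>X\<close> and show a filler at each position of a fixed maximal separated set
  inside their domain. Only the relative domain matters, so the decoder knows the positions.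
\<close>

definition structured :: "'g set \<Rightarrow> ('g \<Rightarrow> 'a) set" where
  "structured P = {b \<in> blocks X P. \<forall>s\<in>fillers P. \<forall>t\<in>U. b (t + s) = u t}"

lemma sep_fillers:
  assumes "(Z + {s}) \<inter> (Z + {s'}) = {}" shows "sep (U + {s}) (U + {s'})"
proof (rule sepI)
  fix d t assume d: "d \<in> D" "t \<in> U + {s}" "d + t \<in> U + {s'}"
  have "d + (t - s) \<in> D + U" using d by (intro set_plus_intro) (auto simp: mem_translate)
  then have "d + t \<in> Z + {s}" using DUZ by (auto simp: mem_translate add_diff_eq)
  moreover have "d + t \<in> Z + {s'}" using d(3) UZ by (auto simp: mem_translate)
  ultimately show False using assms by blast
qed

lemma finite_fillers: assumes "finite P" shows "finite (fillers P)"
proof -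
  obtain z where z: "z \<in> Z" using neZ by blast
  have "fillers P \<subseteq> {- z} + P"
  proof
    fix s assume "s \<in> fillers P"
    then have "z + s \<in> P" using fillers(1)[of s P] z by (auto intro!: set_plus_intro)
    then show "s \<in> {- z} + P" by (simp add: mem_left_translate)
  qed
  then show ?thesis using assms by (auto intro: finite_subset finite_set_plus)
qed

text \<open>
  Outside the \<open>D\<close>-neighbourhood \<open>W\<close> of the fillers any block can be continued to a structured one; \<open>W\<close>
  takes at most a proportion \<open>\<delta>\<close> of the domain.
\<close>

lemma card_structured:
  assumes P: "finite P"
  shows "real (card (blocks X P)) \<le> card (structured P) * card \<Lambda> powr (\<delta> * card P)"
proof -
  define S where "S = fillers P"
  have finS: "finite S" unfolding S_def by (rule finite_fillers[OF P])
  define W where "W = D + (U + S)"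
  have finW: "finite W" using D finU finS by (simp add: W_def finite_set_plus)
  have "card S * card Z = (\<Sum>s\<in>S. card (Z + {s}))" by simp
  also have "\<dots> = card (\<Union>s\<in>S. Z + {s})"
    using finS finZ fillers(2) by (intro card_UN_disjoint[symmetric]) (auto simp: S_def)
  also have "\<dots> \<le> card P" using P fillers(1) by (intro card_mono) (auto simp: S_def)
  finally have cS: "card S * card Z \<le> card P" .
  have "card W \<le> card D * card (U + S)"
    unfolding W_def using D finU finS by (intro card_set_plus_le finite_set_plus)
  also have "\<dots> \<le> card D * (card U * card S)"
    using finU finS by (intro mult_left_mono card_set_plus_le) auto
  finally have "real (card W) \<le> real (card D * card U) * card S"
    by (metis mult.assoc of_nat_le_iff of_nat_mult)
  also have "\<dots> \<le> \<delta> * card Z * card S" using sizeZ by (rule mult_right_mono) simp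
  also have "\<dots> = \<delta> * real (card S * card Z)" by simp
  also have "\<dots> \<le> \<delta> * card P"
  proof (rule mult_left_mono)
    have "0 < card Z" using finZ neZ by (simp add: card_gt_0_iff)
    then show "0 \<le> \<delta>" using sizeZ by (metis of_nat_0_le_iff of_nat_0_less_iff order_trans zero_le_mult_iff not_less)
  qed (rule of_nat_mono[OF cS])
  finally have cW: "real (card W) \<le> \<delta> * card P" .
  have sub: "blocks X (P - W) \<subseteq> (\<lambda>b. restrict b (P - W)) ` structured P"
  proof
    fix b assume b: "b \<in> blocks X (P - W)"
    obtain y where y: "y \<in> X" "\<forall>t\<in>P - W. y (t + 0) = b t" using block_at[OF b, of 0] by blast
    have "\<forall>s\<in>S. \<exists>y. y \<in> X \<and> (\<forall>t\<in>U. y (t + s) = u t)" using block_at[OF uX] by blast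
    from bchoice[OF this] obtain w where w: "\<forall>s\<in>S. w s \<in> X \<and> (\<forall>t\<in>U. w s (t + s) = u t)" by blast
    define I where "I = insert None (Some ` S)"
    have "\<exists>z\<in>X. \<forall>i\<in>I. \<forall>s\<in>(case i of None \<Rightarrow> P - W | Some s \<Rightarrow> U + {s}). z s = (case i of None \<Rightarrow> y | Some s \<Rightarrow> w s) s"
    proof (rule glue)
      fix i assume "i \<in> I"
      then show "finite (case i of None \<Rightarrow> P - W | Some s \<Rightarrow> U + {s}) \<and> (case i of None \<Rightarrow> y | Some s \<Rightarrow> w s) \<in> X"
        using P finU y w by (auto simp: I_def)
    next
      have PS: "sep (U + {s}) (P - W)" if "s \<in> S" for s
      proof (rule sepI)
        fix d t assume d: "d \<in> D" "t \<in> U + {s}" "d + t \<in> P - W"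
        have "t \<in> U + S" using d(2) set_plus_mono2[of U U "{s}" S] that by auto
        then show False using d by (auto simp: W_def intro!: set_plus_intro)
      qed
      have UU: "sep (U + {s}) (U + {s'})" if "s \<in> S" "s' \<in> S" "s \<noteq> s'" for s s'
        using fillers(2)[THEN sep_fillers] that unfolding S_def by blast
      fix i j assume "i \<in> I" "j \<in> I" "i \<noteq> j"
      then show "sep (case i of None \<Rightarrow> P - W | Some s \<Rightarrow> U + {s}) (case j of None \<Rightarrow> P - W | Some s \<Rightarrow> U + {s})"
        by (cases i; cases j) (auto simp: I_def PS sep_sym[OF PS] UU)
    qed
    then obtain z where z: "z \<in> X" "\<forall>t\<in>P - W. z t = y t" "\<forall>s\<in>S. \<forall>t\<in>U + {s}. z t = w s t"
      by (auto simp: I_def)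
    have "restrict z P \<in> structured P"
      unfolding structured_def
    proof (intro CollectI conjI ballI)
      show "restrict z P \<in> blocks X P" using z(1) by (auto simp: blocks_eq[OF subshift])
      fix s t assume st: "s \<in> fillers P" "t \<in> U"
      have tU: "t + s \<in> U + {s}" using st by (intro set_plus_intro) auto
      then have "t + s \<in> P" using fillers(1)[OF st(1)] UZ by (auto simp: mem_translate)
      then show "restrict z P (t + s) = u t" using z(3) w st tU by (auto simp: S_def)
    qed
    moreover have "b = restrict (restrict z P) (P - W)"
      using z(2) y(2) b by (auto simp: blocks_def extensional_def fun_eq_iff)
    ultimately show "b \<in> (\<lambda>b. restrict b (P - W)) ` structured P" by blast
  qed
  have finst: "finite (structured P)"
    using finite_blocks[OF subshift fin\<Lambda> P] by (auto simp: structured_def)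
  have "card (blocks X (P - W)) \<le> card ((\<lambda>b. restrict b (P - W)) ` structured P)"
    using sub finst by (intro card_mono) auto
  also have "\<dots> \<le> card (structured P)" using finst by (rule card_image_le)
  finally have c1: "card (blocks X (P - W)) \<le> card (structured P)" .
  have "\<Lambda> \<noteq> {}" using neX subshift_subset[OF subshift] by (auto simp: full_shift_def)
  then have card\<Lambda>: "1 \<le> card \<Lambda>" using fin\<Lambda> by (simp add: Suc_le_eq card_gt_0_iff)
  have "card (blocks X P) \<le> card (blocks X (P - W)) * card \<Lambda> ^ card (P - (P - W))"
    by (rule card_blocks_diff[OF subshift fin\<Lambda> P]) auto
  also have "\<dots> \<le> card (structured P) * card \<Lambda> ^ card W"
  proof (rule mult_mono[OF c1])
    show "card \<Lambda> ^ card (P - (P - W)) \<le> card \<Lambda> ^ card W"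
      using card\<Lambda> finW by (intro power_increasing card_mono) auto
  qed simp_all
  finally have "real (card (blocks X P)) \<le> card (structured P) * real (card \<Lambda>) ^ card W"
    by (metis of_nat_le_iff of_nat_mult of_nat_power)
  also have "real (card \<Lambda>) ^ card W = card \<Lambda> powr card W"
    using card\<Lambda> by (simp add: powr_realpow)
  also have "\<dots> \<le> card \<Lambda> powr (\<delta> * card P)" using cW card\<Lambda> by (intro powr_mono) auto
  finally show ?thesis by (simp add: mult_left_mono)
qed

end

section \<open>Markers\<close>

text \<open>
  The pieces of which a code is glued: data of a tile with center \<open>c\<close>, the aperiodic core of the marker
  at \<open>c\<close>, the block \<open>v0\<close> or \<open>v1\<close> of this marker at \<open>a + c\<close>, and a filler outside the data.
\<close>

datatype 'g piece = Data 'g | Core 'g | Spike 'g 'g | Filler 'g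

text \<open>
  The marker at \<open>c\<close> occupies \<open>Q + {c}\<close>. Fillers outside the data keep a distance \<open>E\<^sub>3\<close> from it, so a
  translate of \<open>V\<close> can be free of fillers only at positions in \<open>E\<^sub>4 + Q + {c}\<close>. The set \<open>Er\<close> absorbs all
  these distances; it is determined before \<open>T\<close>, \<open>A0\<close> and \<open>A\<close>. The zone \<open>Q'\<close> is what a marker reserves:
  markers with disjoint zones are separated, and a false marker can be close to one of them only.
\<close>

locale marker_system = filler_system \<Lambda> X D U Z E V u v0 v1 \<delta>
  for \<Lambda> :: "'a set" and X :: "('g::group_add \<Rightarrow> 'a) set" and D U Z E V :: "'g set"
    and u v0 v1 :: "'g \<Rightarrow> 'a" and \<delta> :: real +
  fixes E\<^sub>3 E\<^sub>4 Er T A Q Q' :: "'g set" and A0 :: "'g \<Rightarrow> 'a"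
  assumes E3_def: "E\<^sub>3 = uminus ` U + D" and E4_def: "E\<^sub>4 = uminus ` Z + (uminus ` E + E\<^sub>3)"
    and Er_def: "Er = {0} \<union> E\<^sub>4 \<union> (E\<^sub>4 + V) \<union> (uminus ` V + D) \<union> (uminus ` V + (D + V))"
    and finT: "finite T" and A0: "A0 \<in> blocks X T" and aper: "aperiodic_block (Er - {0}) T A0"
    and finA: "finite A" and neA: "A \<noteq> {}" and AT: "A \<inter> (Er + T) = {}"
    and AA: "\<And>a a'. a \<in> A \<Longrightarrow> a' \<in> A \<Longrightarrow> a \<noteq> a' \<Longrightarrow> a \<notin> Er + {a'}"
    and rigid: "\<And>p. A + {p} \<subseteq> Er + (T \<union> A) \<Longrightarrow> p \<in> Er"
    and Q_def: "Q = T \<union> (V + A)"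
    and Q'_def: "Q' = {0} \<union> Q \<union> (D + Q) \<union> (uminus ` A + (E\<^sub>4 + Q))"
begin

definition marker_at :: "('g \<Rightarrow> 'a) \<Rightarrow> 'g \<Rightarrow> ('g \<Rightarrow> bool) \<Rightarrow> bool" where
  "marker_at x g \<zeta> \<longleftrightarrow> (\<forall>t\<in>T. x (t + g) = A0 t) \<and>
     (\<forall>a\<in>A. \<forall>w\<in>V. x (w + (a + g)) = (if \<zeta> a then v1 w else v0 w))"

lemma finQ: "finite Q" unfolding Q_def by (intro finite_UnI finite_set_plus finT finA finV)

lemma finE4: "finite E\<^sub>4"
  unfolding E4_def E3_def by (intro finite_set_plus finite_imageI finU finZ finE D(1))

lemma finQ': "finite Q'"
  unfolding Q'_def by (intro finite_UnI finite_set_plus finite_imageI finQ finE4 finA D(1)) simp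

text \<open>
  The prescribed data blocks, the markers and fillers on a maximal separated set of the remaining
  permitted positions are pairwise separated, so some \<open>x \<in> X\<close> shows them all. The proof that \<open>x\<close> has
  no other markers has two steps. By maximality, a translate of \<open>V\<close> contains a filler or is close to a
  marker center (\<open>hole\<close>). If a marker occurs at \<open>g\<close>, its translates of \<open>V\<close> contain no filler, so they
  are all close to one and the same center \<open>c\<close>. Rigidity of \<open>A\<close> gives \<open>g - c \<in> Er\<close>, and then the
  occurrences of \<open>A0\<close> at \<open>c\<close> and at \<open>g\<close> contradict aperiodicity unless \<open>g = c\<close>.
\<close>

lemma marker_placement:
  fixes C Bad :: "'g set" and P :: "'g \<Rightarrow> 'g set" and \<beta> :: "'g \<Rightarrow> 'g \<Rightarrow> 'a" and \<zeta> :: "'g \<Rightarrow> 'g \<Rightarrow> bool"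
  assumes C: "disjoint_family_on (\<lambda>c. Q' + {c}) C"
    and Bad: "\<And>c. c \<in> C \<Longrightarrow> Q' + {c} \<subseteq> Bad"
    and finP: "\<And>c. c \<in> C \<Longrightarrow> finite (P c)"
    and part: "\<And>g. (\<forall>e\<in>E. e + g \<notin> Bad) \<longleftrightarrow> (\<exists>c\<in>C. g \<in> P c + {c})"
    and far: "\<And>c c' g f. c \<in> C \<Longrightarrow> c' \<in> C \<Longrightarrow> c \<noteq> c' \<Longrightarrow> f \<in> D \<union> (Z + uminus ` Z) \<Longrightarrow>
       g \<in> P c + {c} \<Longrightarrow> f + g \<notin> P c' + {c'}"
    and \<beta>: "\<And>c. c \<in> C \<Longrightarrow> \<beta> c \<in> structured (P c)"
  shows "\<exists>x\<in>X. (\<forall>c\<in>C. \<forall>p\<in>P c. x (p + c) = \<beta> c p) \<and> (\<forall>c\<in>C. marker_at x c (\<zeta> c)) \<and>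
    (\<forall>g \<zeta>. marker_at x g \<zeta> \<longrightarrow> g \<in> C)"
proof -
  define Y where "Y = {b \<in> Bad. \<forall>c\<in>C. b \<notin> E\<^sub>3 + (Q + {c})}"
  from maximal_separated[OF neZ, of Y] obtain \<Sigma> where "\<Sigma> \<subseteq> Y \<and>
     (\<forall>s\<in>\<Sigma>. \<forall>s'\<in>\<Sigma>. s \<noteq> s' \<longrightarrow> (Z + {s}) \<inter> (Z + {s'}) = {}) \<and>
     (\<forall>y\<in>Y. \<exists>s\<in>\<Sigma>. (Z + {y}) \<inter> (Z + {s}) \<noteq> {})" by (rule exE)
  then have \<Sigma>: "\<Sigma> \<subseteq> Y" "\<And>s s'. s \<in> \<Sigma> \<Longrightarrow> s' \<in> \<Sigma> \<Longrightarrow> s \<noteq> s' \<Longrightarrow> (Z + {s}) \<inter> (Z + {s'}) = {}"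
     "\<And>y. y \<in> Y \<Longrightarrow> \<exists>s\<in>\<Sigma>. (Z + {y}) \<inter> (Z + {s}) \<noteq> {}"
    by simp_all
  define I where "I = Data ` C \<union> Core ` C \<union> {Spike a c |a c. a \<in> A \<and> c \<in> C} \<union> Filler ` \<Sigma>"
  define S where "S i = (case i of Data c \<Rightarrow> P c + {c} | Core c \<Rightarrow> T + {c} | Spike a c \<Rightarrow> V + {a + c} | Filler s \<Rightarrow> U + {s})" for i
  define val where "val i y \<longleftrightarrow> y \<in> X \<and> (case i of Data c \<Rightarrow> (\<forall>p\<in>P c. y (p + c) = \<beta> c p)
     | Core c \<Rightarrow> (\<forall>t\<in>T. y (t + c) = A0 t) | Spike a c \<Rightarrow> (\<forall>w\<in>V. y (w + (a + c)) = (if \<zeta> c a then v1 w else v0 w))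
     | Filler s \<Rightarrow> (\<forall>t\<in>U. y (t + s) = u t))" for i and y :: "'g \<Rightarrow> 'a"
  have "\<forall>i\<in>I. \<exists>y. val i y"
  proof
    fix i assume i: "i \<in> I"
    show "\<exists>y. val i y"
    proof (cases i)
      case (Data c)
      then have "\<beta> c \<in> blocks X (P c)" using i \<beta> by (auto simp: I_def structured_def)
      from block_at[OF this, of c] show ?thesis by (auto simp: val_def Data)
    next
      case (Core c)
      show ?thesis using block_at[OF A0, of c] by (auto simp: val_def Core)
    next
      case (Spike a c)
      have "(if \<zeta> c a then v1 else v0) \<in> blocks X V" using vX by simp
      from block_at[OF this, of "a + c"] show ?thesis by (auto simp: val_def Spike)
    next
      case (Filler s)
      show ?thesis using block_at[OF uX, of s] by (auto simp: val_def Filler)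
    qed
  qed
  from bchoice[OF this] obtain y where y: "\<forall>i\<in>I. val i (y i)" by blast
  have QQ': "Q \<subseteq> Q'" "D + Q \<subseteq> Q'" by (auto simp: Q'_def)
  have QC: "M \<subseteq> Q + {c} \<Longrightarrow> M \<subseteq> Q' + {c}" for M c
    using set_plus_mono2[OF QQ'(1) order_refl, of "{c}"] by (rule order_trans[rotated])
  have TQ: "T + {c} \<subseteq> Q + {c}" for c by (intro set_plus_mono2) (auto simp: Q_def)
  have VQ: "V + {a + c} \<subseteq> Q + {c}" if "a \<in> A" for a c
  proof
    fix g assume "g \<in> V + {a + c}"
    then obtain v where v: "v \<in> V" "g = v + (a + c)" by (auto simp: set_plus_def)
    have "v + a \<in> Q" using v(1) that by (auto simp: Q_def intro!: set_plus_intro)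
    then have "(v + a) + c \<in> Q + {c}" by (rule set_plus_intro) simp
    then show "g \<in> Q + {c}" by (simp add: v(2) add.assoc)
  qed
  have DE: "D \<subseteq> E" by (auto simp: E_def)
  have s1: "sep (P c + {c}) (P c' + {c'})" if "c \<in> C" "c' \<in> C" "c \<noteq> c'" for c c'
    by (rule sepI) (use far[OF that] in blast)
  have s2: "sep (P c + {c}) M" if c: "c \<in> C" and c': "c' \<in> C" and M: "M \<subseteq> Q + {c'}" for c c' M
  proof (rule sepI)
    fix d g assume d: "d \<in> D" "g \<in> P c + {c}" "d + g \<in> M"
    have "d + g \<notin> Bad" using part[of g] c d DE by blast
    then show False using d(3) QC[OF M] Bad[OF c'] by blast
  qed
  have s3: "sep (P c + {c}) (U + {s})" if c: "c \<in> C" and s: "s \<in> \<Sigma>" for c s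
  proof (rule sepI)
    fix d g assume d: "d \<in> D" "g \<in> P c + {c}" "d + g \<in> U + {s}"
    then obtain t where t: "t \<in> U" "d + g = t + s" by (auto simp: set_plus_def)
    have "- t + d \<in> E" using t d by (auto simp: E_def intro!: set_plus_intro)
    then have "(- t + d) + g \<notin> Bad" using part[of g] c d by blast
    moreover have "(- t + d) + g = s" by (simp add: add.assoc t(2))
    ultimately show False using s \<Sigma>(1) by (auto simp: Y_def)
  qed
  have s4: "sep M M'" if "c \<in> C" "c' \<in> C" "c \<noteq> c'" "M \<subseteq> Q + {c}" "M' \<subseteq> Q + {c'}" for c c' M M'
  proof (rule sepI)
    fix d g assume d: "d \<in> D" "g \<in> M" "d + g \<in> M'"
    have "g \<in> Q + {c}" using d(2) that(4) by blast
    then have "d + (g - c) \<in> D + Q" using d(1) by (intro set_plus_intro) (simp_all add: mem_translate)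
    then have "d + g \<in> Q' + {c}" using QQ' by (auto simp: mem_translate add_diff_eq)
    moreover have "d + g \<in> Q' + {c'}" using d(3) QC[OF that(5)] by blast
    ultimately show False using disjoint_family_onD[OF C that(1,2,3)] by blast
  qed
  have s5: "sep (T + {c}) (V + {a + c})" if a: "a \<in> A" for a c
  proof (rule sepI)
    fix d g assume d: "d \<in> D" "g \<in> T + {c}" "d + g \<in> V + {a + c}"
    then obtain v where v: "v \<in> V" "d + g = v + (a + c)" by (auto simp: set_plus_def)
    obtain t where t: "t \<in> T" "g = t + c" using d(2) by (auto simp: set_plus_def)
    have "(d + t) + c = (v + a) + c" using v(2) by (simp only: t(2) add.assoc)
    then have "d + t = v + a" by simp
    then have "a = (- v + d) + t" by (simp add: add.assoc)
    moreover have "- v + d \<in> Er" using v(1) d(1) by (auto simp: Er_def intro!: set_plus_intro)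
    ultimately have "a \<in> Er + T" using t(1) by (auto intro!: set_plus_intro)
    then show False using AT a by blast
  qed
  have s6: "sep (V + {a + c}) (V + {a' + c})" if a: "a \<in> A" "a' \<in> A" "a \<noteq> a'" for a a' c
  proof (rule sepI)
    fix d g assume d: "d \<in> D" "g \<in> V + {a + c}" "d + g \<in> V + {a' + c}"
    then obtain v where v: "v \<in> V" "d + g = v + (a' + c)" by (auto simp: set_plus_def)
    obtain t where t: "t \<in> V" "g = t + (a + c)" using d(2) by (auto simp: set_plus_def)
    have "(d + (t + a)) + c = (v + a') + c" using v(2) by (simp only: t(2) add.assoc)
    then have "d + (t + a) = v + a'" by simp
    then have "- v + (d + (t + a)) = a'" by (simp only: minus_add_cancel)
    then have "a' = (- v + (d + t)) + a" by (simp only: add.assoc)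
    moreover have "- v + (d + t) \<in> Er" using v(1) d(1) t(1) by (auto simp: Er_def intro!: set_plus_intro)
    ultimately have "a' \<in> Er + {a}" by (auto intro!: set_plus_intro)
    then show False using AA[of a' a] a by auto
  qed
  have s7: "sep (U + {s}) M" if s: "s \<in> \<Sigma>" and c: "c \<in> C" and M: "M \<subseteq> Q + {c}" for s c M
  proof (rule sepI)
    fix d g assume d: "d \<in> D" "g \<in> U + {s}" "d + g \<in> M"
    obtain t where t: "t \<in> U" "g = t + s" using d(2) by (auto simp: set_plus_def)
    have "d + g \<in> Q + {c}" using d(3) M by blast
    from set_plus_intro[OF set_plus_intro[OF imageI[OF t(1)] neg_D[OF d(1)]] this]
    have "(- t + - d) + (d + g) \<in> (uminus ` U + D) + (Q + {c})" .
    moreover have "(- t + - d) + (d + g) = s" by (simp only: t(2) add.assoc minus_add_cancel)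
    ultimately show False using s \<Sigma>(1) c by (auto simp: Y_def E3_def)
  qed
  have s8: "sep (U + {s}) (U + {s'})" if "s \<in> \<Sigma>" "s' \<in> \<Sigma>" "s \<noteq> s'" for s s'
    by (rule sep_fillers[OF \<Sigma>(2)[OF that]])
  have "\<exists>x\<in>X. \<forall>i\<in>I. \<forall>s\<in>S i. x s = y i s"
  proof (rule glue)
    fix i assume "i \<in> I"
    then show "finite (S i) \<and> y i \<in> X"
      using y finP finT finV finU by (auto simp: I_def S_def val_def)
  next
    fix i j assume ij: "i \<in> I" "j \<in> I" "i \<noteq> j"
    define M where "M i c \<longleftrightarrow> c \<in> C \<and> (i = Core c \<or> (\<exists>a\<in>A. i = Spike a c))" for i c
    have SM: "S (Core c) = T + {c}" "S (Spike a c) = V + {a + c}" for a c by (simp_all add: S_def)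
    have MQ: "S i \<subseteq> Q + {c}" "c \<in> C" if "M i c" for i c
    proof -
      show "c \<in> C" using that by (simp add: M_def)
      from that consider "i = Core c" | a where "i = Spike a c" "a \<in> A" by (auto simp: M_def)
      then show "S i \<subseteq> Q + {c}" by cases (use TQ VQ in \<open>simp_all add: SM\<close>)
    qed
    have same: "sep (S i) (S j)" if M: "M i c" "M j c" and ne: "i \<noteq> j" for i j c
    proof -
      from M(1) consider "i = Core c" | a where "i = Spike a c" "a \<in> A" by (auto simp: M_def)
      then show ?thesis
      proof cases
        case 1
        then obtain a where "j = Spike a c" "a \<in> A" using M(2) ne by (auto simp: M_def)
        then show ?thesis using 1 s5 by (simp add: SM)
      next
        case (2 a)
        from M(2) consider "j = Core c" | b where "j = Spike b c" "b \<in> A" by (auto simp: M_def)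
        then show ?thesis
        proof cases
          case 1
          then show ?thesis using 2 sep_sym[OF s5] by (simp add: SM)
        next
          case (2 b)
          then show ?thesis using \<open>i = Spike a c\<close> \<open>a \<in> A\<close> ne s6[of a b c] by (simp add: SM)
        qed
      qed
    qed
    have cl: "(\<exists>c\<in>C. i = Data c) \<or> (\<exists>s\<in>\<Sigma>. i = Filler s) \<or> (\<exists>c. M i c)" if "i \<in> I" for i
      using that by (cases i) (simp_all add: M_def I_def image_iff)
    have SD: "S (Data c) = P c + {c}" "S (Filler s) = U + {s}" for c s by (simp_all add: S_def)
    consider c c' where "i = Data c" "j = Data c'" "c \<in> C" "c' \<in> C"
      | c s where "i = Data c" "j = Filler s" "c \<in> C" "s \<in> \<Sigma>"
      | c s where "j = Data c" "i = Filler s" "c \<in> C" "s \<in> \<Sigma>"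
      | c c' where "i = Data c" "M j c'" "c \<in> C"
      | c c' where "j = Data c" "M i c'" "c \<in> C"
      | s s' where "i = Filler s" "j = Filler s'" "s \<in> \<Sigma>" "s' \<in> \<Sigma>"
      | s c where "i = Filler s" "M j c" "s \<in> \<Sigma>"
      | s c where "j = Filler s" "M i c" "s \<in> \<Sigma>"
      | c c' where "M i c" "M j c'"
      using cl[OF ij(1)] cl[OF ij(2)] by metis
    then show "sep (S i) (S j)"
    proof cases
      case 1 then show ?thesis using s1 ij(3) by (auto simp: SD)
    next
      case 2 then show ?thesis using s3 by (simp add: SD)
    next
      case 3 then show ?thesis using sep_sym[OF s3] by (simp add: SD)
    next
      case 4 then show ?thesis using s2[OF _ MQ(2) MQ(1)] by (simp add: SD)
    next
      case 5 then show ?thesis using sep_sym[OF s2[OF _ MQ(2) MQ(1)]] by (simp add: SD)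
    next
      case 6 then show ?thesis using s8 ij(3) by (auto simp: SD)
    next
      case 7 then show ?thesis using s7[OF _ MQ(2) MQ(1)] by (simp add: SD)
    next
      case 8 then show ?thesis using sep_sym[OF s7[OF _ MQ(2) MQ(1)]] by (simp add: SD)
    next
      case 9
      show ?thesis
      proof (cases "c = c'")
        case True
        then show ?thesis using same 9 ij(3) by blast
      next
        case False
        then show ?thesis using s4[OF MQ(2)[OF 9(1)] MQ(2)[OF 9(2)] False MQ(1)[OF 9(1)] MQ(1)[OF 9(2)]] by blast
      qed
    qed
  qed
  then obtain x where x: "x \<in> X" and xy: "\<And>i s. i \<in> I \<Longrightarrow> s \<in> S i \<Longrightarrow> x s = y i s" by blast
  have add_mem: "p + g \<in> M + {g}" if "p \<in> M" for p g :: 'g and M using that by (rule set_plus_intro) simp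
  have xD: "x (p + c) = \<beta> c p" if c: "c \<in> C" and p: "p \<in> P c" for c p
  proof -
    have i: "Data c \<in> I" using c by (simp add: I_def)
    have "x (p + c) = y (Data c) (p + c)" by (rule xy[OF i]) (simp add: S_def add_mem[OF p])
    then show ?thesis using y i p by (auto simp: val_def)
  qed
  have xF: "x (t + s) = u t" if s: "s \<in> \<Sigma>" and t: "t \<in> U" for t s
  proof -
    have i: "Filler s \<in> I" using s by (simp add: I_def)
    have "x (t + s) = y (Filler s) (t + s)" by (rule xy[OF i]) (simp add: S_def add_mem[OF t])
    then show ?thesis using y i t by (auto simp: val_def)
  qed
  have xM: "marker_at x c (\<zeta> c)" if c: "c \<in> C" for c
    unfolding marker_at_def
  proof (intro conjI ballI)
    fix t assume t: "t \<in> T"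
    have i: "Core c \<in> I" using c by (simp add: I_def)
    have "x (t + c) = y (Core c) (t + c)" by (rule xy[OF i]) (simp add: S_def add_mem[OF t])
    then show "x (t + c) = A0 t" using y i t by (auto simp: val_def)
  next
    fix a w assume aw: "a \<in> A" "w \<in> V"
    have i: "Spike a c \<in> I" using c aw by (simp add: I_def)
    have "x (w + (a + c)) = y (Spike a c) (w + (a + c))" by (rule xy[OF i]) (simp add: S_def add_mem[OF aw(2)])
    then show "x (w + (a + c)) = (if \<zeta> c a then v1 w else v0 w)" using y i aw by (auto simp: val_def)
  qed
  \<comment> \<open>If some data region contains \<open>Z + {g}\<close>, a filler inside the data is near \<open>g\<close>. Otherwise \<open>g\<close> is
    near a bad position \<open>b\<close>, and so near a filler outside the data unless \<open>b\<close> is close to a marker.\<close>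
  have hole: "(\<exists>s. U + {s} \<subseteq> V + {g} \<and> (\<forall>t\<in>U. x (t + s) = u t)) \<or> (\<exists>c\<in>C. g \<in> (E\<^sub>4 + Q) + {c})" for g
  proof (cases "\<exists>z\<in>Z. \<exists>e\<in>E. e + (z + g) \<in> Bad")
    case True
    then obtain z e where ze: "z \<in> Z" "e \<in> E" "e + (z + g) \<in> Bad" by blast
    define b where "b = e + (z + g)"
    show ?thesis
    proof (cases "\<exists>c\<in>C. b \<in> E\<^sub>3 + (Q + {c})")
      case True
      then obtain c where c: "c \<in> C" "b \<in> E\<^sub>3 + (Q + {c})" by blast
      have "- z + (- e + b) \<in> uminus ` Z + (uminus ` E + (E\<^sub>3 + (Q + {c})))"
        using ze c by (intro set_plus_intro) auto
      moreover have "- z + (- e + b) = g" by (simp only: b_def minus_add_cancel)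
      ultimately have "g \<in> (E\<^sub>4 + Q) + {c}" by (simp only: E4_def add.assoc)
      then show ?thesis using c by blast
    next
      case False
      then have "b \<in> Y" using ze by (auto simp: Y_def b_def)
      then obtain s where s: "s \<in> \<Sigma>" "(Z + {b}) \<inter> (Z + {s}) \<noteq> {}" using \<Sigma>(3) by blast
      then obtain z1 z2 where z12: "z1 \<in> Z" "z2 \<in> Z" "z2 + b = z1 + s" by (auto simp: set_plus_def)
      have "U + {s} \<subseteq> V + {g}"
      proof
        fix h assume "h \<in> U + {s}"
        then obtain t where t: "t \<in> U" "h = t + s" by (auto simp: set_plus_def)
        have "t + (- z1 + (z2 + (e + z))) \<in> V"
          unfolding V_def using t(1) z12 ze by (intro set_plus_intro) (auto intro: set_plus_intro)
        then have "(t + (- z1 + (z2 + (e + z)))) + g \<in> V + {g}" by (rule add_mem)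
        moreover have "(t + (- z1 + (z2 + (e + z)))) + g = t + (- z1 + (z2 + b))"
          by (simp only: b_def add.assoc)
        moreover have "- z1 + (z2 + b) = s" by (simp only: z12(3) minus_add_cancel)
        ultimately show "h \<in> V + {g}" by (simp add: t(2))
      qed
      then show ?thesis using xF[OF s(1)] by blast
    qed
  next
    case False
    have Zc: "\<exists>c\<in>C. z + g \<in> P c + {c}" if "z \<in> Z" for z using part[of "z + g"] False that by blast
    obtain z0 where z0: "z0 \<in> Z" using neZ by blast
    obtain c where c: "c \<in> C" "z0 + g \<in> P c + {c}" using Zc[OF z0] by blast
    have all: "z + g \<in> P c + {c}" if z: "z \<in> Z" for z
    proof -
      obtain c' where c': "c' \<in> C" "z + g \<in> P c' + {c'}" using Zc[OF z] by blast
      have "c' = c"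
      proof (rule ccontr)
        assume ne: "c' \<noteq> c"
        have f: "z0 + - z \<in> D \<union> (Z + uminus ` Z)" using z z0 by (auto intro!: set_plus_intro simp del: add_uminus_conv_diff)
        have "(z0 + - z) + (z + g) = z0 + g" by (simp only: add.assoc minus_add_cancel)
        then show False using far[OF c'(1) c(1) ne f c'(2)] c(2) by simp
      qed
      then show ?thesis using c' by simp
    qed
    have "Z + {g - c} \<subseteq> P c"
    proof
      fix h assume "h \<in> Z + {g - c}"
      then obtain z where z: "z \<in> Z" "h = z + (g - c)" by (auto simp: set_plus_def)
      have "z + g \<in> P c + {c}" by (rule all[OF z(1)])
      then show "h \<in> P c" by (simp add: mem_translate z(2) add_diff_eq)
    qed
    from fillers(3)[OF this] obtain s where s: "s \<in> fillers (P c)" "(Z + {g - c}) \<inter> (Z + {s}) \<noteq> {}" by blast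
    then obtain z1 z2 where z12: "z1 \<in> Z" "z2 \<in> Z" "z2 + (g - c) = z1 + s" by (auto simp: set_plus_def)
    have s': "- z1 + (z2 + (g - c)) = s" by (simp only: z12(3) minus_add_cancel)
    have "U + {s + c} \<subseteq> V + {g}"
    proof
      fix h assume "h \<in> U + {s + c}"
      then obtain t where t: "t \<in> U" "h = t + (s + c)" by (auto simp: set_plus_def)
      have "t + (- z1 + (z2 + 0)) \<in> V"
        unfolding V_def using t(1) z12 by (intro set_plus_intro) auto
      then have "(t + (- z1 + (z2 + 0))) + g \<in> V + {g}" by (rule add_mem)
      moreover have "(t + (- z1 + (z2 + 0))) + g = t + ((- z1 + (z2 + (g - c))) + c)"
        by (simp add: add.assoc)
      ultimately show "h \<in> V + {g}" unfolding s' t(2) by simp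
    qed
    moreover have "x (t + (s + c)) = u t" if t: "t \<in> U" for t
    proof -
      have "t + s \<in> Z + {s}" using t UZ by (intro add_mem) blast
      then have "t + s \<in> P c" using fillers(1)[OF s(1)] by blast
      then have "x ((t + s) + c) = \<beta> c (t + s)" by (rule xD[OF c(1)])
      then show ?thesis using \<beta>[OF c(1)] s(1) t by (simp add: structured_def add.assoc)
    qed
    ultimately show ?thesis by blast
  qed
  have detect: "g \<in> C" if m: "marker_at x g \<xi>" for g \<xi>
  proof -
    have mT: "x (t + g) = A0 t" if "t \<in> T" for t using m that by (auto simp: marker_at_def)
    have mV: "x (w + (a + g)) = (if \<xi> a then v1 w else v0 w)" if "a \<in> A" "w \<in> V" for a w
      using m that by (auto simp: marker_at_def)
    have "\<exists>c\<in>C. a + g \<in> (E\<^sub>4 + Q) + {c}" if a: "a \<in> A" for a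
    proof (rule ccontr)
      assume "\<not> (\<exists>c\<in>C. a + g \<in> (E\<^sub>4 + Q) + {c})"
      then obtain s where s: "U + {s} \<subseteq> V + {a + g}" "\<forall>t\<in>U. x (t + s) = u t" using hole[of "a + g"] by blast
      define s' where "s' = s - (a + g)"
      have ss: "s = s' + (a + g)" by (simp add: s'_def)
      have sub: "U + {s'} \<subseteq> V"
      proof
        fix h assume "h \<in> U + {s'}"
        then obtain t where t: "t \<in> U" "h = t + s'" by (auto simp: set_plus_def)
        have "t + s \<in> V + {a + g}" using s(1) add_mem[OF t(1)] by blast
        then have "t + s - (a + g) \<in> V" by (simp only: mem_translate)
        then show "h \<in> V" by (simp only: t(2) s'_def add_diff_eq)
      qed
      have "(if \<xi> a then v1 (t + s') else v0 (t + s')) = u t" if t: "t \<in> U" for t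
      proof -
        have "t + s' \<in> V" using sub add_mem[OF t] by blast
        from mV[OF a this] have "x ((t + s') + (a + g)) = (if \<xi> a then v1 (t + s') else v0 (t + s'))" .
        moreover have "(t + s') + (a + g) = t + s" by (simp only: ss add.assoc)
        ultimately show ?thesis using s(2) t by simp
      qed
      then show False using u_free(1)[OF sub] u_free(2)[OF sub] by (cases "\<xi> a") auto
    qed
    then have "\<forall>a\<in>A. \<exists>c. c \<in> C \<and> a + g \<in> (E\<^sub>4 + Q) + {c}" by blast
    from bchoice[OF this] obtain k where k: "\<forall>a\<in>A. k a \<in> C \<and> a + g \<in> (E\<^sub>4 + Q) + {k a}" by blast
    have gk: "g \<in> Q' + {k a}" if a: "a \<in> A" for a
    proof -
      have "a + g - k a \<in> E\<^sub>4 + Q" using k a by (auto simp: mem_translate)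
      then have "- a + (a + g - k a) \<in> uminus ` A + (E\<^sub>4 + Q)" using a by (intro set_plus_intro) auto
      moreover have "- a + (a + g - k a) = g - k a" by (simp add: add_diff_eq)
      ultimately have "g - k a \<in> uminus ` A + (E\<^sub>4 + Q)" by simp
      then have "g - k a \<in> Q'" unfolding Q'_def by blast
      then show ?thesis by (simp add: mem_translate)
    qed
    obtain a0 where a0: "a0 \<in> A" using neA by blast
    define c where "c = k a0"
    have cC: "c \<in> C" using k a0 by (auto simp: c_def)
    have kc: "k a = c" if "a \<in> A" for a
      using disjoint_family_onD[OF C, of "k a" c] gk[OF that] gk[OF a0] k that cC by (auto simp: c_def)
    define p where "p = g - c"
    have g: "g = p + c" by (simp add: p_def)
    have "A + {p} \<subseteq> Er + (T \<union> A)"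
    proof
      fix h assume "h \<in> A + {p}"
      then obtain a where a: "a \<in> A" "h = a + p" by (auto simp: set_plus_def)
      have "a + g \<in> (E\<^sub>4 + Q) + {c}" using k a kc by auto
      then have "a + p \<in> E\<^sub>4 + Q" by (simp add: g mem_translate flip: add.assoc)
      then obtain e q where eq: "a + p = e + q" "e \<in> E\<^sub>4" "q \<in> Q" by (rule set_plus_elim)
      show "h \<in> Er + (T \<union> A)"
      proof (cases "q \<in> T")
        case True
        then show ?thesis unfolding a(2) eq(1) using eq(2) by (intro set_plus_intro) (auto simp: Er_def)
      next
        case False
        then obtain v b where vb: "q = v + b" "v \<in> V" "b \<in> A" using eq(3) by (auto simp: Q_def elim: set_plus_elim)
        have "e + v \<in> Er" using eq(2) vb(2) by (auto simp: Er_def intro: set_plus_intro)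
        then have "(e + v) + b \<in> Er + (T \<union> A)" using vb(3) by (intro set_plus_intro) auto
        then show ?thesis unfolding a(2) eq(1) vb(1) by (simp only: add.assoc)
      qed
    qed
    then have pE: "p \<in> Er" by (rule rigid)
    have "p = 0"
    proof (rule ccontr)
      assume "p \<noteq> 0"
      then obtain t where t: "t \<in> T" "t + p \<in> T" "A0 (t + p) \<noteq> A0 t"
        using aper pE by (auto simp: aperiodic_block_def)
      have "x ((t + p) + c) = A0 (t + p)" using xM[OF cC] t(2) by (auto simp: marker_at_def)
      moreover have "x (t + g) = A0 t" by (rule mT[OF t(1)])
      ultimately show False using t(3) by (simp add: g add.assoc)
    qed
    then show ?thesis using cC by (simp add: g)
  qed
  show ?thesis using x xD xM detect by blast
qed

end

section \<open>The code carried by a marked quasi-tiling\<close>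

text \<open>
  A quasi-tiling whose marker zones have room for markers. The level \<open>j\<close> of a tile is written into its
  marker as the subset \<open>J j\<close> of \<open>A\<close>. For each domain \<open>P\<close> which is a large part of a tile shape, \<open>sl P\<close>
  is its set of slots, and \<open>enc P\<close> turns the symbols to be stored, one for each cell of \<open>P\<close> and one
  for each slot, into a structured block.
\<close>

locale marked_tiling = marker_system \<Lambda> X D U Z E V u v0 v1 \<delta> E\<^sub>3 E\<^sub>4 Er T A Q Q' A0
  for \<Lambda> :: "'a set" and X :: "('g::group_add \<Rightarrow> 'a) set" and D U Z E V :: "'g set"
    and u v0 v1 :: "'g \<Rightarrow> 'a" and \<delta> :: real
    and E\<^sub>3 E\<^sub>4 Er T A Q Q' :: "'g set" and A0 :: "'g \<Rightarrow> 'a" +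
  fixes k :: nat and TT :: "nat \<Rightarrow> 'g set" and C :: "nat \<Rightarrow> 'g set" and R :: "nat \<times> 'g \<Rightarrow> 'g set"
    and \<epsilon> \<epsilon>\<^sub>1 :: real and N :: nat and sl :: "'g set \<Rightarrow> 'g set"
    and enc :: "'g set \<Rightarrow> ('g \<Rightarrow> nat) \<times> ('g \<Rightarrow> nat) \<Rightarrow> ('g \<Rightarrow> 'a)" and J :: "nat \<Rightarrow> 'g set"
  assumes qt: "quasi_tiling k TT C R \<epsilon> Q'"
    and TT: "\<And>j. j < k \<Longrightarrow> finite (TT j)" "\<And>j. j < k \<Longrightarrow> Q' \<subseteq> TT j"
    and J: "inj_on J {..<k}" "\<And>j. j < k \<Longrightarrow> J j \<subseteq> A"
    and sl: "\<And>P. sl P \<subseteq> P"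
    and enc: "\<And>j P. j < k \<Longrightarrow> P \<subseteq> TT j \<Longrightarrow> (1 - \<epsilon>\<^sub>1) * real (card (TT j)) \<le> real (card P) \<Longrightarrow>
       inj_on (enc P) ((P \<rightarrow>\<^sub>E {..<N}) \<times> (sl P \<rightarrow>\<^sub>E {..<N})) \<and>
       enc P ` ((P \<rightarrow>\<^sub>E {..<N}) \<times> (sl P \<rightarrow>\<^sub>E {..<N})) \<subseteq> structured P"
begin

lemma C_unique: assumes "i < k" "j < k" "c \<in> C i" "c \<in> C j" shows "i = j"
proof (rule ccontr)
  assume "i \<noteq> j"
  have "disjoint_family_on (\<lambda>(j, c). Q' + {c}) (Sigma {..<k} C)" using qt by (simp add: quasi_tiling_def)
  from disjoint_family_onD[OF this, of "(i, c)" "(j, c)"] \<open>i \<noteq> j\<close> assms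
  have "(Q' + {c}) \<inter> (Q' + {c}) = {}" by simp
  moreover have "c \<in> Q' + {c}" by (simp add: mem_translate Q'_def)
  ultimately show False by blast
qed

text \<open>
  The level of the tile with center \<open>g\<close>. All other data of the quasi-tiling are computed from these
  labels inside bounded windows, which is what makes them visible to the decoder.
\<close>

definition lab :: "'g \<Rightarrow> nat option" where
  "lab g = (if \<exists>j<k. g \<in> C j then Some (THE j. j < k \<and> g \<in> C j) else None)"

lemma lab_Some: "lab g = Some j \<longleftrightarrow> j < k \<and> g \<in> C j"
proof -
  have "(THE j. j < k \<and> g \<in> C j) = i" if "i < k" "g \<in> C i" for i
    using that C_unique by (intro the_equality) auto
  then show ?thesis by (auto simp: lab_def)
qed

text \<open>
  The tiles that contain \<open>g\<close>, each given by its level and by the position of \<open>g\<close> relative to the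
  center.
\<close>

definition cov :: "'g \<Rightarrow> (nat \<times> 'g) set" where
  "cov g = {(j, f). f \<in> TT j \<and> lab (- f + g) = Some j}"

definition K0 :: "'g set" where "K0 = D \<union> (Z + uminus ` Z)"

text \<open>
  A position is bad if it is not in exactly one tile, or in a marker zone, or close to the boundary
  of its tile.
\<close>

definition bad :: "'g \<Rightarrow> bool" where
  "bad g \<longleftrightarrow> \<not> (\<exists>!i. i \<in> cov g) \<or> (\<exists>q\<in>Q'. lab (- q + g) \<noteq> None) \<or>
     (\<exists>j f. (j, f) \<in> cov g \<and> (\<exists>e\<in>K0. e + f \<notin> TT j))"

text \<open>
  The cells, relative to the center \<open>c\<close>, that the tile at \<open>c\<close> owns: those at distance \<open>E\<close> from all
  bad positions. Thus the cells without owner form a union of translates of \<open>uminus ` E\<close>, thick enough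
  to hold fillers.
\<close>

definition P :: "'g \<Rightarrow> 'g set" where
  "P c = (case lab c of None \<Rightarrow> {} | Some j \<Rightarrow> {p \<in> TT j. \<forall>e\<in>E. \<not> bad (e + (p + c))})"

definition good :: "'g \<Rightarrow> bool" where
  "good c \<longleftrightarrow> (\<exists>j. lab c = Some j \<and> (1 - \<epsilon>\<^sub>1) * real (card (TT j)) \<le> real (card (P c)))"

text \<open>
  The cell \<open>g\<close> belongs to the tile with center \<open>- p + g\<close>, and this tile has kept enough cells to be
  used.
\<close>

definition owned :: "'g \<Rightarrow> 'g \<Rightarrow> bool" where
  "owned p g \<longleftrightarrow> good (- p + g) \<and> p \<in> P (- p + g)"

definition leftover :: "'g set" where "leftover = {g. \<nexists>p. owned p g}"

definition slots :: "'g set" where "slots = {g. \<exists>p. owned p g \<and> p \<in> sl (P (- p + g))}"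

lemma covI: "lab c = Some j \<Longrightarrow> f \<in> TT j \<Longrightarrow> (j, f) \<in> cov (f + c)"
  by (simp add: cov_def)

lemma E0: "0 \<in> E" by (simp add: E_def)

lemma not_bad_unique:
  assumes "\<not> bad g" "(i, f) \<in> cov g" "(j, f') \<in> cov g" shows "i = j" "f = f'"
  using assms unfolding bad_def by blast+

lemma P_D:
  assumes "p \<in> P c" obtains j where "lab c = Some j" "p \<in> TT j" "\<And>e. e \<in> E \<Longrightarrow> \<not> bad (e + (p + c))"
  using assms that unfolding P_def by (auto split: option.splits)

lemma P_not_bad: "p \<in> P c \<Longrightarrow> \<not> bad (p + c)"
  using E0 by (elim P_D) (metis add_0)

lemma P_unique:
  assumes "p \<in> P c" "p' \<in> P c'" "p + c = p' + c'" shows "p = p'"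
proof -
  obtain i where i: "lab c = Some i" "p \<in> TT i" using assms(1) by (rule P_D)
  obtain j where j: "lab c' = Some j" "p' \<in> TT j" using assms(2) by (rule P_D)
  have "(j, p') \<in> cov (p + c)" using covI[OF j] assms(3) by simp
  then show ?thesis using not_bad_unique(2)[OF P_not_bad[OF assms(1)] covI[OF i]] by simp
qed

lemma partition: "(\<forall>e\<in>E. e + g \<notin> {b. bad b}) \<longleftrightarrow> (\<exists>c\<in>{c. lab c \<noteq> None}. g \<in> P c + {c})"
proof
  assume a: "\<forall>e\<in>E. e + g \<notin> {b. bad b}"
  then have "\<not> bad g" using E0 by force
  then obtain j f where jf: "(j, f) \<in> cov g" unfolding bad_def by auto
  then have f: "f \<in> TT j" "lab (- f + g) = Some j" by (auto simp: cov_def)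
  have "f + (- f + g) = g" by (simp flip: add.assoc)
  then have "f \<in> P (- f + g)" using f a by (auto simp: P_def)
  then have "g \<in> P (- f + g) + {- f + g}" using set_plus_intro[of f "P (- f + g)" "- f + g" "{- f + g}"]
    \<open>f + (- f + g) = g\<close> by simp
  then show "\<exists>c\<in>{c. lab c \<noteq> None}. g \<in> P c + {c}" using f by blast
next
  assume "\<exists>c\<in>{c. lab c \<noteq> None}. g \<in> P c + {c}"
  then obtain c p where c: "p \<in> P c" "g = p + c" by (auto simp: set_plus_def)
  show "\<forall>e\<in>E. e + g \<notin> {b. bad b}" using c(1) unfolding c(2) by (elim P_D) simp
qed

lemma far_apart:
  assumes "lab c \<noteq> None" "lab c' \<noteq> None" "c \<noteq> c'" "f \<in> D \<union> (Z + uminus ` Z)" "g \<in> P c + {c}"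
  shows "f + g \<notin> P c' + {c'}"
proof
  assume "f + g \<in> P c' + {c'}"
  then obtain p' where p': "p' \<in> P c'" "f + g = p' + c'" by (auto simp: set_plus_def)
  obtain p where p: "p \<in> P c" "g = p + c" using assms(5) by (auto simp: set_plus_def)
  obtain i where i: "lab c = Some i" "p \<in> TT i" using p(1) by (rule P_D)
  obtain j where j: "lab c' = Some j" "p' \<in> TT j" using p'(1) by (rule P_D)
  have "(i, p) \<in> cov (p + c)" by (rule covI[OF i])
  then have "f + p \<in> TT i" using P_not_bad[OF p(1)] assms(4) unfolding bad_def K0_def by blast
  then have "(i, f + p) \<in> cov (f + p + c)" by (rule covI[OF i(1)])
  moreover have eq: "f + p + c = p' + c'" using p'(2) by (simp add: p(2) add.assoc)
  ultimately have "f + p = p'"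
    using not_bad_unique(2)[OF P_not_bad[OF p'(1)] _ covI[OF j]] by simp
  then show False using eq assms(3) by simp
qed

lemma bad_marker: "lab c \<noteq> None \<Longrightarrow> Q' + {c} \<subseteq> {b. bad b}"
proof
  fix g assume "lab c \<noteq> None" "g \<in> Q' + {c}"
  then obtain q where "q \<in> Q'" "g = q + c" by (auto simp: set_plus_def)
  moreover have "- q + (q + c) = c" by simp
  ultimately show "g \<in> {b. bad b}" using \<open>lab c \<noteq> None\<close> unfolding bad_def by force
qed

lemma lab_lt: "lab c = Some j \<Longrightarrow> j < k" by (simp add: lab_Some)

lemma finite_P: "finite (P c)"
  using TT(1) lab_lt by (auto simp: P_def split: option.splits)

lemma P_sub: "lab c = Some j \<Longrightarrow> P c \<subseteq> TT j" by (auto simp: P_def)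

lemma good_lab: "good c \<Longrightarrow> lab c \<noteq> None" by (auto simp: good_def)

subsection \<open>Locality\<close>

definition TA :: "'g set" where "TA = (\<Union>j<k. TT j)"

lemma finTA: "finite TA" using TT(1) by (simp add: TA_def)

text \<open>
  The labels seen from \<open>g\<close> and from \<open>g'\<close> agree in the window \<open>K\<close>. The sets \<open>KB\<close>, \<open>KP\<close>, \<open>KO\<close> below are
  windows in which the labels determine badness, the shape of the owned part and the ownership of a
  cell.
\<close>

definition same :: "'g set \<Rightarrow> 'g \<Rightarrow> 'g \<Rightarrow> bool" where
  "same K g g' \<longleftrightarrow> (\<forall>t\<in>K. lab (t + g) = lab (t + g'))"

lemma same_plus: "same (K + M) g g' \<Longrightarrow> m \<in> M \<Longrightarrow> same K (m + g) (m + g')"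
  unfolding same_def by (metis add.assoc set_plus_intro)

lemma same_sub: "same K g g' \<Longrightarrow> M \<subseteq> K \<Longrightarrow> same M g g'"
  by (auto simp: same_def)

definition KB :: "'g set" where "KB = uminus ` TA \<union> uminus ` Q'"

lemma bad_local: assumes "same KB g g'" shows "bad g \<longleftrightarrow> bad g'"
proof -
  have 1: "lab (- f + g) = lab (- f + g')" if "f \<in> TA" for f using assms that by (auto simp: same_def KB_def)
  have 2: "lab (- q + g) = lab (- q + g')" if "q \<in> Q'" for q using assms that by (auto simp: same_def KB_def)
  have "cov g = cov g'"
    using 1 lab_lt by (fastforce simp: cov_def TA_def)
  then show ?thesis using 2 by (simp add: bad_def)
qed

definition KP :: "'g set" where "KP = {0} \<union> (KB + (E + TA))"

lemma P_local: assumes "same KP c c'" shows "lab c = lab c'" "P c = P c'"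
proof -
  have "lab (0 + c) = lab (0 + c')" using assms by (simp add: same_def KP_def)
  then show l: "lab c = lab c'" by simp
  have b: "bad (e + (p + c)) \<longleftrightarrow> bad (e + (p + c'))" if "e \<in> E" "p \<in> TA" for e p
  proof (rule bad_local)
    have "same (KB + (E + TA)) c c'" using assms by (rule same_sub) (unfold KP_def, blast)
    from same_plus[OF this set_plus_intro[OF that]] show "same KB (e + (p + c)) (e + (p + c'))"
      by (simp add: add.assoc)
  qed
  show "P c = P c'"
  proof (cases "lab c'")
    case None
    then show ?thesis by (simp add: P_def l)
  next
    case (Some j)
    have "TT j \<subseteq> TA" using lab_lt[OF Some] by (auto simp: TA_def)
    then show ?thesis unfolding P_def l Some option.case using b by blast
  qed
qed

lemma good_local: "same KP c c' \<Longrightarrow> good c \<longleftrightarrow> good c'"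
  using P_local by (simp add: good_def)

definition KO :: "'g set" where "KO = KP + uminus ` TA"

lemma owned_TA: "owned p g \<Longrightarrow> p \<in> TA"
  unfolding owned_def by (auto elim!: P_D dest: lab_lt simp: TA_def)

lemma same_KO: assumes "same KO g g'" "p \<in> TA" shows "same KP (- p + g) (- p + g')"
  using same_plus[OF assms(1)[unfolded KO_def] imageI[OF assms(2)]] .

lemma owned_local: assumes "same KO g g'" shows "owned p g \<longleftrightarrow> owned p g'"
proof -
  have "owned p g \<longleftrightarrow> owned p g'" if "p \<in> TA"
    using good_local[OF same_KO[OF assms that]] P_local[OF same_KO[OF assms that]] by (simp add: owned_def)
  then show ?thesis using owned_TA by blast
qed

lemma leftover_local: assumes "same KO g g'" shows "g \<in> leftover \<longleftrightarrow> g' \<in> leftover" "g \<in> slots \<longleftrightarrow> g' \<in> slots"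
proof -
  show "g \<in> leftover \<longleftrightarrow> g' \<in> leftover" using owned_local[OF assms] by (simp add: leftover_def)
  have "P (- p + g) = P (- p + g')" if "owned p g" for p
    using P_local(2)[OF same_KO[OF assms owned_TA[OF that]]] .
  then show "g \<in> slots \<longleftrightarrow> g' \<in> slots" using owned_local[OF assms] by (auto simp: slots_def)
qed

lemma finKO: "finite KO"
  unfolding KO_def KP_def KB_def
  by (intro finite_set_plus finite_UnI finite_imageI finTA finQ' finE) simp

subsection \<open>Encoding and decoding\<close>

definition \<zeta> :: "'g \<Rightarrow> 'g \<Rightarrow> bool" where "\<zeta> c a \<longleftrightarrow> a \<in> J (the (lab c))"

text \<open>
  The symbol to be stored at a slot: the symbol of the leftover cell that \<open>\<eta>\<close> assigns to the slot, and
  \<open>0\<close> if there is none.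
\<close>

definition pull :: "('g \<Rightarrow> 'g) \<Rightarrow> ('g \<Rightarrow> nat) \<Rightarrow> 'g \<Rightarrow> nat" where
  "pull \<eta> y s = (if \<exists>g\<in>leftover. \<eta> g + g = s then y (THE g. g \<in> leftover \<and> \<eta> g + g = s) else 0)"

definition msg :: "('g \<Rightarrow> 'g) \<Rightarrow> ('g \<Rightarrow> nat) \<Rightarrow> 'g \<Rightarrow> ('g \<Rightarrow> nat) \<times> ('g \<Rightarrow> nat)" where
  "msg \<eta> y c = (restrict (\<lambda>p. y (p + c)) (P c), restrict (\<lambda>p. pull \<eta> y (p + c)) (sl (P c)))"

text \<open>
  Tiles that are not good carry an arbitrary structured block.
\<close>

definition encodes :: "('g \<Rightarrow> 'g) \<Rightarrow> ('g \<Rightarrow> 'a) \<Rightarrow> ('g \<Rightarrow> nat) \<Rightarrow> bool" where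
  "encodes \<eta> x y \<longleftrightarrow> x \<in> X \<and> y \<in> full_shift {..<N} \<and>
     (\<forall>c. good c \<longrightarrow> (\<forall>p\<in>P c. x (p + c) = enc (P c) (msg \<eta> y c) p)) \<and>
     (\<forall>c. lab c \<noteq> None \<longrightarrow> marker_at x c (\<zeta> c)) \<and> (\<forall>g \<xi>. marker_at x g \<xi> \<longrightarrow> lab g \<noteq> None)"

lemma structured_ne: assumes "finite S" shows "structured S \<noteq> {}"
proof
  assume "structured S = {}"
  then have "real (card (blocks X S)) \<le> 0" using card_structured[OF assms] by simp
  then show False using card_blocks_pos[OF subshift fin\<Lambda> assms neX] by simp
qed

lemma msg_in:
  assumes "y \<in> full_shift {..<N}" "N \<ge> 1" and "inj_on (\<lambda>g. \<eta> g + g) leftover"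
  shows "msg \<eta> y c \<in> (P c \<rightarrow>\<^sub>E {..<N}) \<times> (sl (P c) \<rightarrow>\<^sub>E {..<N})"
  using assms by (auto simp: msg_def full_shift_def pull_def)

lemma encodes_exists:
  assumes y: "y \<in> full_shift {..<N}" and N: "N \<ge> 1" and inj: "inj_on (\<lambda>g. \<eta> g + g) leftover"
  shows "\<exists>x. encodes \<eta> x y"
proof -
  define \<beta> where "\<beta> c = (if good c then enc (P c) (msg \<eta> y c) else (SOME b. b \<in> structured (P c)))" for c
  have \<beta>: "\<beta> c \<in> structured (P c)" if "c \<in> {c. lab c \<noteq> None}" for c
  proof (cases "good c")
    case True
    then obtain j where j: "lab c = Some j" "(1 - \<epsilon>\<^sub>1) * real (card (TT j)) \<le> real (card (P c))"
      by (auto simp: good_def)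
    have "enc (P c) ` ((P c \<rightarrow>\<^sub>E {..<N}) \<times> (sl (P c) \<rightarrow>\<^sub>E {..<N})) \<subseteq> structured (P c)"
      using enc[OF lab_lt[OF j(1)] P_sub[OF j(1)] j(2)] by blast
    then show ?thesis using msg_in[OF y N inj, of c] True by (auto simp: \<beta>_def)
  next
    case False
    then show ?thesis using structured_ne[OF finite_P, of c] by (simp add: \<beta>_def some_in_eq)
  qed
  have disj: "disjoint_family_on (\<lambda>c. Q' + {c}) {c. lab c \<noteq> None}"
    unfolding disjoint_family_on_def
  proof (intro ballI impI)
    fix c c' assume c: "c \<in> {c. lab c \<noteq> None}" "c' \<in> {c. lab c \<noteq> None}" "c \<noteq> c'"
    then obtain i j where ij: "i < k" "c \<in> C i" "j < k" "c' \<in> C j" by (auto simp: lab_Some)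
    have "disjoint_family_on (\<lambda>(j, c). Q' + {c}) (Sigma {..<k} C)" using qt by (simp add: quasi_tiling_def)
    from disjoint_family_onD[OF this, of "(i, c)" "(j, c')"] ij c(3)
    show "(Q' + {c}) \<inter> (Q' + {c'}) = {}" by simp
  qed
  have "\<exists>x\<in>X. (\<forall>c\<in>{c. lab c \<noteq> None}. \<forall>p\<in>P c. x (p + c) = \<beta> c p) \<and>
     (\<forall>c\<in>{c. lab c \<noteq> None}. marker_at x c (\<zeta> c)) \<and> (\<forall>g \<xi>. marker_at x g \<xi> \<longrightarrow> g \<in> {c. lab c \<noteq> None})"
  proof (rule marker_placement[where Bad = "{b. bad b}"])
    show "Q' + {c} \<subseteq> {b. bad b}" if "c \<in> {c. lab c \<noteq> None}" for c using that bad_marker by simp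
    show "f + g \<notin> P c' + {c'}" if "c \<in> {c. lab c \<noteq> None}" "c' \<in> {c. lab c \<noteq> None}" "c \<noteq> c'"
      "f \<in> D \<union> (Z + uminus ` Z)" "g \<in> P c + {c}" for c c' f g
      by (rule far_apart) (use that in auto)
  qed (rule disj finite_P partition | erule \<beta>)+
  then obtain x where "x \<in> X" "\<forall>c\<in>{c. lab c \<noteq> None}. \<forall>p\<in>P c. x (p + c) = \<beta> c p"
    "\<forall>c\<in>{c. lab c \<noteq> None}. marker_at x c (\<zeta> c)" "\<forall>g \<xi>. marker_at x g \<xi> \<longrightarrow> g \<in> {c. lab c \<noteq> None}"
    by blast
  then have "encodes \<eta> x y" using y good_lab by (auto simp: encodes_def \<beta>_def)
  then show ?thesis by blast
qed

lemma marker_at_window: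
  assumes "marker_at x g \<xi>" "\<forall>q\<in>Q. x (q + g) = x' (q + g')" shows "marker_at x' g' \<xi>"
  unfolding marker_at_def
proof (intro conjI ballI)
  fix t assume t: "t \<in> T"
  then have "t \<in> Q" by (simp add: Q_def)
  then show "x' (t + g') = A0 t" using assms t by (auto simp: marker_at_def)
next
  fix a w assume aw: "a \<in> A" "w \<in> V"
  then have "w + a \<in> Q" by (auto simp: Q_def intro: set_plus_intro)
  then have "x ((w + a) + g) = x' ((w + a) + g')" using assms(2) by blast
  then have "x (w + (a + g)) = x' (w + (a + g'))" by (simp only: add.assoc)
  then show "x' (w + (a + g')) = (if \<xi> a then v1 w else v0 w)" using assms(1) aw by (auto simp: marker_at_def)
qed

lemma marker_label:
  assumes "marker_at x g \<xi>" "marker_at x g \<xi>'" "a \<in> A" shows "\<xi> a = \<xi>' a"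
proof (rule ccontr)
  assume ne: "\<xi> a \<noteq> \<xi>' a"
  have "v0 w = v1 w" if "w \<in> V" for w
  proof -
    have "(if \<xi> a then v1 w else v0 w) = (if \<xi>' a then v1 w else v0 w)"
      using assms that unfolding marker_at_def by metis
    then show ?thesis using ne by (cases "\<xi> a"; cases "\<xi>' a") auto
  qed
  moreover have "v0 \<in> extensional V" "v1 \<in> extensional V" using vX by (auto simp: blocks_def)
  ultimately have "v0 = v1" by (intro extensionalityI)
  then show False using v01 by blast
qed

text \<open>
  A marker, including its choice between \<open>v0\<close> and \<open>v1\<close>, is visible in \<open>Q + {g}\<close>, and markers occur
  at centers only.
\<close>

lemma lab_window:
  assumes x: "encodes \<eta> x y" and x': "encodes \<eta> x' y'" and eq: "\<forall>q\<in>Q. x (q + g) = x' (q + g')"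
  shows "lab g = lab g'"
proof -
  have iff: "lab g \<noteq> None \<longleftrightarrow> lab g' \<noteq> None"
    using x x' marker_at_window[of x g _ x' g'] marker_at_window[of x' g' _ x g] eq
    unfolding encodes_def by metis
  show ?thesis
  proof (cases "lab g")
    case None
    then show ?thesis using iff by simp
  next
    case (Some i)
    then obtain j where j: "lab g' = Some j" using iff by auto
    have "marker_at x g (\<zeta> g)" using x Some by (simp add: encodes_def)
    then have "marker_at x' g' (\<zeta> g)" using eq by (rule marker_at_window)
    moreover have "marker_at x' g' (\<zeta> g')" using x' j by (simp add: encodes_def)
    ultimately have "a \<in> J i \<longleftrightarrow> a \<in> J j" if "a \<in> A" for a
      using marker_label[of x' g' "\<zeta> g" "\<zeta> g'" a] that by (simp add: \<zeta>_def Some j)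
    then have "J i = J j" using J(2) lab_lt[OF Some] lab_lt[OF j] by blast
    then show ?thesis using J(1) lab_lt[OF Some] lab_lt[OF j] Some j by (auto dest: inj_onD)
  qed
qed

lemma same_window:
  assumes x: "encodes \<eta> x y" "encodes \<eta> x' y'" and eq: "\<forall>q\<in>Q + K. x (q + g) = x' (q + g')"
  shows "same K g g'"
  unfolding same_def
proof
  fix t assume t: "t \<in> K"
  have "\<forall>q\<in>Q. x (q + (t + g)) = x' (q + (t + g'))"
  proof
    fix q assume "q \<in> Q"
    then have "x ((q + t) + g) = x' ((q + t) + g')" using eq t by (blast intro: set_plus_intro)
    then show "x (q + (t + g)) = x' (q + (t + g'))" by (simp only: add.assoc)
  qed
  then show "lab (t + g) = lab (t + g')" by (rule lab_window[OF x])
qed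

definition KD :: "'g set" where "KD = (Q + KO) \<union> (TA + uminus ` TA)"

text \<open>
  If the two codes agree near \<open>g\<close> and \<open>g'\<close>, then these cells lie at the same position of tiles with the
  same owned part, which carry the same block, and \<open>enc\<close> is injective.
\<close>

lemma decode_owned:
  assumes x: "encodes \<eta> x y" and x': "encodes \<eta> x' y'" and eq: "\<forall>t\<in>KD. x (t + g) = x' (t + g')"
    and N: "N \<ge> 1" and inj: "inj_on (\<lambda>g. \<eta> g + g) leftover" and o: "owned p g"
  shows "y g = y' g'" "p \<in> sl (P (- p + g)) \<Longrightarrow> pull \<eta> y g = pull \<eta> y' g'"
proof -
  have same: "same KO g g'" by (rule same_window[OF x x']) (use eq in \<open>auto simp: KD_def\<close>)
  have p: "p \<in> TA" by (rule owned_TA[OF o])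
  define c where "c = - p + g"
  define c' where "c' = - p + g'"
  have PP: "P c' = P c" and lab: "lab c' = lab c"
    using P_local[OF same_KO[OF same p]] by (simp_all add: c_def c'_def)
  have gc: "good c" "p \<in> P c" using o by (auto simp: owned_def c_def)
  have gc': "good c'" using good_local[OF same_KO[OF same p]] gc(1) by (simp add: c_def c'_def)
  obtain j where j: "lab c = Some j" "(1 - \<epsilon>\<^sub>1) * real (card (TT j)) \<le> real (card (P c))"
    using gc(1) by (auto simp: good_def)
  note e = enc[OF lab_lt[OF j(1)] P_sub[OF j(1)] j(2)]
  have yN: "y \<in> full_shift {..<N}" "y' \<in> full_shift {..<N}" using x x' by (auto simp: encodes_def)
  have m: "msg \<eta> y c \<in> (P c \<rightarrow>\<^sub>E {..<N}) \<times> (sl (P c) \<rightarrow>\<^sub>E {..<N})"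
    "msg \<eta> y' c' \<in> (P c \<rightarrow>\<^sub>E {..<N}) \<times> (sl (P c) \<rightarrow>\<^sub>E {..<N})"
    using msg_in[OF yN(1) N inj, of c] msg_in[OF yN(2) N inj, of c'] by (simp_all only: PP)
  have "enc (P c) (msg \<eta> y c) = enc (P c) (msg \<eta> y' c')"
  proof (rule extensionalityI)
    have "enc (P c) (msg \<eta> y c) \<in> structured (P c)" "enc (P c) (msg \<eta> y' c') \<in> structured (P c)"
      by (rule subsetD[OF conjunct2[OF e] imageI[OF m(1)]], rule subsetD[OF conjunct2[OF e] imageI[OF m(2)]])
    then show "enc (P c) (msg \<eta> y c) \<in> extensional (P c)" "enc (P c) (msg \<eta> y' c') \<in> extensional (P c)"
      unfolding structured_def blocks_def by simp_all
    fix q assume q: "q \<in> P c"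
    then have "q \<in> TA" using P_sub[OF j(1)] lab_lt[OF j(1)] by (auto simp: TA_def)
    then have "q + - p \<in> KD" using p by (auto simp: KD_def intro!: set_plus_intro simp del: add_uminus_conv_diff)
    then have "x ((q + - p) + g) = x' ((q + - p) + g')" using eq by blast
    then have "x (q + c) = x' (q + c')" by (simp only: c_def c'_def add.assoc)
    moreover have "x (q + c) = enc (P c) (msg \<eta> y c) q" using x gc(1) q by (auto simp: encodes_def)
    moreover have "x' (q + c') = enc (P c) (msg \<eta> y' c') q" using x' gc' q PP by (auto simp: encodes_def)
    ultimately show "enc (P c) (msg \<eta> y c) q = enc (P c) (msg \<eta> y' c') q" by simp
  qed
  then have eqm: "msg \<eta> y c = msg \<eta> y' c'" using inj_onD[OF conjunct1[OF e] _ m] by blast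
  have pc: "p + c = g" "p + c' = g'" by (simp_all add: c_def c'_def flip: add.assoc)
  have "restrict (\<lambda>p. y (p + c)) (P c) p = restrict (\<lambda>p. y' (p + c')) (P c) p"
    using eqm by (simp add: msg_def PP)
  then show "y g = y' g'" using gc(2) by (simp add: pc)
  assume s: "p \<in> sl (P (- p + g))"
  have "restrict (\<lambda>p. pull \<eta> y (p + c)) (sl (P c)) p = restrict (\<lambda>p. pull \<eta> y' (p + c')) (sl (P c)) p"
    using eqm by (simp add: msg_def PP)
  then show "pull \<eta> y g = pull \<eta> y' g'" using s by (simp add: pc flip: c_def)
qed

lemma pull_eq:
  assumes "inj_on (\<lambda>g. \<eta> g + g) leftover" "g \<in> leftover" shows "pull \<eta> y (\<eta> g + g) = y g"
proof -
  have "(THE h. h \<in> leftover \<and> \<eta> h + h = \<eta> g + g) = g"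
    using assms by (intro the_equality) (auto dest: inj_onD)
  then show ?thesis using assms(2) by (auto simp: pull_def)
qed

text \<open>
  The symbol of a leftover cell is found in the slot at distance \<open>\<eta> g\<close>, which depends on the labels
  near \<open>g\<close> only.
\<close>

lemma decode:
  assumes x: "encodes \<eta> x y" and x': "encodes \<eta> x' y'" and N: "N \<ge> 1"
    and inj: "inj_on (\<lambda>g. \<eta> g + g) leftover" and H: "\<And>g. g \<in> leftover \<Longrightarrow> \<eta> g \<in> H" "\<And>g. g \<in> leftover \<Longrightarrow> \<eta> g + g \<in> slots"
    and loc: "\<And>g g'. g \<in> leftover \<Longrightarrow> g' \<in> leftover \<Longrightarrow>
      (\<forall>t\<in>K. (t + g \<in> leftover \<longleftrightarrow> t + g' \<in> leftover) \<and> (t + g \<in> slots \<longleftrightarrow> t + g' \<in> slots)) \<Longrightarrow> \<eta> g = \<eta> g'"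
    and eq: "\<forall>t\<in>(Q + (KO + K)) \<union> (KD + H) \<union> KD. x (t + g) = x' (t + g')"
  shows "y g = y' g'"
proof (cases "g \<in> leftover")
  case False
  then obtain p where "owned p g" by (auto simp: leftover_def)
  then show ?thesis using decode_owned(1)[OF x x' _ N inj] eq by blast
next
  case True
  have sameKO: "same KO g g'"
    by (rule same_window[OF x x']) (use eq in \<open>auto simp: KD_def\<close>)
  have same: "same (KO + K) g g'" by (rule same_window[OF x x']) (use eq in blast)
  have g': "g' \<in> leftover" using leftover_local(1)[OF sameKO] True by simp
  have "\<eta> g = \<eta> g'"
    by (rule loc[OF True g']) (use leftover_local[OF same_plus[OF same]] in blast)
  define h where "h = \<eta> g"
  have h: "\<eta> g = h" "\<eta> g' = h" using \<open>\<eta> g = \<eta> g'\<close> by (simp_all add: h_def)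
  have "h + g \<in> slots" using H(2)[OF True] h by simp
  then obtain p where p: "owned p (h + g)" "p \<in> sl (P (- p + (h + g)))" by (auto simp: slots_def)
  have hH: "h \<in> H" using H(1)[OF True] h by simp
  have "\<forall>t\<in>KD. x (t + (h + g)) = x' (t + (h + g'))"
  proof
    fix t assume "t \<in> KD"
    then have "t + h \<in> KD + H" using hH by (rule set_plus_intro)
    then have "x ((t + h) + g) = x' ((t + h) + g')" using eq by blast
    then show "x (t + (h + g)) = x' (t + (h + g'))" by (simp only: add.assoc)
  qed
  from decode_owned(2)[OF x x' this N inj p]
  have "pull \<eta> y (h + g) = pull \<eta> y' (h + g')" .
  then show ?thesis using pull_eq[OF inj True, of y] pull_eq[OF inj g', of y'] h by simp
qed

end

section \<open>Leftover cells are rarer than slots\<close>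

context marked_tiling
begin

definition KT :: "'g set" where "KT = TA + uminus ` TA"

lemma finKT: "finite KT"
  unfolding KT_def by (intro finite_set_plus finite_imageI finTA)

lemma diff_KT: assumes "p \<in> TA" "q \<in> TA" shows "p - q \<in> KT"
  using set_plus_intro[OF assms(1) imageI[OF assms(2), of uminus]] by (simp add: KT_def)

lemma near_KT:
  assumes "j < k" "y \<in> TT j + {c}" "r \<in> TT j + {c}" shows "r - y \<in> KT"
proof -
  have "r - c \<in> TA" "y - c \<in> TA" using assms by (auto simp: mem_translate TA_def)
  from diff_KT[OF this] have "(r - c) - (y - c) \<in> KT" .
  moreover have "(r - c) - (y - c) = (r - c) + (c - y)"
    by (simp only: diff_conv_add_uminus[of "r - c" "y - c"] minus_diff_eq)
  moreover have "(r - c) + (c - y) = r - y" by (simp add: add_diff_eq)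
  ultimately show ?thesis by simp
qed

lemma core:
  assumes "i \<in> Sigma {..<k} C"
  shows "R i \<subseteq> TT (fst i) + {snd i}" "(1 - \<epsilon>) * real (card (TT (fst i))) \<le> real (card (R i))"
    "fst i < k" "finite (TT (fst i))" "lab (snd i) = Some (fst i)"
  using quasi_tilingD[OF qt assms] TT(1) assms by (auto simp: lab_Some)

lemma disj_R: "disjoint_family_on R (Sigma {..<k} C)"
  using qt by (simp add: quasi_tiling_def)

text \<open>
  Instance of \<open>density_le_tiles\<close> for parts of tiles, charged to the cores.
\<close>

lemma tiles_density:
  fixes Y :: "nat \<times> 'g \<Rightarrow> 'g set" and q :: real
  assumes F: "folner_sequence F" and \<epsilon>: "\<epsilon> < 1" and q: "q \<ge> 0"
    and Y: "\<And>i. i \<in> Sigma {..<k} C \<Longrightarrow> Y i \<subseteq> TT (fst i) + {snd i}"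
      "\<And>i. i \<in> Sigma {..<k} C \<Longrightarrow> real (card (Y i)) \<le> q * card (TT (fst i))"
  shows "density_le F (\<Union>i\<in>Sigma {..<k} C. Y i) (q / (1 - \<epsilon>))"
proof -
  have "density_le F (\<Union>i\<in>Sigma {..<k} C. Y i) (q / (1 - \<epsilon>) * 1)"
  proof (rule density_le_tiles[OF F finKT disj_R])
    show "density_le F UNIV 1" by (rule density_le_UNIV[OF F])
    show "0 \<le> q / (1 - \<epsilon>)" using q \<epsilon> by simp
    fix i assume i: "i \<in> Sigma {..<k} C"
    show "R i \<subseteq> UNIV" by simp
    show "r - y \<in> KT" if "y \<in> Y i" "r \<in> R i" for y r
      by (rule near_KT[OF core(3)[OF i], of _ "snd i"]) (use that Y(1)[OF i] core(1)[OF i] in auto)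
    have "finite (Y i)" using Y(1)[OF i] core(4)[OF i] by (auto intro: finite_subset)
    moreover have "real (card (Y i)) \<le> q / (1 - \<epsilon>) * card (R i)"
    proof -
      have "real (card (Y i)) \<le> q * card (TT (fst i))" by (rule Y(2)[OF i])
      also have "\<dots> = q / (1 - \<epsilon>) * ((1 - \<epsilon>) * card (TT (fst i)))" using \<epsilon> by simp
      also have "\<dots> \<le> q / (1 - \<epsilon>) * card (R i)"
        using core(2)[OF i] q \<epsilon> by (intro mult_left_mono) auto
      finally show ?thesis .
    qed
    ultimately show "finite (Y i) \<and> real (card (Y i)) \<le> q / (1 - \<epsilon>) * card (R i)" by blast
  qed
  then show ?thesis by simp
qed

text \<open>
  A position in two tiles lies outside the core of one of them, hence in one of the small sets \<open>Y1\<close>;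
  marker zones and boundary layers are small parts of their tiles, too.
\<close>

lemma density_bad:
  assumes F: "folner_sequence F" and \<epsilon>: "0 < \<epsilon>" "\<epsilon> \<le> 1 / 2"
    and dens: "density_le F (- covered k TT C) \<epsilon>"
    and Q': "\<And>j. j < k \<Longrightarrow> real (card Q') \<le> \<epsilon> * card (TT j)"
    and bdry: "\<And>j. j < k \<Longrightarrow> real (card {p \<in> TT j. \<exists>e\<in>K0. e + p \<notin> TT j}) \<le> \<epsilon> * card (TT j)"
  shows "density_le F {b. bad b} (7 * \<epsilon>)"
proof -
  let ?S = "Sigma {..<k} C"
  have e1: "\<epsilon> < 1" using \<epsilon> by simp
  define Y1 where "Y1 i = (TT (fst i) + {snd i}) - R i" for i
  define Y2 where "Y2 i = Q' + {snd i}" for i :: "nat \<times> 'g"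
  define Y3 where "Y3 i = {p \<in> TT (fst i). \<exists>e\<in>K0. e + p \<notin> TT (fst i)} + {snd i}" for i
  have d1: "density_le F (\<Union>i\<in>?S. Y1 i) (\<epsilon> / (1 - \<epsilon>))"
  proof (rule tiles_density[OF F e1])
    fix i assume i: "i \<in> ?S"
    show "Y1 i \<subseteq> TT (fst i) + {snd i}" by (auto simp: Y1_def)
    have "card (R i) \<le> card (TT (fst i) + {snd i})" using core[OF i] by (intro card_mono) auto
    then have "real (card (Y1 i)) = card (TT (fst i)) - real (card (R i))"
      using core[OF i] by (simp add: Y1_def card_Diff_subset finite_subset[OF core(1)[OF i]] of_nat_diff)
    then show "real (card (Y1 i)) \<le> \<epsilon> * card (TT (fst i))" using core(2)[OF i] by (simp add: algebra_simps)
  qed (use \<epsilon> in auto)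
  have d2: "density_le F (\<Union>i\<in>?S. Y2 i) (\<epsilon> / (1 - \<epsilon>))"
  proof (rule tiles_density[OF F e1])
    fix i assume i: "i \<in> ?S"
    show "Y2 i \<subseteq> TT (fst i) + {snd i}" unfolding Y2_def by (intro set_plus_mono2 TT(2) core(3)[OF i] order_refl)
    show "real (card (Y2 i)) \<le> \<epsilon> * card (TT (fst i))" using Q'[OF core(3)[OF i]] by (simp add: Y2_def)
  qed (use \<epsilon> in auto)
  have d3: "density_le F (\<Union>i\<in>?S. Y3 i) (\<epsilon> / (1 - \<epsilon>))"
  proof (rule tiles_density[OF F e1])
    fix i assume i: "i \<in> ?S"
    show "Y3 i \<subseteq> TT (fst i) + {snd i}" unfolding Y3_def by (intro set_plus_mono2 order_refl) auto
    show "real (card (Y3 i)) \<le> \<epsilon> * card (TT (fst i))" using bdry[OF core(3)[OF i]] by (simp add: Y3_def)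
  qed (use \<epsilon> in auto)
  have sub: "{b. bad b} \<subseteq> (- covered k TT C) \<union> ((\<Union>i\<in>?S. Y1 i) \<union> ((\<Union>i\<in>?S. Y2 i) \<union> (\<Union>i\<in>?S. Y3 i)))"
  proof
    fix b assume "b \<in> {b. bad b}"
    then have b: "bad b" by simp
    have tile: "(j, - f + b) \<in> ?S" "b \<in> TT j + {- f + b}" if "(j, f) \<in> cov b" for j f
    proof -
      have f: "f \<in> TT j" "j < k" "- f + b \<in> C j" using that by (auto simp: cov_def lab_Some)
      show "(j, - f + b) \<in> ?S" using f by simp
      have "f + (- f + b) \<in> TT j + {- f + b}" using f(1) by (rule set_plus_intro) simp
      then show "b \<in> TT j + {- f + b}" by (simp flip: add.assoc)
    qed
    from b consider "cov b = {}" | i j where "i \<in> cov b" "j \<in> cov b" "i \<noteq> j"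
      | q where "q \<in> Q'" "lab (- q + b) \<noteq> None"
      | j f e where "(j, f) \<in> cov b" "e \<in> K0" "e + f \<notin> TT j"
      unfolding bad_def by blast
    then show "b \<in> (- covered k TT C) \<union> ((\<Union>i\<in>?S. Y1 i) \<union> ((\<Union>i\<in>?S. Y2 i) \<union> (\<Union>i\<in>?S. Y3 i)))"
    proof cases
      case 1
      have "b \<notin> covered k TT C"
      proof
        assume "b \<in> covered k TT C"
        then obtain j c where jc: "j < k" "c \<in> C j" "b \<in> TT j + {c}" by (auto simp: covered_def)
        then have "(j, b - c) \<in> cov (b - c + c)" by (intro covI) (auto simp: lab_Some mem_translate)
        then show False using 1 by simp
      qed
      then show ?thesis by blast
    next
      case (2 x x')
      obtain i f j f' where x: "x = (i, f)" "x' = (j, f')" by (cases x; cases x') auto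
      note t = tile[OF 2(1)[unfolded x]] tile[OF 2(2)[unfolded x]]
      have "(i, - f + b) \<noteq> (j, - f' + b)" using 2(3) x by auto
      then have "R (i, - f + b) \<inter> R (j, - f' + b) = {}"
        using disjoint_family_onD[OF disj_R t(1,3)] by blast
      then have "b \<in> Y1 (i, - f + b) \<or> b \<in> Y1 (j, - f' + b)" using t(2,4) by (auto simp: Y1_def)
      then show ?thesis using t(1,3) by blast
    next
      case (3 q)
      then obtain j where j: "lab (- q + b) = Some j" by auto
      then have "(j, - q + b) \<in> ?S" by (simp add: lab_Some)
      moreover have "q + (- q + b) \<in> Q' + {- q + b}" using 3(1) by (rule set_plus_intro) simp
      then have "b \<in> Y2 (j, - q + b)" by (simp add: Y2_def flip: add.assoc)
      ultimately show ?thesis by blast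
    next
      case (4 j f e)
      note t = tile[OF 4(1)]
      have "f \<in> {p \<in> TT j. \<exists>e\<in>K0. e + p \<notin> TT j}" using 4 by (auto simp: cov_def)
      then have "f + (- f + b) \<in> Y3 (j, - f + b)" unfolding Y3_def by (intro set_plus_intro) auto
      then have "b \<in> Y3 (j, - f + b)" by (simp flip: add.assoc)
      then show ?thesis using t(1) by blast
    qed
  qed
  have "\<epsilon> / (1 - \<epsilon>) \<le> \<epsilon> / (1 / 2)" using \<epsilon> by (intro divide_left_mono) auto
  then have "\<epsilon> + (\<epsilon> / (1 - \<epsilon>) + (\<epsilon> / (1 - \<epsilon>) + \<epsilon> / (1 - \<epsilon>))) \<le> 7 * \<epsilon>" by simp
  then show ?thesis
    by (rule density_le_mono[OF F density_le_Un[OF dens density_le_Un[OF d1 density_le_Un[OF d2 d3]]] sub])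
qed

text \<open>
  A leftover cell is close to a bad position or lies in a tile that is not good. The core of such a
  tile has more than a proportion \<open>\<epsilon>\<^sub>1 - \<epsilon>\<close> of cells close to bad positions, so these tiles are rare as
  well.
\<close>

lemma density_leftover:
  assumes F: "folner_sequence F" and \<epsilon>: "0 < \<epsilon>" "\<epsilon> \<le> 1 / 2" "\<epsilon> \<le> \<epsilon>\<^sub>1 / 2" "\<epsilon>\<^sub>1 \<le> 1"
    and bad: "density_le F {b. bad b} (7 * \<epsilon>)"
  shows "density_le F leftover (3 * (card E * (7 * \<epsilon>)) / \<epsilon>\<^sub>1)"
proof -
  let ?S = "Sigma {..<k} C"
  define NO where "NO = {g. \<exists>e\<in>E. bad (e + g)}"
  define \<kappa> where "\<kappa> = card E * (7 * \<epsilon>)"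
  have \<kappa>0: "\<kappa> \<ge> 0" using \<epsilon> by (simp add: \<kappa>_def)
  have "NO \<subseteq> uminus ` E + {b. bad b}"
  proof
    fix g assume "g \<in> NO"
    then obtain e where e: "e \<in> E" "bad (e + g)" by (auto simp: NO_def)
    then have "- e + (e + g) \<in> uminus ` E + {b. bad b}" by (intro set_plus_intro) auto
    then show "g \<in> uminus ` E + {b. bad b}" by simp
  qed
  then have dNO: "density_le F NO \<kappa>"
    using density_le_mono[OF F density_le_set_plus[OF F finite_imageI[OF finE, of uminus] bad]]
    by (simp add: \<kappa>_def card_uminus_image)
  define I where "I = {i \<in> ?S. \<not> good (snd i)}"
  have dB: "density_le F (\<Union>i\<in>I. TT (fst i) + {snd i}) (1 / (\<epsilon>\<^sub>1 - \<epsilon>) * \<kappa>)"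
  proof (rule density_le_tiles[OF F finKT, where R = "\<lambda>i. R i \<inter> NO" and V = NO])
    show "disjoint_family_on (\<lambda>i. R i \<inter> NO) I"
      unfolding disjoint_family_on_def
    proof (intro ballI impI)
      fix i i' assume "i \<in> I" "i' \<in> I" "i \<noteq> i'"
      then have "R i \<inter> R i' = {}" using disjoint_family_onD[OF disj_R, of i i'] by (simp add: I_def)
      then show "R i \<inter> NO \<inter> (R i' \<inter> NO) = {}" by blast
    qed
    show "0 \<le> 1 / (\<epsilon>\<^sub>1 - \<epsilon>)" using \<epsilon> by simp
    show "density_le F NO \<kappa>" by (rule dNO)
    fix i assume i': "i \<in> I"
    then have i: "i \<in> ?S" and ng: "\<not> good (snd i)" by (auto simp: I_def)
    show "R i \<inter> NO \<subseteq> NO" by simp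
    show "r - y \<in> KT" if "y \<in> TT (fst i) + {snd i}" "r \<in> R i \<inter> NO" for y r
      by (rule near_KT[OF core(3)[OF i], of _ "snd i"]) (use that core(1)[OF i] in auto)
    define c where "c = snd i"
    define j where "j = fst i"
    have lab: "lab c = Some j" and fin: "finite (TT j)" and Rs: "R i \<subseteq> TT j + {c}"
      and Rc: "(1 - \<epsilon>) * card (TT j) \<le> card (R i)"
      using core[OF i] by (simp_all add: c_def j_def)
    have finR: "finite (R i)" using Rs fin by (auto intro: finite_subset)
    have "(TT j + {c}) - NO \<subseteq> P c + {c}"
    proof
      fix g assume g: "g \<in> (TT j + {c}) - NO"
      then have "\<forall>e\<in>E. \<not> bad (e + (g - c + c))" by (auto simp: NO_def)
      then have "g - c \<in> P c" using g lab by (simp add: P_def mem_translate)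
      then show "g \<in> P c + {c}" by (simp add: mem_translate)
    qed
    then have "card (R i - NO) \<le> card (P c + {c})"
      using Rs finite_P by (intro card_mono) auto
    then have "real (card (R i - NO)) \<le> real (card (P c))" by simp
    moreover have "real (card (P c)) < (1 - \<epsilon>\<^sub>1) * card (TT j)"
      using ng lab by (auto simp: good_def c_def)
    ultimately have "real (card (R i - NO)) < (1 - \<epsilon>\<^sub>1) * card (TT j)" by linarith
    moreover have "card (R i) = card (R i \<inter> NO) + card (R i - NO)" by (rule card_Int_Diff[OF finR])
    ultimately have "(\<epsilon>\<^sub>1 - \<epsilon>) * card (TT j) \<le> card (R i \<inter> NO)"
      using Rc by (simp add: algebra_simps)
    then have "real (card (TT j)) \<le> 1 / (\<epsilon>\<^sub>1 - \<epsilon>) * card (R i \<inter> NO)"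
      using \<epsilon> by (simp add: le_divide_eq mult.commute)
    then show "finite (TT (fst i) + {snd i}) \<and>
        real (card (TT (fst i) + {snd i})) \<le> 1 / (\<epsilon>\<^sub>1 - \<epsilon>) * card (R i \<inter> NO)"
      using fin by (simp add: j_def)
  qed
  have sub: "leftover \<subseteq> NO \<union> (\<Union>i\<in>I. TT (fst i) + {snd i})"
  proof
    fix g assume g: "g \<in> leftover"
    show "g \<in> NO \<union> (\<Union>i\<in>I. TT (fst i) + {snd i})"
    proof (cases "g \<in> NO")
      case False
      then obtain c where c: "g \<in> P c + {c}" using partition[of g] by (auto simp: NO_def)
      then obtain p where p: "p \<in> P c" "g = p + c" by (auto simp: set_plus_def)
      obtain j where j: "lab c = Some j" "p \<in> TT j" using p(1) by (rule P_D)
      have "- p + g = c" by (simp add: p(2))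
      then have "\<not> good c" using g p(1) by (auto simp: leftover_def owned_def)
      then have "(j, c) \<in> I" using j by (simp add: I_def lab_Some)
      moreover have "g \<in> TT j + {c}" using j p(2) by (simp add: mem_translate)
      ultimately show ?thesis by force
    qed simp
  qed
  have "\<kappa> + 1 / (\<epsilon>\<^sub>1 - \<epsilon>) * \<kappa> \<le> 3 * \<kappa> / \<epsilon>\<^sub>1"
  proof -
    have "1 / (\<epsilon>\<^sub>1 - \<epsilon>) \<le> 1 / (\<epsilon>\<^sub>1 / 2)" using \<epsilon> by (intro divide_left_mono) auto
    then have "1 + 1 / (\<epsilon>\<^sub>1 - \<epsilon>) \<le> 1 / \<epsilon>\<^sub>1 + 2 / \<epsilon>\<^sub>1" using \<epsilon> by (intro add_mono) auto
    then have "(1 + 1 / (\<epsilon>\<^sub>1 - \<epsilon>)) * \<kappa> \<le> (3 / \<epsilon>\<^sub>1) * \<kappa>" using \<kappa>0 by (intro mult_right_mono) auto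
    then show ?thesis by (simp add: algebra_simps)
  qed
  then show ?thesis using density_le_mono[OF F density_le_Un[OF dNO dB] sub] by (simp add: \<kappa>_def)
qed

lemma card_window:
  fixes h :: 'g
  shows "card {t \<in> B. t + h \<in> S} = card (S \<inter> (B + {h}))"
proof (rule bij_betw_same_card)
  show "bij_betw (\<lambda>t. t + h) {t \<in> B. t + h \<in> S} (S \<inter> (B + {h}))"
    unfolding bij_betw_def by (auto simp: inj_on_def translate_eq_image)
qed

text \<open>
  In a large window all but a few cells belong to good tiles whose owned part lies inside the
  window, and the slots of these tiles make up a proportion \<open>\<beta>\<close>.
\<close>

lemma unbalanced:
  fixes \<beta> :: real
  assumes F: "folner_sequence F" and \<beta>: "0 < \<beta>" "\<beta> \<le> 1 / 2"
    and sl_ge: "\<And>c. \<beta> * card (P c) \<le> card (sl (P c))"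
    and dL: "density_le F leftover (\<beta> / 8)"
  shows "\<exists>B. finite B \<and> (\<forall>h. card {t \<in> B. t + h \<in> leftover} < card {t \<in> B. t + h \<in> slots})"
proof -
  have \<beta>8: "\<beta> / 8 > 0" using \<beta> by simp
  have "\<forall>\<^sub>F n in sequentially. (\<forall>h. real (card (leftover \<inter> (F n + {h}))) \<le> (\<beta> / 8 + \<beta> / 8) * card (F n)) \<and>
     real (card {g \<in> F n. \<exists>k\<in>KT. k + g \<notin> F n}) \<le> \<beta> / 8 * card (F n)"
    by (rule eventually_conj[OF dL[unfolded density_le_def, rule_format, OF \<beta>8] folner_interior[OF F finKT \<beta>8]])
  from eventually_happens'[OF sequentially_bot this] obtain n
    where n1: "\<And>h. real (card (leftover \<inter> (F n + {h}))) \<le> (\<beta> / 8 + \<beta> / 8) * card (F n)"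
    and n2: "real (card {g \<in> F n. \<exists>k\<in>KT. k + g \<notin> F n}) \<le> \<beta> / 8 * card (F n)" by blast
  have finF: "finite (F n)" and Fpos: "0 < real (card (F n))"
    using F by (auto simp: folner_sequence_def card_gt_0_iff)
  have "card (leftover \<inter> (F n + {h})) < card (slots \<inter> (F n + {h}))" for h
  proof -
    define B where "B = F n + {h}"
    have finB: "finite B" and cB: "card B = card (F n)" using finF by (simp_all add: B_def)
    define bd where "bd = {g \<in> F n. \<exists>k\<in>KT. k + g \<notin> F n} + {h}"
    have finbd: "finite bd" and cbd: "real (card bd) \<le> \<beta> / 8 * card (F n)" using finF n2 by (simp_all add: bd_def)
    define G where "G = {g \<in> B. g \<notin> leftover \<and> (\<forall>k\<in>KT. k + g \<in> B)}"
    have finG: "finite G" using finB by (simp add: G_def)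
    have "B \<subseteq> G \<union> (leftover \<inter> B) \<union> bd"
    proof
      fix g assume g: "g \<in> B"
      show "g \<in> G \<union> (leftover \<inter> B) \<union> bd"
      proof (cases "\<forall>k\<in>KT. k + g \<in> B")
        case True
        then show ?thesis using g by (auto simp: G_def)
      next
        case False
        then obtain k where k: "k \<in> KT" "k + g \<notin> B" by blast
        then have "k + (g - h) \<notin> F n" by (simp add: B_def mem_translate add_diff_eq)
        then have "g \<in> bd" using g k(1) by (auto simp: B_def bd_def mem_translate)
        then show ?thesis by blast
      qed
    qed
    then have "card B \<le> card (G \<union> (leftover \<inter> B) \<union> bd)" using finG finB finbd by (intro card_mono) auto
    also have "\<dots> \<le> card G + card (leftover \<inter> B) + card bd"
      using card_Un_le[of "G \<union> (leftover \<inter> B)" bd] card_Un_le[of G "leftover \<inter> B"] by linarith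
    finally have "real (card (F n)) \<le> card G + real (card (leftover \<inter> B)) + card bd" using cB by simp
    then have cG: "(1 - 3 * \<beta> / 8) * card (F n) \<le> card G"
      using n1[of h] cbd by (simp add: B_def algebra_simps)
    define J where "J = {c. good c \<and> P c \<noteq> {} \<and> P c + {c} \<subseteq> B}"
    have "J \<subseteq> uminus ` TA + B"
    proof
      fix c assume c: "c \<in> J"
      then obtain p where p: "p \<in> P c" by (auto simp: J_def)
      then have "p + c \<in> B" using c by (auto simp: J_def intro!: set_plus_intro)
      moreover have "p \<in> TA" using p by (elim P_D) (auto simp: TA_def dest: lab_lt)
      ultimately have "- p + (p + c) \<in> uminus ` TA + B" by (intro set_plus_intro) auto
      then show "c \<in> uminus ` TA + B" by simp
    qed
    then have finJ: "finite J"
      by (rule finite_subset[OF _ finite_set_plus[OF finite_imageI[OF finTA] finB]])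
    have disj: "(P c + {c}) \<inter> (P c' + {c'}) = {}" if "c \<noteq> c'" for c c'
    proof (rule ccontr)
      assume "(P c + {c}) \<inter> (P c' + {c'}) \<noteq> {}"
      then obtain p p' where pp: "p \<in> P c" "p' \<in> P c'" "p + c = p' + c'" by (auto simp: set_plus_def)
      then show False using P_unique[OF pp] that by simp
    qed
    have GJ: "G \<subseteq> (\<Union>c\<in>J. P c + {c})"
    proof
      fix g assume g: "g \<in> G"
      then obtain p where p: "owned p g" by (auto simp: G_def leftover_def)
      define c where "c = - p + g"
      have c: "good c" "p \<in> P c" using p by (auto simp: owned_def c_def)
      have gc: "g = p + c" by (simp add: c_def flip: add.assoc)
      have "P c + {c} \<subseteq> B"
      proof
        fix x assume "x \<in> P c + {c}"
        then obtain q where q: "q \<in> P c" "x = q + c" by (auto simp: set_plus_def)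
        have "q \<in> TA" using q(1) by (elim P_D) (auto simp: TA_def dest: lab_lt)
        then have "q - p \<in> KT" using diff_KT owned_TA[OF p] by blast
        then have "(q - p) + g \<in> B" using g by (auto simp: G_def)
        moreover have "(q - p) + g = x" by (simp add: q(2) gc flip: add.assoc)
        ultimately show "x \<in> B" by simp
      qed
      then have "c \<in> J" using c by (auto simp: J_def)
      moreover have "g \<in> P c + {c}" using c(2) by (simp add: gc mem_translate)
      ultimately show "g \<in> (\<Union>c\<in>J. P c + {c})" by blast
    qed
    have "card G \<le> card (\<Union>c\<in>J. P c + {c})"
      using GJ finJ finite_P by (intro card_mono) auto
    also have "\<dots> \<le> (\<Sum>c\<in>J. card (P c + {c}))" by (rule card_UN_le[OF finJ])
    finally have "\<beta> * card G \<le> \<beta> * real (\<Sum>c\<in>J. card (P c))"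
      using \<beta> by (intro mult_left_mono of_nat_mono) auto
    also have "\<dots> = (\<Sum>c\<in>J. \<beta> * card (P c))" by (simp add: sum_distrib_left)
    also have "\<dots> \<le> (\<Sum>c\<in>J. real (card (sl (P c))))" by (rule sum_mono) (rule sl_ge)
    also have "\<dots> = real (\<Sum>c\<in>J. card (sl (P c) + {c}))" by simp
    also have "(\<Sum>c\<in>J. card (sl (P c) + {c})) = card (\<Union>c\<in>J. sl (P c) + {c})"
    proof (rule card_UN_disjoint[symmetric, OF finJ])
      show "\<forall>c\<in>J. finite (sl (P c) + {c})" using sl finite_P by (auto intro: finite_subset)
      have "sl (P c) + {c} \<subseteq> P c + {c}" for c by (intro set_plus_mono2 sl order_refl)
      then show "\<forall>c\<in>J. \<forall>c'\<in>J. c \<noteq> c' \<longrightarrow> (sl (P c) + {c}) \<inter> (sl (P c') + {c'}) = {}"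
        using disj by blast
    qed
    also have "card (\<Union>c\<in>J. sl (P c) + {c}) \<le> card (slots \<inter> B)"
    proof (rule card_mono)
      show "(\<Union>c\<in>J. sl (P c) + {c}) \<subseteq> slots \<inter> B"
      proof
        fix x assume "x \<in> (\<Union>c\<in>J. sl (P c) + {c})"
        then obtain c s where cs: "c \<in> J" "s \<in> sl (P c)" "x = s + c" by (auto simp: set_plus_def)
        have sP: "s \<in> P c" using cs(2) sl by blast
        have "- s + x = c" by (simp add: cs(3))
        then have "owned s x" "s \<in> sl (P (- s + x))" using cs sP by (auto simp: owned_def J_def)
        then have "x \<in> slots" unfolding slots_def by blast
        moreover have "x \<in> P c + {c}" using sP by (simp add: cs(3) mem_translate)
        ultimately show "x \<in> slots \<inter> B" using cs(1) by (auto simp: J_def)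
      qed
    qed (use finB in simp)
    finally have "\<beta> * card G \<le> card (slots \<inter> B)" by simp
    moreover have "\<beta> * ((1 - 3 * \<beta> / 8) * card (F n)) \<le> \<beta> * card G" using cG \<beta> by (intro mult_left_mono) auto
    moreover have "(\<beta> / 8 + \<beta> / 8) * card (F n) < \<beta> * ((1 - 3 * \<beta> / 8) * card (F n))"
    proof -
      have "1 / 4 < 1 - 3 * \<beta> / 8" using \<beta> by simp
      then have "\<beta> * (1 / 4 * card (F n)) < \<beta> * ((1 - 3 * \<beta> / 8) * card (F n))"
        using \<beta> Fpos by (intro mult_strict_left_mono mult_strict_right_mono) auto
      then show ?thesis by simp
    qed
    ultimately have "real (card (leftover \<inter> B)) < card (slots \<inter> B)" using n1[of h] unfolding B_def by linarith
    then show ?thesis by (simp add: B_def)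
  qed
  then show ?thesis using finF unfolding card_window[symmetric] by blast
qed

end

section \<open>The factor map\<close>

text \<open>
  The rule \<open>\<Psi>\<close> looks at a pattern on \<open>K\<close>; if the pattern occurs in some code, it returns the symbol
  encoded there, which is unique by assumption, and otherwise \<open>0\<close>.
\<close>

lemma factor_map_from_code:
  fixes X :: "('g::group_add \<Rightarrow> 'a) set" and N :: nat
  assumes X: "subshift \<Lambda> X" and N: "N \<ge> 1" and K: "finite K"
    and ex: "\<And>y. y \<in> full_shift {..<N} \<Longrightarrow> \<exists>x. code x y"
    and val: "\<And>x y. code x y \<Longrightarrow> x \<in> X \<and> y \<in> full_shift {..<N}"
    and dec: "\<And>x y x' y' g g'. code x y \<Longrightarrow> code x' y' \<Longrightarrow> \<forall>t\<in>K. x (t + g) = x' (t + g') \<Longrightarrow> y g = y' g'"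
  shows "\<exists>\<pi>. factor_map \<Lambda> X {..<N} (full_shift {..<N}) \<pi>"
proof -
  define ok where "ok w r \<longleftrightarrow> (\<exists>x y g. code x y \<and> (\<forall>t\<in>K. w t = x (t + g)) \<and> r = y g)" for w r
  define \<Psi> where "\<Psi> w = (if \<exists>r. ok w r then SOME r. ok w r else 0)" for w
  define \<pi> where "\<pi> x g = \<Psi> (restrict (\<lambda>t. x (t + g)) K)" for x g
  have okN: "r < N" if "ok w r" for w r
    using that val unfolding ok_def by (auto simp: full_shift_def)
  have \<Psi>N: "\<Psi> w < N" for w
    using okN someI_ex[of "ok w"] N by (auto simp: \<Psi>_def)
  have \<pi>N: "\<pi> x \<in> full_shift {..<N}" for x by (simp add: full_shift_def \<pi>_def \<Psi>N)
  have \<pi>_code: "\<pi> x = y" if c: "code x y" for x y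
  proof
    fix g
    let ?w = "restrict (\<lambda>t. x (t + g)) K"
    have 1: "ok ?w (y g)" unfolding ok_def using c by (intro exI[of _ x] exI[of _ y] exI[of _ g]) auto
    have 2: "r = y g" if ok: "ok ?w r" for r
    proof -
      obtain x' y' g' where c': "code x' y'" and eq: "\<forall>t\<in>K. ?w t = x' (t + g')" and r: "r = y' g'"
        using ok unfolding ok_def by blast
      have "\<forall>t\<in>K. x (t + g) = x' (t + g')" using eq by simp
      from dec[OF c c' this] show ?thesis by (simp only: r)
    qed
    have "(SOME r. ok ?w r) = y g" by (rule 2) (rule someI[of "ok ?w", OF 1])
    moreover have "\<exists>r. ok ?w r" using 1 by blast
    ultimately show "\<pi> x g = y g" unfolding \<pi>_def \<Psi>_def by (simp only: if_True)
  qed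
  have sub: "X \<subseteq> full_shift \<Lambda>" by (rule subshift_subset[OF X])
  have cont: "continuous_map (subtopology (shift_topology \<Lambda>) X) (subtopology (shift_topology {..<N}) (full_shift {..<N})) \<pi>"
  proof (rule continuous_map_into_subtopology)
    show "\<pi> \<in> topspace (subtopology (shift_topology \<Lambda>) X) \<rightarrow> full_shift {..<N}" using \<pi>N by auto
    show "continuous_map (subtopology (shift_topology \<Lambda>) X) (shift_topology {..<N}) \<pi>"
      unfolding shift_topology_def[of "{..<N}"] continuous_map_componentwise_UNIV
    proof
      fix g
      show "continuous_map (subtopology (shift_topology \<Lambda>) X) (discrete_topology {..<N}) (\<lambda>x. \<pi> x g)"
        unfolding continuous_map_def
      proof (intro conjI allI impI)
        show "(\<lambda>x. \<pi> x g) \<in> topspace (subtopology (shift_topology \<Lambda>) X) \<rightarrow> topspace (discrete_topology {..<N})"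
          using \<Psi>N by (auto simp: \<pi>_def)
        fix S
        show "openin (subtopology (shift_topology \<Lambda>) X) {x \<in> topspace (subtopology (shift_topology \<Lambda>) X). \<pi> x g \<in> S}"
          unfolding openin_subshift_iff[OF sub] topspace_subshift[OF sub]
        proof (intro conjI ballI)
          fix x assume x: "x \<in> {x \<in> X. \<pi> x g \<in> S}"
          show "\<exists>K. finite K \<and> (\<forall>y\<in>X. (\<forall>k\<in>K. y k = x k) \<longrightarrow> y \<in> {x \<in> X. \<pi> x g \<in> S})"
          proof (intro exI[of _ "K + {g}"] conjI ballI impI)
            show "finite (K + {g})" using K by simp
            fix y assume y: "y \<in> X" "\<forall>k\<in>K + {g}. y k = x k"
            have "restrict (\<lambda>t. y (t + g)) K = restrict (\<lambda>t. x (t + g)) K"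
              using y(2) by (auto simp: fun_eq_iff intro!: set_plus_intro)
            then have "\<pi> y g = \<pi> x g" by (simp add: \<pi>_def)
            then show "y \<in> {x \<in> X. \<pi> x g \<in> S}" using x y(1) by auto
          qed
        qed auto
      qed
    qed
  qed
  have onto: "\<pi> ` X = full_shift {..<N}"
  proof
    show "full_shift {..<N} \<subseteq> \<pi> ` X"
    proof
      fix y :: "'g \<Rightarrow> nat" assume "y \<in> full_shift {..<N}"
      then obtain x where "code x y" using ex by blast
      then show "y \<in> \<pi> ` X" using \<pi>_code val by (metis image_eqI)
    qed
  qed (use \<pi>N in auto)
  have equi: "\<pi> (shift g x) = shift g (\<pi> x)" for g x
    by (simp add: fun_eq_iff \<pi>_def shift_def add.assoc)
  show ?thesis unfolding factor_map_def using cont onto equi by blast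
qed


text \<open>
  Passing from the tile to its part \<open>P\<close> and then to structured blocks costs factors
  \<open>card \<Lambda> powr (\<epsilon>\<^sub>1 * card T)\<close> and \<open>card \<Lambda> powr (\<delta> * card T)\<close>; the hypothesis \<open>room\<close> says that enough
  blocks remain for one of \<open>N\<close> symbols on each cell of \<open>P\<close> and of \<open>S\<close>.
\<close>

lemma (in filler_system) capacity:
  fixes h \<epsilon>\<^sub>1 :: real and N :: nat and S P T :: "'g set"
  assumes T: "finite T" "P \<subseteq> T" "(1 - \<epsilon>\<^sub>1) * real (card T) \<le> real (card P)" and S: "S \<subseteq> P" and N: "N \<ge> 1"
    and big: "2 powr (h * card T) \<le> card (blocks X T)"
    and room: "log 2 N * (real (card P) + real (card S)) \<le> (h - log 2 (card \<Lambda>) * (\<epsilon>\<^sub>1 + \<delta>)) * card T"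
  shows "\<exists>f. inj_on f ((P \<rightarrow>\<^sub>E {..<N}) \<times> (S \<rightarrow>\<^sub>E {..<N})) \<and>
     f ` ((P \<rightarrow>\<^sub>E {..<N}) \<times> (S \<rightarrow>\<^sub>E {..<N})) \<subseteq> structured P"
proof -
  define l where "l = log 2 (card \<Lambda>)"
  have finP: "finite P" and finS: "finite S" using T S by (auto intro: finite_subset)
  have "\<Lambda> \<noteq> {}" using neX subshift_subset[OF subshift] by (auto simp: full_shift_def)
  then have card\<Lambda>: "1 \<le> card \<Lambda>" using fin\<Lambda> by (simp add: Suc_le_eq card_gt_0_iff)
  then have l0: "l \<ge> 0" by (simp add: l_def)
  have pw: "card \<Lambda> powr r = 2 powr (l * r)" for r
    using card\<Lambda> by (simp add: l_def powr_powr[symmetric])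
  have "0 < card Z" using finZ neZ by (simp add: card_gt_0_iff)
  then have \<delta>0: "0 \<le> \<delta>" using sizeZ by (metis of_nat_0_le_iff of_nat_0_less_iff order_trans zero_le_mult_iff not_less)
  have cTP: "real (card (T - P)) \<le> \<epsilon>\<^sub>1 * card T"
    using T finP card_mono[OF T(1,2)] by (simp add: card_Diff_subset of_nat_diff algebra_simps)
  have "2 powr (h * card T) \<le> real (card (blocks X T))" by (rule big)
  also have "\<dots> \<le> real (card (blocks X P) * card \<Lambda> ^ card (T - P))"
    by (rule of_nat_mono) (rule card_blocks_diff[OF subshift fin\<Lambda> T(1,2)])
  also have "\<dots> = real (card (blocks X P)) * card \<Lambda> powr card (T - P)"
    using card\<Lambda> by (simp add: powr_realpow)
  also have "\<dots> \<le> (card (structured P) * card \<Lambda> powr (\<delta> * card P)) * card \<Lambda> powr (\<epsilon>\<^sub>1 * card T)"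
    using card_structured[OF finP] cTP card\<Lambda> by (intro mult_mono powr_mono) auto
  also have "\<dots> \<le> (card (structured P) * card \<Lambda> powr (\<delta> * card T)) * card \<Lambda> powr (\<epsilon>\<^sub>1 * card T)"
    using card\<Lambda> \<delta>0 card_mono[OF T(1,2)] by (intro mult_right_mono mult_left_mono powr_mono) auto
  also have "\<dots> = card (structured P) * 2 powr (l * (\<epsilon>\<^sub>1 + \<delta>) * card T)"
    unfolding pw by (simp add: powr_add[symmetric] algebra_simps)
  finally have "2 powr (h * card T) * 2 powr (- (l * (\<epsilon>\<^sub>1 + \<delta>) * card T))
      \<le> card (structured P) * 2 powr (l * (\<epsilon>\<^sub>1 + \<delta>) * card T) * 2 powr (- (l * (\<epsilon>\<^sub>1 + \<delta>) * card T))"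
    by (rule mult_right_mono) simp
  then have st: "2 powr ((h - l * (\<epsilon>\<^sub>1 + \<delta>)) * card T) \<le> card (structured P)"
    by (simp add: mult.assoc powr_add[symmetric] algebra_simps)
  have "real (card ((P \<rightarrow>\<^sub>E {..<N}) \<times> (S \<rightarrow>\<^sub>E {..<N}))) = real N ^ (card P + card S)"
    using finP finS by (simp add: card_cartesian_product card_PiE power_add)
  also have "\<dots> = real N powr real (card P + card S)" using N by (intro powr_realpow[symmetric]) simp
  also have "\<dots> = (2 powr log 2 N) powr (real (card P) + real (card S))" using N by simp
  also have "\<dots> = 2 powr (log 2 N * (real (card P) + real (card S)))" by (rule powr_powr)
  also have "\<dots> \<le> 2 powr ((h - l * (\<epsilon>\<^sub>1 + \<delta>)) * card T)"
    using room by (intro powr_mono) (auto simp: l_def)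
  also note st
  finally have le: "card ((P \<rightarrow>\<^sub>E {..<N}) \<times> (S \<rightarrow>\<^sub>E {..<N})) \<le> card (structured P)" by simp
  have f1: "finite (structured P)"
    using finite_blocks[OF subshift fin\<Lambda> finP] by (auto simp: structured_def)
  have f2: "finite ((P \<rightarrow>\<^sub>E {..<N}) \<times> (S \<rightarrow>\<^sub>E {..<N}))"
    using finP finS by (intro finite_cartesian_product finite_PiE) auto
  from card_le_inj[OF f2 f1 le] show ?thesis by (simp only: conj_commute)
qed

text \<open>
  Adding the fixed set \<open>Q\<close> to a late member of the Folner sequence changes it by a negligible
  proportion; the passage from \<open>h2\<close> to \<open>h1\<close> absorbs the change in the number of blocks.
\<close>

lemma tile_exists:
  fixes F :: "nat \<Rightarrow> 'g::group_add set" and h1 h2 \<epsilon> \<delta> :: real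
  assumes F: "folner_sequence F" and inf: "infinite (UNIV :: 'g set)"
    and fin: "finite \<Lambda>" and X: "subshift \<Lambda> X"
    and h: "0 < h1" "h1 < h2" "\<forall>\<^sub>F n in sequentially. 2 powr (h2 * card (F n)) \<le> card (blocks X (F n))"
    and \<epsilon>: "\<epsilon> > 0" and fins: "finite Q" "finite K" "finite K'" and \<delta>: "\<delta> > 0"
  shows "\<exists>S. finite S \<and> S \<noteq> {} \<and> Q \<subseteq> S \<and> (2 powr (h1 * card S) \<le> card (blocks X S) \<and> m \<le> card S \<and>
     real (card Q) \<le> \<epsilon> * card S \<and> real (card {p \<in> S. \<exists>e\<in>K'. e + p \<notin> S}) \<le> \<epsilon> * card S) \<and>
     real (card ((K + S) - S)) \<le> \<delta> * card S"
proof -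
  define q where "q = card Q"
  obtain M :: nat where M: "real m + h1 * q / (h2 - h1) + 2 * q / \<epsilon> + 2 * (card K * q) / \<delta> \<le> M"
    using real_arch_simple by blast
  have "\<forall>\<^sub>F n in sequentially. (M \<le> card (F n) \<and> 2 powr (h2 * card (F n)) \<le> card (blocks X (F n))) \<and>
      real (card ((K + F n) - F n)) \<le> \<delta> / 2 * card (F n) \<and>
      real (card {g \<in> F n. \<exists>k\<in>K'. k + g \<notin> F n}) \<le> \<epsilon> / 2 * card (F n)"
    by (intro eventually_conj folner_card_unbounded[OF F inf] h(3) folner_expand[OF F fins(2)] folner_interior[OF F fins(3)])
       (use \<epsilon> \<delta> in auto)
  from eventually_happens'[OF sequentially_bot this] obtain n where n: "M \<le> card (F n)"
    "2 powr (h2 * card (F n)) \<le> card (blocks X (F n))"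
    "real (card ((K + F n) - F n)) \<le> \<delta> / 2 * card (F n)"
    "real (card {g \<in> F n. \<exists>k\<in>K'. k + g \<notin> F n}) \<le> \<epsilon> / 2 * card (F n)" by blast
  have finF: "finite (F n)" "F n \<noteq> {}" using F by (auto simp: folner_sequence_def)
  define f where "f = real (card (F n))"
  have nn: "0 \<le> h1 * q / (h2 - h1)" "0 \<le> 2 * q / \<epsilon>" "0 \<le> 2 * (card K * q) / \<delta>" using h \<epsilon> \<delta> by auto
  have fM: "real m + h1 * q / (h2 - h1) + 2 * q / \<epsilon> + 2 * (card K * q) / \<delta> \<le> f"
    using M n(1) by (simp add: f_def)
  have "h1 * q / (h2 - h1) \<le> f" "2 * q / \<epsilon> \<le> f" "2 * (card K * q) / \<delta> \<le> f" "real m \<le> f"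
    using fM nn by linarith+
  then have b1: "h1 * q \<le> (h2 - h1) * f" and b2: "q \<le> \<epsilon> / 2 * f" and b3: "card K * q \<le> \<delta> / 2 * f" and b4: "real m \<le> f"
    using h \<epsilon> \<delta> by (auto simp: divide_le_eq mult.commute)
  define S where "S = F n \<union> Q"
  have finS: "finite S" using finF fins by (simp add: S_def)
  have fS: "f \<le> card S" unfolding f_def S_def using finF fins by (intro of_nat_mono card_mono) auto
  have Sf: "card S \<le> f + q" using card_Un_le[of "F n" Q] by (simp add: S_def f_def q_def)
  have "h1 * card S \<le> h1 * (f + q)" using Sf h by (intro mult_left_mono) auto
  also have "\<dots> \<le> h2 * f" using b1 by (simp add: algebra_simps)
  finally have "2 powr (h1 * card S) \<le> 2 powr (h2 * f)" by (intro powr_mono) auto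
  also have "\<dots> \<le> card (blocks X (F n))" using n(2) by (simp add: f_def)
  also have "\<dots> \<le> card (blocks X S)"
    by (rule of_nat_mono, rule card_blocks_mono[OF X fin finS]) (simp add: S_def)
  finally have c1: "2 powr (h1 * card S) \<le> card (blocks X S)" .
  have c2: "m \<le> card S" using b4 fS by linarith
  have \<epsilon>S: "\<epsilon> * f \<le> \<epsilon> * card S" using fS \<epsilon> by (intro mult_left_mono) auto
  have f0: "0 \<le> \<epsilon> / 2 * f" using \<epsilon> by (simp add: f_def)
  have c3: "real (card Q) \<le> \<epsilon> * card S" using b2 \<epsilon>S f0 by (simp add: q_def)
  have "card {p \<in> S. \<exists>e\<in>K'. e + p \<notin> S} \<le> card ({g \<in> F n. \<exists>k\<in>K'. k + g \<notin> F n} \<union> Q)"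
    using finF fins by (intro card_mono) (auto simp: S_def)
  also have "\<dots> \<le> card {g \<in> F n. \<exists>k\<in>K'. k + g \<notin> F n} + q" unfolding q_def by (rule card_Un_le)
  finally have c4: "real (card {p \<in> S. \<exists>e\<in>K'. e + p \<notin> S}) \<le> \<epsilon> * card S"
    using n(4) b2 \<epsilon>S by (simp add: f_def)
  have "(K + S) - S \<subseteq> ((K + F n) - F n) \<union> (K + Q)" by (auto simp: S_def set_plus_def)
  then have "card ((K + S) - S) \<le> card (((K + F n) - F n) \<union> (K + Q))"
    using finF fins by (intro card_mono) (auto simp: finite_set_plus)
  also have "\<dots> \<le> card ((K + F n) - F n) + card K * q"
    using card_Un_le[of "(K + F n) - F n" "K + Q"] card_set_plus_le[OF fins(2,1)] unfolding q_def by linarith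
  finally have "real (card ((K + S) - S)) \<le> real (card ((K + F n) - F n)) + card K * q" by linarith
  also have "\<dots> \<le> \<delta> * f" using n(3) b3 by (simp add: f_def)
  also have "\<dots> \<le> \<delta> * card S" using fS \<delta> by (intro mult_left_mono) auto
  finally have c5: "real (card ((K + S) - S)) \<le> \<delta> * card S" .
  show ?thesis
    by (rule exI[of _ S]) (use finS finF c1 c2 c3 c4 c5 in \<open>auto simp: S_def\<close>)
qed

lemma irreducibility_distance_mono:
  assumes "irreducibility_distance X D" "D \<subseteq> D'" "finite D'"
  shows "irreducibility_distance X D'"
proof -
  have sub: "D + T + {g} \<subseteq> D' + T + {g}" for T g by (intro set_plus_mono2 assms(2) order_refl)
  show ?thesis unfolding irreducibility_distance_def
  proof (intro conjI allI impI)
    show "0 \<in> D'" using assms by (auto simp: irreducibility_distance_def)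
    fix T1 T2 B1 B2 g1 g2
    assume "finite T1" "finite T2" "B1 \<in> blocks X T1" "B2 \<in> blocks X T2" "(D' + T1 + {g1}) \<inter> (T2 + {g2}) = {}"
    moreover from this(5) have "(D + T1 + {g1}) \<inter> (T2 + {g2}) = {}" using sub[of T1 g1] by blast
    ultimately show "\<exists>x\<in>X. occurs_at T1 B1 x g1 \<and> occurs_at T2 B2 x g2"
      using assms(1) unfolding irreducibility_distance_def by blast
  qed (rule assms(3))
qed

lemma slots_exist:
  fixes \<beta> :: real
  assumes "0 < \<beta>" "\<beta> \<le> 1"
  shows "\<exists>sl :: 'g set \<Rightarrow> 'g set. \<forall>P. sl P \<subseteq> P \<and>
    (finite P \<longrightarrow> \<beta> * card P \<le> card (sl P) \<and> card (sl P) \<le> \<beta> * card P + 1)"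
proof (rule choice, rule allI)
  fix P :: "'g set"
  define n where "n = nat \<lceil>\<beta> * card P\<rceil>"
  have n1: "\<beta> * card P \<le> n" "n \<le> \<beta> * card P + 1" using assms by (auto simp: n_def)
  have "\<beta> * card P \<le> 1 * real (card P)" using assms by (intro mult_right_mono) auto
  then have "n \<le> card P" by (simp add: n_def ceiling_le_iff nat_le_iff)
  then obtain S where "S \<subseteq> P" "card S = n" by (meson obtain_subset_with_card_n)
  then show "\<exists>S\<subseteq>P. finite P \<longrightarrow> \<beta> * card P \<le> card S \<and> card S \<le> \<beta> * card P + 1" using n1 by auto
qed


text \<open>
  By \<open>1 - t \<le> exp (- t)\<close> the power is at most \<open>exp (- (2 ^ m / s))\<close> with \<open>s\<close> at most quadratic in \<open>m\<close>.
\<close>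

lemma many_labels:
  fixes \<epsilon> :: real and q :: nat
  assumes \<epsilon>: "0 < \<epsilon>" "\<epsilon> \<le> 1"
  obtains m0 where "\<And>m c. m0 \<le> m \<Longrightarrow> c \<le> q * m ^ 2 \<Longrightarrow> (1 - 1 / (1 / \<epsilon> + real c)) ^ (2 ^ m) \<le> \<epsilon> / 2"
proof -
  have "\<forall>\<^sub>F m in sequentially. ln (2 / \<epsilon>) * (1 / \<epsilon> + real q * real m ^ 2) \<le> 2 ^ m"
    by real_asymp
  then obtain m0 where m0: "\<And>m. m0 \<le> m \<Longrightarrow> ln (2 / \<epsilon>) * (1 / \<epsilon> + real q * real m ^ 2) \<le> 2 ^ m"
    unfolding eventually_sequentially by blast
  show ?thesis
  proof (rule that[of m0])
    fix m c :: nat assume m: "m0 \<le> m" and c: "c \<le> q * m ^ 2"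
    define s where "s = 1 / \<epsilon> + real c"
    have s1: "1 \<le> s" using \<epsilon> by (simp add: s_def add_increasing2)
    have "real c \<le> real (q * m ^ 2)" using c by (rule of_nat_mono)
    then have "s \<le> 1 / \<epsilon> + real q * real m ^ 2" by (simp add: s_def)
    then have "ln (2 / \<epsilon>) * s \<le> ln (2 / \<epsilon>) * (1 / \<epsilon> + real q * real m ^ 2)"
      using \<epsilon> by (intro mult_left_mono) auto
    also have "\<dots> \<le> 2 ^ m" by (rule m0[OF m])
    finally have ls: "ln (2 / \<epsilon>) \<le> 2 ^ m / s" using s1 by (simp add: le_divide_eq)
    have "1 + - (1 / s) \<le> exp (- (1 / s))" by (rule exp_ge_add_one_self)
    moreover have "0 \<le> 1 - 1 / s" using s1 by simp
    ultimately have "(1 - 1 / s) ^ (2 ^ m) \<le> exp (- (1 / s)) ^ (2 ^ m)" by (intro power_mono) auto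
    also have "\<dots> = exp (- (2 ^ m / s))" by (simp add: exp_of_nat_mult[symmetric])
    also have "\<dots> \<le> exp (- ln (2 / \<epsilon>))" using ls by simp
    also have "\<dots> = \<epsilon> / 2" using \<epsilon> by (simp add: exp_minus)
    finally show "(1 - 1 / (1 / \<epsilon> + real c)) ^ (2 ^ m) \<le> \<epsilon> / 2" by (simp add: s_def)
  qed
qed

theorem theorem5p1:
  fixes F :: "nat \<Rightarrow> 'g::group_add set"
    and \<Lambda> :: "'a set"
    and X :: "('g \<Rightarrow> 'a) set"
    and N :: nat
  assumes "countable (UNIV :: 'g set)" and "infinite (UNIV :: 'g set)"
    and "comparison_property TYPE('g)"
    and "folner_sequence F"
    and "finite \<Lambda>" and "subshift \<Lambda> X"
    and "aperiodic X" and "strongly_irreducible X"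
    and "N \<ge> 1" and "log 2 (real N) < entropy F X"
  shows "\<exists>\<pi>. factor_map \<Lambda> X {..<N} (full_shift {..<N}) \<pi>"
proof -
  note cnt = assms(1,2) and inf = assms(2) and F = assms(4) and fin = assms(5) and X = assms(6)
  have ne: "X \<noteq> {}"
  proof -
    obtain T B where "B \<in> blocks X T" using assms(7) unfolding aperiodic_def by (metis empty_subsetI finite.emptyI)
    then show ?thesis by (auto simp: blocks_def)
  qed
  have "\<Lambda> \<noteq> {}" using ne subshift_subset[OF X] by (auto simp: full_shift_def)
  then have card\<Lambda>: "1 \<le> card \<Lambda>" using fin by (simp add: Suc_le_eq card_gt_0_iff)
  obtain D0 where D0: "irreducibility_distance X D0" using assms(8) by (auto simp: strongly_irreducible_def)
  define D where "D = D0 \<union> uminus ` D0"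
  have finD0: "finite D0" using D0 by (simp add: irreducibility_distance_def)
  have irr: "irreducibility_distance X D"
    by (rule irreducibility_distance_mono[OF D0]) (auto simp: D_def finD0)
  have symD: "uminus ` D = D" by (auto simp: D_def image_Un image_image)
  \<comment> \<open>The numbers \<open>h1 < h2\<close> cut the gap between \<open>log 2 N\<close> and the entropy into thirds. One half of \<open>h1 - lN\<close>
    pays for the fillers and for the cells that tiles lose, the rest for the slots.\<close>
  define lN where "lN = log 2 (real N)"
  have lN0: "lN \<ge> 0" using assms(9) by (simp add: lN_def)
  define \<Delta> where "\<Delta> = (entropy F X - lN) / 3"
  have \<Delta>0: "\<Delta> > 0" using assms(10) by (simp add: \<Delta>_def lN_def)
  define h1 where "h1 = lN + \<Delta>"
  define h2 where "h2 = lN + 2 * \<Delta>"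
  have "3 * \<Delta> = entropy F X - lN" by (simp add: \<Delta>_def)
  then have h: "0 < h1" "h1 < h2" "0 < h2" "h2 < entropy F X"
    using lN0 \<Delta>0 unfolding h1_def h2_def by linarith+
  have ent: "\<forall>\<^sub>F n in sequentially. 2 powr (h2 * card (F n)) \<le> card (blocks X (F n))"
    using order_tendstoD(1)[OF entropy_tendsto[OF F cnt fin X ne] h(4)]
  proof eventually_elim
    case (elim n)
    have finF: "finite (F n)" "0 < card (F n)" using F by (auto simp: folner_sequence_def card_gt_0_iff)
    have pos: "0 < real (card (blocks X (F n)))" using card_blocks_pos[OF X fin finF(1) ne] by linarith
    have "h2 * card (F n) \<le> log 2 (card (blocks X (F n)))" using elim finF by (simp add: less_divide_eq)
    then have "2 powr (h2 * card (F n)) \<le> 2 powr (log 2 (card (blocks X (F n))))" by (intro powr_mono) auto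
    then show ?case using pos by simp
  qed
  define l where "l = log 2 (card \<Lambda>)"
  have l0: "l \<ge> 0" using card\<Lambda> by (simp add: l_def)
  define \<delta> where "\<delta> = \<Delta> / (4 * (l + 1))"
  define \<epsilon>\<^sub>1 where "\<epsilon>\<^sub>1 = min (1 / 2) \<delta>"
  define \<beta> where "\<beta> = min (1 / 2) (\<Delta> / (8 * (lN + 1)))"
  have \<delta>0: "\<delta> > 0" using \<Delta>0 l0 by (simp add: \<delta>_def)
  have \<epsilon>1: "0 < \<epsilon>\<^sub>1" "\<epsilon>\<^sub>1 \<le> 1 / 2" "\<epsilon>\<^sub>1 \<le> \<delta>"
    using \<delta>0 unfolding \<epsilon>\<^sub>1_def by (simp_all only: min.cobounded1 min.cobounded2, simp?)
  have \<beta>: "0 < \<beta>" "\<beta> \<le> 1 / 2" "\<beta> \<le> \<Delta> / (8 * (lN + 1))"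
    using \<Delta>0 lN0 unfolding \<beta>_def by (simp_all only: min.cobounded1 min.cobounded2, simp?)
  have l\<delta>: "l * (\<epsilon>\<^sub>1 + \<delta>) \<le> \<Delta> / 2"
  proof -
    have "l * (\<epsilon>\<^sub>1 + \<delta>) \<le> (l + 1) * (2 * \<delta>)" using \<epsilon>1 l0 \<delta>0 by (intro mult_mono) auto
    also have "\<dots> = (\<delta> * (4 * (l + 1))) / 2" by (simp add: algebra_simps)
    also have "\<delta> * (4 * (l + 1)) = \<Delta>" unfolding \<delta>_def by (rule nonzero_eq_divide_eq[THEN iffD1, OF _ refl]) (use l0 in \<open>simp add: add_nonneg_eq_0_iff\<close>)
    finally show ?thesis .
  qed
  have l\<beta>: "lN * \<beta> \<le> \<Delta> / 8"
  proof -
    have "lN * \<beta> \<le> (lN + 1) * (\<Delta> / (8 * (lN + 1)))" using \<beta> lN0 by (intro mult_mono) auto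
    also have "\<dots> = (\<Delta> / (8 * (lN + 1)) * (8 * (lN + 1))) / 8"
    proof -
      have "(lN + 1) * a = (a * (8 * (lN + 1))) / 8" for a by (simp add: algebra_simps)
      then show ?thesis .
    qed
    also have "\<Delta> / (8 * (lN + 1)) * (8 * (lN + 1)) = \<Delta>" by (rule nonzero_eq_divide_eq[THEN iffD1, OF _ refl]) (use lN0 in \<open>simp add: add_nonneg_eq_0_iff\<close>)
    finally show ?thesis .
  qed
  obtain U Z E V u v0 v1 where fs: "filler_system \<Lambda> X D U Z E V u v0 v1 \<delta>"
    by (rule filler_system_exists[OF F inf fin X irr symD h(3) ent \<delta>0])
  interpret fs: filler_system \<Lambda> X D U Z E V u v0 v1 \<delta> by (rule fs)
  \<comment> \<open>The overlap \<open>\<epsilon>\<close> depends on \<open>E\<close> but not on the markers: by \<open>density_leftover\<close> the leftover density is then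
    at most \<open>\<beta> / 8\<close>.\<close>
  define \<epsilon> where "\<epsilon> = min (\<epsilon>\<^sub>1 / 2) (\<beta> * \<epsilon>\<^sub>1 / (168 * (real (card E) + 1)))"
  have cE: "0 < 168 * (real (card E) + 1)" by simp
  have \<epsilon>: "0 < \<epsilon>" "\<epsilon> \<le> \<epsilon>\<^sub>1 / 2" "\<epsilon> \<le> \<beta> * \<epsilon>\<^sub>1 / (168 * (real (card E) + 1))"
    using \<epsilon>1 \<beta> cE unfolding \<epsilon>_def by (simp_all only: min.cobounded1 min.cobounded2, simp?)
  have \<epsilon>2: "\<epsilon> \<le> 1 / 2" "\<epsilon> < 1" "\<epsilon> \<le> 1" "\<epsilon>\<^sub>1 \<le> 1" using \<epsilon> \<epsilon>1 by auto
  define E3 where "E3 = uminus ` U + D"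
  define E4 where "E4 = uminus ` Z + (uminus ` E + E3)"
  define Er where "Er = {0} \<union> E4 \<union> (E4 + V) \<union> (uminus ` V + D) \<union> (uminus ` V + (D + V))"
  have finE4: "finite E4"
    unfolding E4_def E3_def by (intro finite_set_plus finite_imageI fs.finU fs.finZ fs.finE fs.D(1))
  have finEr: "finite Er"
    unfolding Er_def by (intro finite_UnI finite_set_plus finite_imageI finE4 fs.finV fs.D(1)) simp
  obtain T A0 where T: "finite T" "A0 \<in> blocks X T" "aperiodic_block (Er - {0}) T A0"
    using assms(7)[unfolded aperiodic_def, rule_format, of "Er - {0}"] finEr by auto
  \<comment> \<open>The zone \<open>Q'\<close> has at most \<open>q * card A ^ 2\<close> elements, whatever \<open>A\<close> will be; this is why the number
    \<open>m0\<close> of elements that suffices for the labels can be fixed before \<open>A\<close>.\<close>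
  define q0 where "q0 = card T + card V"
  define q where "q = 1 + q0 + card D * q0 + card E4 * q0"
  obtain m0 where m0: "\<And>m c. m0 \<le> m \<Longrightarrow> c \<le> q * m ^ 2 \<Longrightarrow> (1 - 1 / (1 / \<epsilon> + real c)) ^ (2 ^ m) \<le> \<epsilon> / 2"
    using many_labels[OF \<epsilon>(1) \<epsilon>2(3), of q] by blast
  obtain A where A: "finite A" "max m0 1 \<le> card A" "A \<inter> (Er + T) = {}"
    "\<And>a a'. a \<in> A \<Longrightarrow> a' \<in> A \<Longrightarrow> a \<noteq> a' \<Longrightarrow> a \<notin> Er + {a'}"
    "\<And>p. A + {p} \<subseteq> Er + (T \<union> A) \<Longrightarrow> p \<in> Er"
    by (rule rigid_set[OF inf finEr T(1), of "max m0 1"]) blast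
  define Q where "Q = T \<union> (V + A)"
  define Q' where "Q' = {0} \<union> Q \<union> (D + Q) \<union> (uminus ` A + (E4 + Q))"
  have ms: "marker_system \<Lambda> X D U Z E V u v0 v1 \<delta> E3 E4 Er T A Q Q' A0"
  proof (rule marker_system.intro[OF fs], rule marker_system_axioms.intro)
    show "A \<noteq> {}" using A(2) by auto
  qed (fact E3_def E4_def Er_def T A Q_def Q'_def)+
  interpret ms: marker_system \<Lambda> X D U Z E V u v0 v1 \<delta> E3 E4 Er T A Q Q' A0 by (rule ms)
  define m where "m = card A"
  have m1: "1 \<le> m" "m0 \<le> m" using A(2) by (auto simp: m_def)
  have cQ: "card Q \<le> q0 * m"
  proof -
    have "card Q \<le> card T + card V * m"
      unfolding Q_def m_def using card_Un_le[of T "V + A"] card_set_plus_le[OF fs.finV A(1)] by linarith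
    also have "\<dots> \<le> card T * m + card V * m" using m1 by simp
    finally show ?thesis by (simp add: q0_def algebra_simps)
  qed
  have cQ': "card Q' \<le> q * m ^ 2"
  proof -
    have "card Q' \<le> card ({0} :: 'g set) + card Q + card (D + Q) + card (uminus ` A + (E4 + Q))"
      unfolding Q'_def using card_Un_le[of "{0} \<union> Q \<union> (D + Q)" "uminus ` A + (E4 + Q)"]
        card_Un_le[of "{0} \<union> Q" "D + Q"] card_Un_le[of "{0}" Q] by linarith
    also have "\<dots> \<le> 1 + card Q + card D * card Q + m * (card E4 * card Q)"
    proof -
      have "card (uminus ` A + (E4 + Q)) \<le> card (uminus ` A) * card (E4 + Q)"
        using A(1) finE4 ms.finQ by (intro card_set_plus_le finite_set_plus finite_imageI)
      also have "\<dots> \<le> m * (card E4 * card Q)"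
        unfolding card_uminus_image m_def using card_set_plus_le[OF finE4 ms.finQ] by (rule mult_left_mono) simp
      finally show ?thesis using card_set_plus_le[OF fs.D(1) ms.finQ] by simp
    qed
    also have "\<dots> \<le> m ^ 2 + q0 * m ^ 2 + card D * (q0 * m ^ 2) + card E4 * (q0 * m ^ 2)"
    proof -
      have "m \<le> m ^ 2" by (simp add: power2_eq_square)
      then have "q0 * m \<le> q0 * m ^ 2" by (rule mult_le_mono2)
      with cQ have "card Q \<le> q0 * m ^ 2" by (rule le_trans)
      moreover have "m * (card E4 * card Q) \<le> card E4 * (q0 * m ^ 2)"
        using mult_le_mono2[OF cQ, of "m * card E4"] by (simp add: power2_eq_square algebra_simps)
      moreover have "1 \<le> m ^ 2" using m1 by simp
      ultimately show ?thesis by (intro add_mono mult_le_mono2)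
    qed
    also have "\<dots> = q * m ^ 2" by (simp add: q_def algebra_simps)
    finally show ?thesis .
  qed
  define k :: nat where "k = 2 ^ m"
  define \<gamma> where "\<gamma> = 1 / (1 / \<epsilon> + real (card Q'))"
  have \<gamma>k: "(1 - \<gamma>) ^ k \<le> \<epsilon> / 2" unfolding \<gamma>_def k_def by (rule m0[OF m1(2) cQ'])
  define K0 where "K0 = D \<union> (Z + uminus ` Z)"
  have finK0: "finite K0" unfolding K0_def by (intro finite_UnI finite_set_plus finite_imageI fs.D(1) fs.finZ)
  obtain m2 :: nat where m2: "4 * lN / \<Delta> \<le> m2" using real_arch_simple by blast
  define Pr where "Pr S \<longleftrightarrow> 2 powr (h1 * card S) \<le> card (blocks X S) \<and> m2 \<le> card S \<and>
     real (card Q') \<le> \<epsilon> * card S \<and> real (card {p \<in> S. \<exists>e\<in>K0. e + p \<notin> S}) \<le> \<epsilon> * card S" for S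
  have \<epsilon>h: "0 < \<epsilon> / 2" using \<epsilon> by simp
  obtain TT C R where TT: "\<And>j. j < k \<Longrightarrow> finite (TT j) \<and> TT j \<noteq> {} \<and> Q' \<subseteq> TT j \<and> Pr (TT j)"
    and qt: "quasi_tiling k TT C R \<epsilon> Q'" and dens: "density_le F (- covered k TT C) ((1 - \<gamma>) ^ k + \<epsilon> / 2)"
  proof (rule quasi_tiling_exists[where k = k and P = Pr, OF F cnt \<epsilon>(1) \<epsilon>2(2) \<epsilon>h \<gamma>_def])
    fix K :: "'g set" and \<delta>' :: real assume "finite K" "\<delta>' > 0"
    then show "\<exists>S. finite S \<and> S \<noteq> {} \<and> Q' \<subseteq> S \<and> Pr S \<and> real (card ((K + S) - S)) \<le> \<delta>' * card S"
      unfolding Pr_def by (intro tile_exists[OF F inf fin X h(1,2) ent \<epsilon>(1) ms.finQ' _ finK0])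
  qed blast
  have dens': "density_le F (- covered k TT C) \<epsilon>"
    by (rule density_le_mono[OF F dens order_refl]) (use \<gamma>k in simp)
  have finPow: "finite (Pow A)" and "card {..<k} \<le> card (Pow A)"
    using A(1) by (simp_all add: card_Pow k_def m_def)
  from card_le_inj[OF finite_lessThan this] obtain J where J: "J ` {..<k} \<subseteq> Pow A" "inj_on J {..<k}" by blast
  have "\<beta> \<le> 1" using \<beta>(2) by simp
  from slots_exist[OF \<beta>(1) this] obtain sl :: "'g set \<Rightarrow> 'g set" where "\<forall>P. sl P \<subseteq> P \<and>
    (finite P \<longrightarrow> \<beta> * card P \<le> card (sl P) \<and> card (sl P) \<le> \<beta> * card P + 1)" by (rule exE)
  then have sl: "\<And>P. sl P \<subseteq> P"
    "\<And>P. finite P \<Longrightarrow> \<beta> * card P \<le> card (sl P) \<and> card (sl P) \<le> \<beta> * card P + 1"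
    by blast+
  have "\<forall>P. \<exists>f. (\<exists>j<k. P \<subseteq> TT j \<and> (1 - \<epsilon>\<^sub>1) * real (card (TT j)) \<le> real (card P)) \<longrightarrow>
      inj_on f ((P \<rightarrow>\<^sub>E {..<N}) \<times> (sl P \<rightarrow>\<^sub>E {..<N})) \<and>
      f ` ((P \<rightarrow>\<^sub>E {..<N}) \<times> (sl P \<rightarrow>\<^sub>E {..<N})) \<subseteq> fs.structured P"
  proof
    fix P
    show "\<exists>f. (\<exists>j<k. P \<subseteq> TT j \<and> (1 - \<epsilon>\<^sub>1) * real (card (TT j)) \<le> real (card P)) \<longrightarrow>
      inj_on f ((P \<rightarrow>\<^sub>E {..<N}) \<times> (sl P \<rightarrow>\<^sub>E {..<N})) \<and>
      f ` ((P \<rightarrow>\<^sub>E {..<N}) \<times> (sl P \<rightarrow>\<^sub>E {..<N})) \<subseteq> fs.structured P"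
    proof (cases "\<exists>j<k. P \<subseteq> TT j \<and> (1 - \<epsilon>\<^sub>1) * real (card (TT j)) \<le> real (card P)")
      case True
      then obtain j where j: "j < k" "P \<subseteq> TT j" "(1 - \<epsilon>\<^sub>1) * real (card (TT j)) \<le> real (card P)" by blast
      define t where "t = real (card (TT j))"
      have Tj: "finite (TT j)" "2 powr (h1 * card (TT j)) \<le> card (blocks X (TT j))" "m2 \<le> card (TT j)"
        using TT[OF j(1)] by (auto simp: Pr_def)
      have finP: "finite P" using j(2) Tj(1) by (rule finite_subset)
      have Pt: "real (card P) \<le> t" unfolding t_def using Tj(1) j(2) by (intro of_nat_mono card_mono)
      have "4 * lN / \<Delta> \<le> t" using m2 Tj(3) by (simp add: t_def)
      then have lt: "lN \<le> \<Delta> / 4 * t" using \<Delta>0 by (simp add: divide_le_eq mult.commute)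
      have "real (card P) + real (card (sl P)) \<le> t + (\<beta> * t + 1)"
      proof -
        have "\<beta> * real (card P) \<le> \<beta> * t" using Pt \<beta> by (intro mult_left_mono) auto
        then show ?thesis using sl(2)[OF finP] Pt by linarith
      qed
      then have "lN * (real (card P) + real (card (sl P))) \<le> lN * (t + (\<beta> * t + 1))"
        using lN0 by (rule mult_left_mono)
      also have "\<dots> = lN * t + (lN * \<beta>) * t + lN" by (simp add: algebra_simps)
      also have "\<dots> \<le> lN * t + (\<Delta> / 8) * t + \<Delta> / 4 * t"
        using l\<beta> lt by (intro add_mono mult_right_mono) (auto simp: t_def)
      also have "\<dots> \<le> (lN + \<Delta> / 2) * t"
      proof -
        have "0 \<le> \<Delta> * t" using \<Delta>0 by (simp add: t_def)
        then show ?thesis by (simp add: algebra_simps)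
      qed
      also have "\<dots> \<le> (h1 - l * (\<epsilon>\<^sub>1 + \<delta>)) * t"
        using l\<delta> by (intro mult_right_mono) (auto simp: h1_def t_def)
      finally have room: "log 2 N * (real (card P) + real (card (sl P))) \<le> (h1 - log 2 (card \<Lambda>) * (\<epsilon>\<^sub>1 + \<delta>)) * card (TT j)"
        by (simp add: lN_def l_def t_def)
      show ?thesis using fs.capacity[OF Tj(1) j(2,3) sl(1) assms(9) Tj(2) room] by blast
    qed blast
  qed
  from choice[OF this] obtain enc where enc:
    "\<forall>P. (\<exists>j<k. P \<subseteq> TT j \<and> (1 - \<epsilon>\<^sub>1) * real (card (TT j)) \<le> real (card P)) \<longrightarrow>
      inj_on (enc P) ((P \<rightarrow>\<^sub>E {..<N}) \<times> (sl P \<rightarrow>\<^sub>E {..<N})) \<and>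
      enc P ` ((P \<rightarrow>\<^sub>E {..<N}) \<times> (sl P \<rightarrow>\<^sub>E {..<N})) \<subseteq> fs.structured P" by blast
  have mt: "marked_tiling \<Lambda> X D U Z E V u v0 v1 \<delta> E3 E4 Er T A Q Q' A0 k TT C R \<epsilon> \<epsilon>\<^sub>1 N sl enc J"
  proof (rule marked_tiling.intro[OF ms], rule marked_tiling_axioms.intro)
    show "quasi_tiling k TT C R \<epsilon> Q'" by (rule qt)
    show "inj_on J {..<k}" by (rule J(2))
    show "sl P \<subseteq> P" for P by (rule sl(1))
    fix j assume j: "j < k"
    show "finite (TT j)" "Q' \<subseteq> TT j" using TT[OF j] by auto
    show "J j \<subseteq> A" using J(1) j by auto
    fix P assume "P \<subseteq> TT j" "(1 - \<epsilon>\<^sub>1) * real (card (TT j)) \<le> real (card P)"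
    then show "inj_on (enc P) ((P \<rightarrow>\<^sub>E {..<N}) \<times> (sl P \<rightarrow>\<^sub>E {..<N})) \<and>
      enc P ` ((P \<rightarrow>\<^sub>E {..<N}) \<times> (sl P \<rightarrow>\<^sub>E {..<N})) \<subseteq> fs.structured P"
      using enc j by blast
  qed
  interpret mt: marked_tiling \<Lambda> X D U Z E V u v0 v1 \<delta> E3 E4 Er T A Q Q' A0 k TT C R \<epsilon> \<epsilon>\<^sub>1 N sl enc J by (rule mt)
  have K0: "mt.K0 = K0" by (simp add: mt.K0_def K0_def)
  have dbad: "density_le F {b. mt.bad b} (7 * \<epsilon>)"
    by (rule mt.density_bad[OF F \<epsilon>(1) \<epsilon>2(1) dens']) (use TT in \<open>auto simp: Pr_def K0\<close>)
  have dL: "density_le F mt.leftover (\<beta> / 8)"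
  proof (rule density_le_mono[OF F mt.density_leftover[OF F \<epsilon>(1) \<epsilon>2(1) \<epsilon>(2) \<epsilon>2(4) dbad] order_refl])
    have "\<epsilon> * (168 * (real (card E) + 1)) \<le> \<beta> * \<epsilon>\<^sub>1" using \<epsilon>(3) cE by (simp only: pos_le_divide_eq)
    moreover have "\<epsilon> * (168 * real (card E)) \<le> \<epsilon> * (168 * (real (card E) + 1))"
      using \<epsilon>(1) by (intro mult_left_mono) auto
    ultimately have "\<epsilon> * (168 * real (card E)) \<le> \<beta> * \<epsilon>\<^sub>1" by linarith
    then show "3 * (real (card E) * (7 * \<epsilon>)) / \<epsilon>\<^sub>1 \<le> \<beta> / 8"
      using \<epsilon>1(1) by (simp add: pos_divide_le_eq) (simp add: algebra_simps)
  qed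
  obtain B where B: "finite B" "\<forall>h. card {t \<in> B. t + h \<in> mt.leftover} < card {t \<in> B. t + h \<in> mt.slots}"
    using mt.unbalanced[OF F \<beta>(1,2) _ dL] sl(2)[OF mt.finite_P] by blast
  obtain \<eta> H K where eta: "finite H" "finite K"
    "\<And>g. g \<in> mt.leftover \<Longrightarrow> \<eta> g \<in> H" "\<And>g. g \<in> mt.leftover \<Longrightarrow> \<eta> g + g \<in> mt.slots" "inj_on (\<lambda>g. \<eta> g + g) mt.leftover"
    "\<And>g g'. g \<in> mt.leftover \<Longrightarrow> g' \<in> mt.leftover \<Longrightarrow>
      (\<forall>t\<in>K. (t + g \<in> mt.leftover \<longleftrightarrow> t + g' \<in> mt.leftover) \<and> (t + g \<in> mt.slots \<longleftrightarrow> t + g' \<in> mt.slots)) \<Longrightarrow> \<eta> g = \<eta> g'"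
    by (rule comparison_matching[OF cnt assms(3) B(1), of mt.leftover mt.slots]) (use B(2) in blast)+
  have finKD: "finite mt.KD"
    unfolding mt.KD_def by (intro finite_UnI finite_set_plus finite_imageI ms.finQ mt.finKO mt.finTA)
  show ?thesis
  proof (rule factor_map_from_code[OF X assms(9)])
    show "finite ((Q + (mt.KO + K)) \<union> (mt.KD + H) \<union> mt.KD)"
      by (intro finite_UnI finite_set_plus ms.finQ mt.finKO eta(1,2) finKD)
    show "\<exists>x. mt.encodes \<eta> x y" if "y \<in> full_shift {..<N}" for y
      by (rule mt.encodes_exists[OF that assms(9) eta(5)])
    show "x \<in> X \<and> y \<in> full_shift {..<N}" if "mt.encodes \<eta> x y" for x y
      using that by (simp add: mt.encodes_def)
    fix x y x' y' g g'
    assume xy: "mt.encodes \<eta> x y" "mt.encodes \<eta> x' y'"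
      and eq: "\<forall>t\<in>(Q + (mt.KO + K)) \<union> (mt.KD + H) \<union> mt.KD. x (t + g) = x' (t + g')"
    show "y g = y' g'"
    proof (rule mt.decode[OF xy assms(9) eta(5)])
      show "\<eta> g \<in> H" "\<eta> g + g \<in> mt.slots" if "g \<in> mt.leftover" for g by (rule eta(3)[OF that], rule eta(4)[OF that])
      show "\<forall>t\<in>(Q + (mt.KO + K)) \<union> (mt.KD + H) \<union> mt.KD. x (t + g) = x' (t + g')" by (rule eq)
    qed (rule eta(6))
  qed
qed

end
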